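(* Let $p=6$ and let $(\mathcal G_\ell)_{\ell>0}$ be a family of compact connected metric graphs without terminal edges and without cycle coverings, whose longest bridging edge has variable length $\ell$, the remaining part of the graph being fixed in the sense specified in the context. Then $$\lim_{\ell\to+\infty}\mu_1(\mathcal G_\ell,6)=\frac{\pi}{2}\qquad\text{and}\qquad\liminf_{\ell\to0}\mu_1(\mathcal G_\ell,6)\ge\pi.$$
   Context: A compact metric graph $\mathcal G$ is formed by finitely many edges (bounded intervals $I_e=[0,\ell_e]$, $0<\ell_e<\infty$) with some endpoints glued together at vertices; self-loops and multiple edges are allowed. All graphs are connected. $|\mathcal G|=\sum_e\ell_e$ is the total length. Integrals and $L^p(\mathcal G)$ norms $\|\cdot\|_p$ are defined edge by edge with Lebesgue measure. $H^1(\mathcal G)$ is the space of continuous $u:\mathcal G\to\mathbb C$ whose restriction $u_e$ to each edge is in $H^1(I_e)$. For $\mu>0$, $H^1_\mu(\mathcal G)=\{u\in H^1(\mathcal G):\|u\|_2^2=\mu\}$. A terminal edge is an edge ending at a vertex of degree 1. $\mathcal G$ admits a cycle covering if it can be covered by cycles, a cycle being a closed path (loop) without edge repetitions. A bridging edge is an edge whose removal disconnects the graph into two disjoint components. A graph with no terminal edge and no cycle covering has at least one bridging edge. The family $\mathcal G_\ell$: the underlying combinatorial graph (with no terminal edge and no cycle covering) is the same for all $\ell$; the lengths of all non-bridging edges are fixed, independent of $\ell$; a distinguished bridging edge has length $\ell$; all other bridging edges (if any) have length at most $\ell$ and bounded uniformly in $\ell$. (If there is exactly one bridging edge, this means $\mathcal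 G_\ell$ consists of two fixed compact graphs $\Gamma_1,\Gamma_2$, independent of $\ell$, joined by an edge of length $\ell$.) Let $E(u)=\frac12\|u'\|_2^2-\frac16\|u\|_6^6$ and $\kappa_\mu=\sqrt{\mu/|\mathcal G|}$ (constant function). $\mu_1(\mathcal G,6)>0$ denotes the threshold mass for local minimality of the constants: $\kappa_\mu$ is a local minimizer (in the $H^1$ topology) of $E$ in $H^1_\mu(\mathcal G)$ for $\mu<\mu_1(\mathcal G,6)$, and is not for $\mu>\mu_1(\mathcal G,6)$. In the paper it is defined explicitly by $\mu_1(\mathcal G,6)=|\mathcal G|\left(\lambda_2(\mathcal G)/4\right)^{1/2}$, where $\lambda_2(\mathcal G)=\inf\{\int_{\mathcal G}|\varphi'|^2dx/\int_{\mathcal G}|\varphi|^2dx:\ \varphi\in H^1(\mathcal G)\setminus\{0\},\ \int_{\mathcal G}\varphi\,dx=0\}$. *)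

theory Defs
  imports
    "HOL-Analysis.Analysis"
    "HOL-Library.Liminf_Limsup"
    "Graph_Theory.Digraph_Component"
begin

section \<open>Compact metric graphs\<close>

text \<open>
  A metric graph is a finite multigraph \<open>G\<close> (loops and parallel edges allowed) together with
  edge lengths \<open>len\<close>.  The edges of \<open>G\<close> are unoriented; the direction of an arc \<open>e\<close> only fixes
  the parametrisation of the edge by the interval \<open>{0..len e}\<close>, where \<open>0\<close> corresponds to the
  vertex \<open>tail G e\<close> and \<open>len e\<close> to \<open>head G e\<close>.  Connectedness is that of the library: any two
  vertices are joined by a path in which arcs may be traversed in both directions.
\<close>

locale compact_metric_graph = fin_digraph G
  for G :: "('v, 'e) pre_digraph" (structure) and len :: "'e \<Rightarrow> real" +
  assumes graph_connected: "Digraph_Component.connected G"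
    and len_pos: "e \<in> arcs G \<Longrightarrow> len e > 0"

definition total_length :: "('v, 'e) pre_digraph \<Rightarrow> ('e \<Rightarrow> real) \<Rightarrow> real" where
  "total_length G len = (\<Sum>e\<in>arcs G. len e)"

text \<open>The degree in the unoriented sense; a loop contributes 2.\<close>

definition degree :: "('v, 'e) pre_digraph \<Rightarrow> 'v \<Rightarrow> nat" where
  "degree G v = in_degree G v + out_degree G v"

definition terminal_edge :: "('v, 'e) pre_digraph \<Rightarrow> 'e \<Rightarrow> bool" where
  "terminal_edge G e \<longleftrightarrow> e \<in> arcs G \<and> (degree G (tail G e) = 1 \<or> degree G (head G e) = 1)"

text \<open>In a connected graph, the removal of one edge leaves at most two components.\<close>

definition bridging_edge :: "('v, 'e) pre_digraph \<Rightarrow> 'e \<Rightarrow> bool" where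
  "bridging_edge G e \<longleftrightarrow> e \<in> arcs G \<and> \<not> Digraph_Component.connected (pre_digraph.del_arc G e)"

text \<open>
  Walks in the unoriented graph are arc walks in the digraph where each edge \<open>e\<close> is replaced by
  \<open>(e, True)\<close>, traversed from tail to head, and \<open>(e, False)\<close>, traversed from head to tail.
\<close>

definition both_directions :: "('v, 'e) pre_digraph \<Rightarrow> ('v, 'e \<times> bool) pre_digraph" where
  "both_directions G =
    \<lparr> verts = verts G, arcs = arcs G \<times> UNIV,
      tail = (\<lambda>(e, b). if b then tail G e else head G e),
      head = (\<lambda>(e, b). if b then head G e else tail G e) \<rparr>"

text \<open>Vertices may be repeated in a cycle, but no edge, not even in opposite directions.\<close>

definition graph_cycle :: "('v, 'e) pre_digraph \<Rightarrow> ('e \<times> bool) list \<Rightarrow> bool" where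
  "graph_cycle G p \<longleftrightarrow>
    p \<noteq> [] \<and> (\<exists>v. pre_digraph.awalk (both_directions G) v p v) \<and> distinct (map fst p)"

definition has_cycle_covering :: "('v, 'e) pre_digraph \<Rightarrow> bool" where
  "has_cycle_covering G \<longleftrightarrow>
    (\<exists>C. (\<forall>p\<in>C. graph_cycle G p) \<and> arcs G \<subseteq> (\<Union>p\<in>C. fst ` set p))"

section \<open>Sobolev functions\<close>

definition L2_interval :: "real \<Rightarrow> (real \<Rightarrow> complex) \<Rightarrow> bool" where
  "L2_interval l f \<longleftrightarrow> f \<in> borel_measurable (lebesgue_on {0..l}) \<and>
    integrable (lebesgue_on {0..l}) (\<lambda>x. (norm (f x))\<^sup>2)"

text \<open>
  \<open>g\<close> is a square integrable weak derivative of \<open>f\<close> on the interval from \<open>0\<close> to \<open>l\<close>, tested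
  against continuously differentiable functions with compact support in the open interval, as in
  Brezis, Functional Analysis, Sobolev Spaces and Partial Differential Equations, Section 8.2.
\<close>

definition has_weak_deriv :: "real \<Rightarrow> (real \<Rightarrow> complex) \<Rightarrow> (real \<Rightarrow> complex) \<Rightarrow> bool" where
  "has_weak_deriv l f g \<longleftrightarrow> L2_interval l g \<and>
    (\<forall>\<phi> :: real \<Rightarrow> real.
      \<phi> C1_differentiable_on UNIV \<longrightarrow>
      compact (closure {x. \<phi> x \<noteq> 0}) \<longrightarrow> closure {x. \<phi> x \<noteq> 0} \<subseteq> {0<..<l} \<longrightarrow>
      (\<integral>x. deriv \<phi> x *\<^sub>R f x \<partial>lebesgue_on {0..l}) = - (\<integral>x. \<phi> x *\<^sub>R g x \<partial>lebesgue_on {0..l}))"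

definition H1_interval :: "real \<Rightarrow> (real \<Rightarrow> complex) \<Rightarrow> bool" where
  "H1_interval l f \<longleftrightarrow> L2_interval l f \<and> (\<exists>g. has_weak_deriv l f g)"

text \<open>Determined up to a null set; only integrals of it are used.\<close>

definition weak_deriv :: "real \<Rightarrow> (real \<Rightarrow> complex) \<Rightarrow> real \<Rightarrow> complex" where
  "weak_deriv l f = (SOME g. has_weak_deriv l f g)"

text \<open>
  A function on the graph is a family \<open>u\<close> of functions on the edges; only the values \<open>u e x\<close> with
  \<open>e \<in> arcs G\<close> and \<open>x \<in> {0..len e}\<close> matter.  It is a continuous function on the graph iff it is
  continuous on each edge and the endpoint values agree at every vertex; \<open>val v\<close> is the common
  value at \<open>v\<close>.
\<close>

definition graph_continuous ::
  "('v, 'e) pre_digraph \<Rightarrow> ('e \<Rightarrow> real) \<Rightarrow> ('e \<Rightarrow> real \<Rightarrow> complex) \<Rightarrow> bool" where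
  "graph_continuous G len u \<longleftrightarrow>
    (\<forall>e\<in>arcs G. continuous_on {0..len e} (u e)) \<and>
    (\<exists>val. \<forall>e\<in>arcs G. u e 0 = val (tail G e) \<and> u e (len e) = val (head G e))"

definition H1_graph ::
  "('v, 'e) pre_digraph \<Rightarrow> ('e \<Rightarrow> real) \<Rightarrow> ('e \<Rightarrow> real \<Rightarrow> complex) set" where
  "H1_graph G len = {u. graph_continuous G len u \<and> (\<forall>e\<in>arcs G. H1_interval (len e) (u e))}"

definition graph_integral ::
  "('v, 'e) pre_digraph \<Rightarrow> ('e \<Rightarrow> real) \<Rightarrow> ('e \<Rightarrow> real \<Rightarrow> 'a::{banach, second_countable_topology}) \<Rightarrow> 'a"
  where
  "graph_integral G len u = (\<Sum>e\<in>arcs G. \<integral>x. u e x \<partial>lebesgue_on {0..len e})"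

section \<open>The spectral gap and the threshold mass\<close>

definition rayleigh_quotient ::
  "('v, 'e) pre_digraph \<Rightarrow> ('e \<Rightarrow> real) \<Rightarrow> ('e \<Rightarrow> real \<Rightarrow> complex) \<Rightarrow> real" where
  "rayleigh_quotient G len u =
    graph_integral G len (\<lambda>e x. (norm (weak_deriv (len e) (u e) x))\<^sup>2) /
    graph_integral G len (\<lambda>e x. (norm (u e x))\<^sup>2)"

definition lambda2 :: "('v, 'e) pre_digraph \<Rightarrow> ('e \<Rightarrow> real) \<Rightarrow> real" where
  "lambda2 G len = Inf {rayleigh_quotient G len u | u. u \<in> H1_graph G len \<and>
    (\<exists>e\<in>arcs G. \<exists>x\<in>{0..len e}. u e x \<noteq> 0) \<and> graph_integral G len u = 0}"

text \<open>The threshold mass for the exponent \<open>p = 6\<close>.\<close>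

definition mu1 :: "('v, 'e) pre_digraph \<Rightarrow> ('e \<Rightarrow> real) \<Rightarrow> real" where
  "mu1 G len = total_length G len * sqrt (lambda2 G len / 4)"

end

theory Submission
  imports Defs
begin

text \<open>
  Write \<open>L\<close> for the total length of the graph, so that \<open>mu1 = L sqrt (lambda2) / 2\<close>.  The theorem follows from three
  bounds on \<open>lambda2\<close>, valid for every compact connected metric graph with a bridge:

  \<^item> \<open>lambda2 \<ge> (\<pi> / L)\<^sup>2\<close>;
  \<^item> \<open>lambda2 \<le> (\<pi> / l)\<^sup>2\<close> if there is a bridge of length \<open>l\<close>;
  \<^item> \<open>lambda2 \<ge> (2 \<pi> / (L + 3 b))\<^sup>2\<close>, where \<open>b\<close> is the total length of all bridges.

  As \<open>l \<rightarrow> \<infinity>\<close>, the first two give \<open>\<pi> / 2 \<le> mu1 \<le> (\<pi> / 2) (L / l)\<close> with \<open>L / l \<rightarrow> 1\<close>.  As \<open>l \<rightarrow> 0\<close>, the length \<open>b\<close>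
  tends to \<open>0\<close>, whereas \<open>L\<close> stays above the fixed total length of the other edges, so the third one gives
  \<open>mu1 \<ge> \<pi> L / (L + 3 b) \<rightarrow> \<pi>\<close>.  That length is positive: if all edges were bridges, the graph
  would be a tree and would have a terminal edge (\<open>nonbridging_edge_exists\<close>).

  The upper bound comes from a test function that is a half-period of the cosine on the bridge and constant on both
  sides of it (\<open>bridge_test_function\<close>).  Both lower bounds come from one principle: if almost every value of \<open>u\<close>
  between its minimum and its maximum is attained at least \<open>N\<close> times on a graph of length \<open>T\<close>, then
  \<open>\<integral> |u'|\<^sup>2 \<ge> (N \<pi> / T)\<^sup>2 \<integral> (u - c)\<^sup>2\<close> for a median \<open>c\<close> of \<open>u\<close> (\<open>poincare_from_layers\<close>).  It is used in the form that
  the layer \<open>{\<alpha> < u < \<beta>}\<close> carries at least \<open>N (\<beta> - \<alpha>)\<close> of \<open>\<integral> |u'|\<close>.  Instead of a symmetric rearrangement, which would need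
  the coarea formula, the proof compares \<open>|u'|\<close> layer by layer with the slope that the optimal one-dimensional
  profile would have at the same level (\<open>layer_step\<close>).

  In a connected graph every value between the extremes is attained, which is the case \<open>N = 1\<close>.  If there are
  no bridges, every cut is crossed by two edges and \<open>N = 2\<close>.  A graph with bridges is reduced to that case by
  replacing each bridge of length \<open>l\<close> by two parallel edges of length \<open>2 l\<close>.  The energy of a function does
  not change if it is transported to both copies, the total length becomes \<open>L + 3 b\<close>, and the squared
  distance to constants does not decrease (\<open>weighted_poincare\<close>).
\<close>

section \<open>Energy carried by the level layers\<close>

lemma tan_increment_ge:
  fixes x y :: real
  assumes "0 \<le> x" "x \<le> y" "y < pi / 2"
  shows "tan y - tan x \<ge> (y - x) * (1 + (tan x)\<^sup>2)"
proof -
  have cx: "cos x > 0" and cy: "cos y > 0"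
    using assms by (auto intro!: cos_gt_zero_pi)
  have tx: "tan x \<ge> 0" and txy: "tan x \<le> tan y"
    using assms by (auto intro!: tan_pos_pi2_le tan_mono_le)
  have "tan (y - x) \<ge> y - x"
    using abs_tan_ge[of "y - x"] tan_pos_pi2_le[of "y - x"] assms by auto
  moreover have "tan y - tan x = tan (y - x) * (1 + tan x * tan y)"
  proof -
    have "cos (y - x) \<noteq> 0"
      using assms by (intro less_imp_neq[symmetric] cos_gt_zero_pi) auto
    moreover have "1 + tan x * tan y > 0"
      using tx txy by (simp add: add_pos_nonneg)
    ultimately show ?thesis
      using cx cy by (simp add: tan_diff field_simps)
  qed
  moreover have "(tan x)\<^sup>2 \<le> tan x * tan y"
    using tx txy by (simp add: power2_eq_square mult_left_mono)
  ultimately show ?thesis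
    using assms by (auto intro!: mult_mono)
qed

text \<open>
  Write \<open>s(t) = |{h \<ge> t}|\<close>, \<open>k = N \<kappa>\<close> and \<open>a(s) = k tan (\<kappa> s)\<close>, and consider
  \<open>F(t) = \<integral>\<^bsub>{h < t}\<^esub> (g\<^sup>2 - k\<^sup>2 h\<^sup>2) - N t\<^sup>2 a(s(t))\<close>.  The function \<open>a\<close> solves the Riccati equation
  \<open>N a' = k\<^sup>2 + a\<^sup>2\<close>; it is \<open>- h\<^sub>0' / h\<^sub>0\<close>, up to the factor \<open>N\<close>, for the extremal profile
  \<open>h\<^sub>0 = cos (\<kappa> s)\<close>.  If each layer \<open>{\<alpha> < h < \<beta>}\<close> carries at least \<open>N (\<beta> - \<alpha>)\<close> of \<open>\<integral> |g|\<close>, then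
  \<open>g\<^sup>2 \<ge> 2 \<psi> |g| - \<psi>\<^sup>2\<close> with \<open>\<psi> = \<alpha> a(s(\<beta>))\<close> shows that \<open>F\<close> decreases over \<open>[\<alpha>, \<beta>]\<close> at most by a
  quantity of second order in the increments of \<open>t\<close> and \<open>s\<close>.
\<close>

lemma (in finite_measure) layer_step:
  fixes h g :: "'a \<Rightarrow> real"
  assumes h[measurable]: "h \<in> borel_measurable M" and g[measurable]: "g \<in> borel_measurable M"
    and g2: "integrable M (\<lambda>x. (g x)\<^sup>2)"
    and N: "N > 0" and kap: "0 < \<kappa>" "\<kappa> * measure M (space M) < pi / 2"
    and range: "\<And>x. x \<in> space M \<Longrightarrow> 0 \<le> h x"
    and ab: "0 \<le> \<alpha>" "\<alpha> < \<beta>" 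
    and cross: "(\<integral>x. indicator {x. \<alpha> < h x \<and> h x < \<beta>} x * \<bar>g x\<bar> \<partial>M) \<ge> N * (\<beta> - \<alpha>)"
  defines "s t \<equiv> measure M {x \<in> space M. t \<le> h x}"
  defines "F t \<equiv> (\<integral>x. indicator {x. h x < t} x * ((g x)\<^sup>2 - (N * \<kappa>)\<^sup>2 * (h x)\<^sup>2) \<partial>M)
      - N * t\<^sup>2 * (N * \<kappa> * tan (\<kappa> * s t))"
  shows "F \<beta> - F \<alpha> \<ge> - (N\<^sup>2 * \<kappa> * tan (\<kappa> * measure M (space M)) * (\<beta> - \<alpha>)\<^sup>2)
     - 2 * (N * \<kappa>)\<^sup>2 * \<beta> * (\<beta> - \<alpha>) * (s \<alpha> - s \<beta>)"
proof -
  define a where "a t = N * \<kappa> * tan (\<kappa> * s t)" for t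
  define q where "q = s \<alpha> - s \<beta>"
  define L where "L = {x \<in> space M. \<alpha> \<le> h x \<and> h x < \<beta>}"
  define L' where "L' = {x \<in> space M. \<alpha> < h x \<and> h x < \<beta>}"
  have Lm[measurable]: "L \<in> sets M" "L' \<in> sets M" unfolding L_def L'_def by measurable
  have "{x \<in> space M. \<alpha> \<le> h x} = L \<union> {x \<in> space M. \<beta> \<le> h x}" using ab by (auto simp: L_def)
  then have "s \<alpha> = measure M L + s \<beta>"
    unfolding s_def by (subst finite_measure_Union[symmetric]) (auto simp: L_def)
  then have q: "q = measure M L" by (simp add: q_def)
  have q': "measure M L' \<le> q" unfolding q by (intro finite_measure_mono) (auto simp: L_def L'_def)
  have q0: "q \<ge> 0" by (simp add: q)
  have sle: "s t \<le> measure M (space M)" "0 \<le> s t" for t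
    unfolding s_def by (auto intro: bounded_measure)
  have "tan (\<kappa> * s \<alpha>) - tan (\<kappa> * s \<beta>) \<ge> (\<kappa> * s \<alpha> - \<kappa> * s \<beta>) * (1 + (tan (\<kappa> * s \<beta>))\<^sup>2)"
    using kap sle[of \<beta>] q0 le_less_trans[OF mult_left_mono[OF sle(1)[of \<alpha>]] kap(2)]
    by (intro tan_increment_ge) (auto simp: q_def)
  then have "N * (N * \<kappa>) * (tan (\<kappa> * s \<alpha>) - tan (\<kappa> * s \<beta>)) \<ge> N * (N * \<kappa>) * ((\<kappa> * s \<alpha> - \<kappa> * s \<beta>) * (1 + (tan (\<kappa> * s \<beta>))\<^sup>2))"
    using N kap by (intro mult_left_mono) auto
  then have a_step: "N * (a \<alpha> - a \<beta>) \<ge> q * ((N * \<kappa>)\<^sup>2 + (a \<beta>)\<^sup>2)"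
    by (simp add: a_def q_def algebra_simps power2_eq_square)
  have a_bd: "0 \<le> a \<beta>" "a \<beta> \<le> N * \<kappa> * tan (\<kappa> * measure M (space M))"
    using N kap sle[of \<beta>] le_less_trans[OF mult_left_mono[OF sle(1)[of \<beta>]] kap(2)]
      less_le_trans[OF _ mult_nonneg_nonneg[OF less_imp_le[OF kap(1)] sle(2)[of \<beta>]], of "- (pi / 2)"]
    unfolding a_def
    by (auto intro!: mult_nonneg_nonneg tan_pos_pi2_le tan_mono_le mult_left_mono)

  have hint: "integrable M (\<lambda>x. indicator {x. h x < t} x * (h x)\<^sup>2)" for t
  proof (rule integrable_const_bound[where B="t\<^sup>2"])
    show "AE x in M. norm (indicator {x. h x < t} x * (h x)\<^sup>2) \<le> t\<^sup>2"
      using range by (intro AE_I2) (auto simp: indicator_def intro!: power_mono)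
  qed measurable
  have gint: "integrable M (\<lambda>x. indicator {x. h x < t} x * (g x)\<^sup>2)" for t
    using integrable_mult_indicator[OF _ g2, of "{x \<in> space M. h x < t}"]
    by (rule Bochner_Integration.integrable_cong[THEN iffD1, rotated -1]) (auto simp: indicator_def)
  have ind_int: "integrable M (indicat_real L)" "integrable M (indicat_real L')" by (auto simp: integrable_real_indicator less_top[symmetric])
  define I where "I t = (\<integral>x. indicator {x. h x < t} x * ((g x)\<^sup>2 - (N * \<kappa>)\<^sup>2 * (h x)\<^sup>2) \<partial>M)" for t
  have intI: "integrable M (\<lambda>x. indicator {x. h x < t} x * ((g x)\<^sup>2 - (N * \<kappa>)\<^sup>2 * (h x)\<^sup>2))" for t
    using Bochner_Integration.integrable_diff[OF gint[of t] integrable_mult_right[OF hint[of t], of "(N * \<kappa>)\<^sup>2"]]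
    by (simp add: algebra_simps)
  define \<psi> where "\<psi> = \<alpha> * a \<beta>"
  have psi0: "\<psi> \<ge> 0" using a_bd ab by (simp add: \<psi>_def)
  have gabs: "integrable M (\<lambda>x. indicator L' x * \<bar>g x\<bar>)"
  proof (rule Bochner_Integration.integrable_bound)
    show "integrable M (\<lambda>x. 1 + (g x)\<^sup>2)" using g2 by auto
    have "\<bar>t\<bar> \<le> 1 + t\<^sup>2" for t :: real
      using sum_squares_bound[of "\<bar>t\<bar>" 1] by (auto simp: power2_eq_square)
    then show "AE x in M. norm (indicat_real L' x * \<bar>g x\<bar>) \<le> norm (1 + (g x)\<^sup>2)"
      by (intro AE_I2) (auto simp: indicator_def)
  qed measurable
  have "2 * \<psi> * (N * (\<beta> - \<alpha>)) - \<psi>\<^sup>2 * q - (N * \<kappa>)\<^sup>2 * \<beta>\<^sup>2 * q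
     \<le> 2 * \<psi> * (\<integral>x. indicator L' x * \<bar>g x\<bar> \<partial>M) - \<psi>\<^sup>2 * measure M L' - (N * \<kappa>)\<^sup>2 * \<beta>\<^sup>2 * measure M L"
  proof -
    have "(\<integral>x. indicator L' x * \<bar>g x\<bar> \<partial>M) = (\<integral>x. indicator {x. \<alpha> < h x \<and> h x < \<beta>} x * \<bar>g x\<bar> \<partial>M)"
      by (intro Bochner_Integration.integral_cong) (auto simp: L'_def indicator_def)
    with cross have "2 * \<psi> * (N * (\<beta> - \<alpha>)) \<le> 2 * \<psi> * (\<integral>x. indicator L' x * \<bar>g x\<bar> \<partial>M)"
      using psi0 by (intro mult_left_mono) auto
    moreover have "\<psi>\<^sup>2 * measure M L' \<le> \<psi>\<^sup>2 * q" using q' by (intro mult_left_mono) auto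
    ultimately show ?thesis by (simp add: q)
  qed
  also have "\<dots> = (\<integral>x. 2 * \<psi> * (indicator L' x * \<bar>g x\<bar>) - \<psi>\<^sup>2 * indicator L' x - (N * \<kappa>)\<^sup>2 * \<beta>\<^sup>2 * indicator L x \<partial>M)"
    using gabs ind_int by simp
  also have "\<dots> \<le> (\<integral>x. indicator {x. h x < \<beta>} x * ((g x)\<^sup>2 - (N * \<kappa>)\<^sup>2 * (h x)\<^sup>2)
         - indicator {x. h x < \<alpha>} x * ((g x)\<^sup>2 - (N * \<kappa>)\<^sup>2 * (h x)\<^sup>2) \<partial>M)"
  proof (rule integral_mono)
    fix x assume x: "x \<in> space M"
    have 1: "2 * \<psi> * \<bar>g x\<bar> - \<psi>\<^sup>2 \<le> (g x)\<^sup>2"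
      using sum_squares_bound[of \<psi> "\<bar>g x\<bar>"] by auto
    have 2: "(N * \<kappa>)\<^sup>2 * (h x)\<^sup>2 \<le> (N * \<kappa>)\<^sup>2 * \<beta>\<^sup>2" if "h x < \<beta>"
      using range[OF x] that by (intro mult_left_mono power_mono) auto
    have 3: "(N * \<kappa>)\<^sup>2 * (h x)\<^sup>2 \<le> (g x)\<^sup>2 + (N * \<kappa>)\<^sup>2 * \<beta>\<^sup>2" if "h x < \<beta>"
      using 2[OF that] by (intro add_increasing) auto
    show "2 * \<psi> * (indicator L' x * \<bar>g x\<bar>) - \<psi>\<^sup>2 * indicator L' x - (N * \<kappa>)\<^sup>2 * \<beta>\<^sup>2 * indicator L x
      \<le> indicator {x. h x < \<beta>} x * ((g x)\<^sup>2 - (N * \<kappa>)\<^sup>2 * (h x)\<^sup>2)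
         - indicator {x. h x < \<alpha>} x * ((g x)\<^sup>2 - (N * \<kappa>)\<^sup>2 * (h x)\<^sup>2)"
      using 1 2 3 ab x
      by (cases "h x < \<alpha>"; cases "\<alpha> < h x"; cases "h x < \<beta>")
        (auto simp: L_def L'_def indicator_def)
  qed (use gabs ind_int intI in auto)
  also have "\<dots> = I \<beta> - I \<alpha>"
    unfolding I_def by (intro Bochner_Integration.integral_diff intI)
  finally have 3: "I \<beta> - I \<alpha> \<ge> 2 * \<psi> * (N * (\<beta> - \<alpha>)) - \<psi>\<^sup>2 * q - (N * \<kappa>)\<^sup>2 * \<beta>\<^sup>2 * q" .
  have F: "F t = I t - N * t\<^sup>2 * a t" for t
    by (simp add: F_def I_def a_def)
  have 4: "\<alpha>\<^sup>2 * (N * (a \<alpha> - a \<beta>)) \<ge> \<alpha>\<^sup>2 * (q * ((N * \<kappa>)\<^sup>2 + (a \<beta>)\<^sup>2))"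
    using a_step by (intro mult_left_mono) auto
  have 5: "N * (\<beta> - \<alpha>)\<^sup>2 * a \<beta> \<le> N * (\<beta> - \<alpha>)\<^sup>2 * (N * \<kappa> * tan (\<kappa> * measure M (space M)))"
    using a_bd N by (intro mult_left_mono) auto
  have "(\<beta>\<^sup>2 - \<alpha>\<^sup>2) * ((N * \<kappa>)\<^sup>2 * q) \<le> (2 * \<beta> * (\<beta> - \<alpha>)) * ((N * \<kappa>)\<^sup>2 * q)"
    using mult_nonneg_nonneg[OF zero_le_power2[of "N * \<kappa>"] q0] zero_le_power2[of "\<beta> - \<alpha>"] by (intro mult_right_mono) (simp_all add: power2_eq_square algebra_simps)
  then have "F \<beta> - F \<alpha> \<ge> - (N * (\<beta> - \<alpha>)\<^sup>2 * (N * \<kappa> * tan (\<kappa> * measure M (space M)))) - (2 * \<beta> * (\<beta> - \<alpha>)) * ((N * \<kappa>)\<^sup>2 * q)"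
    using 3 4 5 unfolding F \<psi>_def by (simp add: algebra_simps power2_eq_square)
  then show ?thesis by (simp add: q_def power2_eq_square algebra_simps)
qed


text \<open>Summing the second order errors over \<open>n\<close> equal layers and letting \<open>n \<rightarrow> \<infinity>\<close> gives \<open>F(H) \<ge> F(0) = 0\<close>.\<close>

lemma (in finite_measure) layer_inequality_aux:
  fixes h g :: "'a \<Rightarrow> real"
  assumes h[measurable]: "h \<in> borel_measurable M" and g[measurable]: "g \<in> borel_measurable M"
    and g2: "integrable M (\<lambda>x. (g x)\<^sup>2)"
    and N: "N > 0" and kap: "0 < \<kappa>" "\<kappa> * measure M (space M) < pi / 2"
    and range: "\<And>x. x \<in> space M \<Longrightarrow> 0 \<le> h x" "\<And>x. x \<in> space M \<Longrightarrow> h x \<le> H"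
    and H: "H > 0"
    and cross: "\<And>\<alpha> \<beta>. 0 \<le> \<alpha> \<Longrightarrow> \<alpha> < \<beta> \<Longrightarrow> \<beta> \<le> H \<Longrightarrow>
      (\<integral>x. indicator {x. \<alpha> < h x \<and> h x < \<beta>} x * \<bar>g x\<bar> \<partial>M) \<ge> N * (\<beta> - \<alpha>)"
  shows "(N * \<kappa>)\<^sup>2 * (\<integral>x. (h x)\<^sup>2 \<partial>M) \<le> (\<integral>x. (g x)\<^sup>2 \<partial>M)"
proof -
  define s where "s t = measure M {x \<in> space M. t \<le> h x}" for t
  define F where "F t = (\<integral>x. indicator {x. h x < t} x * ((g x)\<^sup>2 - (N * \<kappa>)\<^sup>2 * (h x)\<^sup>2) \<partial>M)
      - N * t\<^sup>2 * (N * \<kappa> * tan (\<kappa> * s t))" for t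
  have sle: "s t \<le> measure M (space M)" "0 \<le> s t" for t
    unfolding s_def by (auto intro: bounded_measure)
  have s_mono: "s \<beta> \<le> s \<alpha>" if "\<alpha> \<le> \<beta>" for \<alpha> \<beta>
    unfolding s_def using that by (intro finite_measure_mono) auto
  define C1 where "C1 = N\<^sup>2 * \<kappa> * tan (\<kappa> * measure M (space M))"
  define C2 where "C2 = 2 * (N * \<kappa>)\<^sup>2 * H"
  have C2: "C2 \<ge> 0" using H by (simp add: C2_def)
  have step: "F \<beta> - F \<alpha> \<ge> - C1 * (\<beta> - \<alpha>)\<^sup>2 - C2 * (\<beta> - \<alpha>) * (s \<alpha> - s \<beta>)"
    if ab: "0 \<le> \<alpha>" "\<alpha> < \<beta>" "\<beta> \<le> H" for \<alpha> \<beta>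
  proof -
    have "2 * (N * \<kappa>)\<^sup>2 * (\<beta> - \<alpha>) * (s \<alpha> - s \<beta>) * \<beta> \<le> 2 * (N * \<kappa>)\<^sup>2 * (\<beta> - \<alpha>) * (s \<alpha> - s \<beta>) * H"
      using ab s_mono[of \<alpha> \<beta>] by (intro mult_left_mono mult_nonneg_nonneg) auto
    then show ?thesis
      using layer_step[OF h g g2 N kap range(1) ab(1,2) cross[OF ab]]
      unfolding C1_def C2_def F_def s_def by (simp add: algebra_simps)
  qed
  have F0: "F 0 = 0"
  proof -
    have "(\<integral>x. indicator {x. h x < 0} x * ((g x)\<^sup>2 - (N * \<kappa>)\<^sup>2 * (h x)\<^sup>2) \<partial>M) = (\<integral>x. 0 \<partial>M)"
      using range(1) by (intro Bochner_Integration.integral_cong) (auto simp: indicator_def not_less[symmetric])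
    then show ?thesis by (simp add: F_def)
  qed
  have bound: "F H \<ge> - (\<bar>C1\<bar> * H\<^sup>2 + C2 * H * measure M (space M)) / real n" if n: "n > 0" for n
  proof -
    define d where "d = H / real n"
    have d: "d > 0" "real n * d = H" using H n by (auto simp: d_def)
    have "F H = (\<Sum>i<n. F (real (Suc i) * d) - F (real i * d))"
      using F0 d by (subst sum_lessThan_telescope) auto
    also have "\<dots> \<ge> (\<Sum>i<n. - C1 * d\<^sup>2 - C2 * d * (s (real i * d) - s (real (Suc i) * d)))"
    proof (rule sum_mono)
      fix i assume "i \<in> {..<n}"
      then have "real (Suc i) * d \<le> H"
        using d by (metis Suc_leI lessThan_iff less_imp_le mult_right_mono of_nat_le_iff)
      then show "- C1 * d\<^sup>2 - C2 * d * (s (real i * d) - s (real (Suc i) * d)) \<le> F (real (Suc i) * d) - F (real i * d)"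
        using step[of "real i * d" "real (Suc i) * d"] d by (simp add: algebra_simps)
    qed
    also have "(\<Sum>i<n. - C1 * d\<^sup>2 - C2 * d * (s (real i * d) - s (real (Suc i) * d)))
        = - C1 * d\<^sup>2 * n + C2 * d * (\<Sum>i<n. s (real (Suc i) * d) - s (real i * d))"
      by (simp add: sum_subtractf sum_distrib_left algebra_simps sum.distrib)
    also have "(\<Sum>i<n. s (real (Suc i) * d) - s (real i * d)) = s H - s 0"
      using d by (subst sum_lessThan_telescope) auto
    finally have "F H \<ge> - C1 * d\<^sup>2 * n + C2 * d * (s H - s 0)" .
    moreover have "C2 * d * (s H - s 0) \<ge> C2 * d * (- measure M (space M))"
      using C2 d sle(1)[of 0] sle(2)[of H] by (intro mult_left_mono) auto
    moreover have "- C1 * d\<^sup>2 * n \<ge> - \<bar>C1\<bar> * d\<^sup>2 * n" by (intro mult_right_mono) auto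
    ultimately have "F H \<ge> - \<bar>C1\<bar> * d\<^sup>2 * n + C2 * d * (- measure M (space M))" by linarith
    also have "- \<bar>C1\<bar> * d\<^sup>2 * n + C2 * d * (- measure M (space M)) = - (\<bar>C1\<bar> * H\<^sup>2 + C2 * H * measure M (space M)) / real n"
      using n by (simp add: d_def power2_eq_square field_simps)
    finally show ?thesis .
  qed
  have "F H \<ge> 0"
  proof (rule LIMSEQ_le_const2[where X="\<lambda>n. - (\<bar>C1\<bar> * H\<^sup>2 + C2 * H * measure M (space M)) / real n"])
    show "(\<lambda>n. - (\<bar>C1\<bar> * H\<^sup>2 + C2 * H * measure M (space M)) / real n) \<longlonglongrightarrow> 0"
      by (rule lim_const_over_n)
    show "\<exists>N. \<forall>n\<ge>N. - (\<bar>C1\<bar> * H\<^sup>2 + C2 * H * measure M (space M)) / real n \<le> F H"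
      using bound by (intro exI[of _ 1]) auto
  qed
  \<comment> \<open>the mass at the maximal level \<open>H\<close> is absorbed by the boundary term of \<open>F H\<close>\<close>
  moreover have "N * (N * \<kappa> * tan (\<kappa> * s H)) \<ge> (N * \<kappa>)\<^sup>2 * s H"
  proof -
    have "\<kappa> * s H \<ge> 0" "\<kappa> * s H < pi / 2"
      using kap sle[of H] le_less_trans[OF mult_left_mono[OF sle(1)[of H]] kap(2)] by auto
    then have "tan (\<kappa> * s H) \<ge> \<kappa> * s H"
      using tan_increment_ge[of 0 "\<kappa> * s H"] by auto
    then have "N * (N * \<kappa>) * tan (\<kappa> * s H) \<ge> N * (N * \<kappa>) * (\<kappa> * s H)"
      using N kap by (intro mult_left_mono) auto
    then show ?thesis by (simp add: power2_eq_square algebra_simps)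
  qed
  then have "N * H\<^sup>2 * (N * \<kappa> * tan (\<kappa> * s H)) \<ge> (N * \<kappa>)\<^sup>2 * H\<^sup>2 * s H"
    using mult_left_mono[of "(N * \<kappa>)\<^sup>2 * s H" "N * (N * \<kappa> * tan (\<kappa> * s H))" "H\<^sup>2"]
    by (simp add: algebra_simps)
  ultimately have 1: "(N * \<kappa>)\<^sup>2 * H\<^sup>2 * s H
      \<le> (\<integral>x. indicator {x. h x < H} x * ((g x)\<^sup>2 - (N * \<kappa>)\<^sup>2 * (h x)\<^sup>2) \<partial>M)"
    unfolding F_def by linarith
  have h2: "integrable M (\<lambda>x. (h x)\<^sup>2)"
    using range by (intro integrable_const_bound[where B="H\<^sup>2"] AE_I2) (auto intro!: power_mono)
  have ind: "integrable M (indicat_real {x \<in> space M. H \<le> h x})"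
    by (auto simp: integrable_real_indicator less_top[symmetric])
  have "(\<integral>x. indicator {x. h x < H} x * ((g x)\<^sup>2 - (N * \<kappa>)\<^sup>2 * (h x)\<^sup>2) \<partial>M)
      \<le> (\<integral>x. (g x)\<^sup>2 - (N * \<kappa>)\<^sup>2 * (h x)\<^sup>2 + (N * \<kappa>)\<^sup>2 * H\<^sup>2 * indicator {x \<in> space M. H \<le> h x} x \<partial>M)"
  proof (rule integral_mono)
    show "integrable M (\<lambda>x. indicator {x. h x < H} x * ((g x)\<^sup>2 - (N * \<kappa>)\<^sup>2 * (h x)\<^sup>2))"
    proof (rule Bochner_Integration.integrable_bound)
      show "integrable M (\<lambda>x. (g x)\<^sup>2 - (N * \<kappa>)\<^sup>2 * (h x)\<^sup>2)" using g2 h2 by auto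
    qed (auto simp: indicator_def)
    fix x assume x: "x \<in> space M"
    show "indicator {x. h x < H} x * ((g x)\<^sup>2 - (N * \<kappa>)\<^sup>2 * (h x)\<^sup>2)
      \<le> (g x)\<^sup>2 - (N * \<kappa>)\<^sup>2 * (h x)\<^sup>2 + (N * \<kappa>)\<^sup>2 * H\<^sup>2 * indicator {x \<in> space M. H \<le> h x} x"
      using range(2)[OF x] x by (cases "h x = H") (auto simp: indicator_def)
  qed (use g2 h2 ind in auto)
  also have "\<dots> = (\<integral>x. (g x)\<^sup>2 \<partial>M) - (N * \<kappa>)\<^sup>2 * (\<integral>x. (h x)\<^sup>2 \<partial>M) + (N * \<kappa>)\<^sup>2 * H\<^sup>2 * s H"
    using g2 h2 ind by (simp add: s_def)
  finally show ?thesis using 1 by linarith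
qed

text \<open>
  The constant is the lowest eigenvalue of an interval of length \<open>A / N\<close> with a Dirichlet condition at
  one end and a Neumann condition at the other; it is reached as \<open>\<kappa> \<rightarrow> \<pi> / (2 A)\<close>.
\<close>

lemma (in finite_measure) layer_inequality:
  fixes h g :: "'a \<Rightarrow> real"
  assumes h[measurable]: "h \<in> borel_measurable M" and g[measurable]: "g \<in> borel_measurable M"
    and g2: "integrable M (\<lambda>x. (g x)\<^sup>2)"
    and N: "N > 0" and A: "A > 0" "measure M (space M) \<le> A"
    and range: "\<And>x. x \<in> space M \<Longrightarrow> 0 \<le> h x" "\<And>x. x \<in> space M \<Longrightarrow> h x \<le> H"
    and cross: "\<And>\<alpha> \<beta>. 0 \<le> \<alpha> \<Longrightarrow> \<alpha> < \<beta> \<Longrightarrow> \<beta> \<le> H \<Longrightarrow>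
      (\<integral>x. indicator {x. \<alpha> < h x \<and> h x < \<beta>} x * \<bar>g x\<bar> \<partial>M) \<ge> N * (\<beta> - \<alpha>)"
  shows "(N * pi / (2 * A))\<^sup>2 * (\<integral>x. (h x)\<^sup>2 \<partial>M) \<le> (\<integral>x. (g x)\<^sup>2 \<partial>M)"
proof (cases "H > 0")
  case False
  then have "(\<integral>x. (h x)\<^sup>2 \<partial>M) = (\<integral>x. 0 \<partial>M)"
    using range by (intro Bochner_Integration.integral_cong) (auto simp: not_less intro: antisym order_trans)
  then show ?thesis by simp
next
  case True
  have lim: "((\<lambda>\<kappa>. (N * \<kappa>)\<^sup>2 * (\<integral>x. (h x)\<^sup>2 \<partial>M)) \<longlongrightarrow> (N * (pi / (2 * A)))\<^sup>2 * (\<integral>x. (h x)\<^sup>2 \<partial>M)) (at_left (pi / (2 * A)))"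
    by (intro tendsto_intros)
  have "eventually (\<lambda>\<kappa>. \<kappa> \<in> {0<..<pi / (2 * A)}) (at_left (pi / (2 * A)))"
    using A by (intro eventually_at_leftI[of 0]) auto
  then have "eventually (\<lambda>\<kappa>. (N * \<kappa>)\<^sup>2 * (\<integral>x. (h x)\<^sup>2 \<partial>M) \<le> (\<integral>x. (g x)\<^sup>2 \<partial>M)) (at_left (pi / (2 * A)))"
  proof eventually_elim
    case (elim \<kappa>)
    have "\<kappa> * measure M (space M) \<le> \<kappa> * A"
      using elim A by (intro mult_left_mono) auto
    also have "\<dots> < pi / 2" using elim A by (simp add: field_simps)
    finally show ?case
      using elim by (intro layer_inequality_aux[OF h g g2 N _ _ range True cross]) auto
  qed
  with lim show ?thesis
    using tendsto_upperbound[OF lim] by (simp add: trivial_limit_at_left_real)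
qed

lemma (in finite_measure) median_exists:
  fixes u :: "'a \<Rightarrow> real"
  assumes u[measurable]: "u \<in> borel_measurable M"
    and bd: "\<And>x. x \<in> space M \<Longrightarrow> \<bar>u x\<bar> \<le> B"
  shows "\<exists>c. measure M {x \<in> space M. u x > c} \<le> measure M (space M) / 2 \<and>
             measure M {x \<in> space M. u x < c} \<le> measure M (space M) / 2"
proof (cases "space M = {}")
  case True
  then show ?thesis by (auto simp: measure_empty)
next
  case False
  define S where "S = {t. measure M {x \<in> space M. u x > t} \<le> measure M (space M) / 2}"
  have BS: "B \<in> S"
  proof -
    have e: "{x \<in> space M. u x > B} = {}" using bd by force
    show ?thesis unfolding S_def mem_Collect_eq e by simp
  qed
  show ?thesis
  proof (cases "measure M (space M) = 0")
    case True
    have "measure M X = 0" for X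
      using True by (metis bounded_measure measure_nonneg antisym)
    then show ?thesis using True by auto
  next
    case pos: False
    have lowS: "bdd_below S"
    proof (rule bdd_belowI)
      fix t assume t: "t \<in> S"
      show "- B - 1 \<le> t"
      proof (rule ccontr)
        assume "\<not> - B - 1 \<le> t"
        then have "{x \<in> space M. u x > t} = space M" using bd by force
        with t pos measure_nonneg[of M "space M"] show False by (auto simp: S_def)
      qed
    qed
    define c where "c = Inf S"
    have up: "t \<in> S" if "t > c" for t
    proof -
      obtain r where r: "r \<in> S" "r < t"
        using \<open>t > c\<close> BS cInf_less_iff[OF _ lowS, of t] by (auto simp: c_def)
      have "measure M {x \<in> space M. u x > t} \<le> measure M {x \<in> space M. u x > r}"
        using r by (intro finite_measure_mono) auto
      with r show ?thesis by (auto simp: S_def)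
    qed
    have "(\<lambda>n. measure M {x \<in> space M. u x > c + 1 / real (Suc n)}) \<longlonglongrightarrow>
        measure M (\<Union>n. {x \<in> space M. u x > c + 1 / real (Suc n)})"
    proof (rule finite_Lim_measure_incseq)
      show "incseq (\<lambda>n. {x \<in> space M. u x > c + 1 / real (Suc n)})"
      proof (clarsimp simp: incseq_def simp del: of_nat_Suc)
        fix m n :: nat and x assume "m \<le> n" "c + 1 / real (Suc m) < u x"
        moreover have "1 / real (Suc n) \<le> 1 / real (Suc m)" using \<open>m \<le> n\<close> by (intro divide_left_mono) auto
        ultimately show "c + 1 / real (Suc n) < u x" by linarith
      qed
    qed auto
    moreover have "(\<Union>n. {x \<in> space M. u x > c + 1 / real (Suc n)}) = {x \<in> space M. u x > c}"
    proof safe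
      fix x n assume "c + 1 / real (Suc n) < u x"
      moreover have "1 / real (Suc n) > 0" by simp
      ultimately show "c < u x" by linarith
    next
      fix x assume "x \<in> space M" "c < u x"
      then obtain n where "1 / real (Suc n) < u x - c"
        using reals_Archimedean[of "u x - c"] by (auto simp: inverse_eq_divide)
      then show "x \<in> (\<Union>n. {x \<in> space M. u x > c + 1 / real (Suc n)})"
        using \<open>x \<in> space M\<close> by (auto intro!: exI[of _ n])
    qed
    moreover have "measure M {x \<in> space M. u x > c + 1 / real (Suc n)} \<le> measure M (space M) / 2" for n
      using up[of "c + 1 / real (Suc n)"] by (auto simp: S_def)
    ultimately have A: "measure M {x \<in> space M. u x > c} \<le> measure M (space M) / 2"
      by (metis (no_types, lifting) LIMSEQ_le_const2)
    have "(\<lambda>n. measure M {x \<in> space M. u x \<le> c - 1 / real (Suc n)}) \<longlonglongrightarrow>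
        measure M (\<Union>n. {x \<in> space M. u x \<le> c - 1 / real (Suc n)})"
    proof (rule finite_Lim_measure_incseq)
      show "incseq (\<lambda>n. {x \<in> space M. u x \<le> c - 1 / real (Suc n)})"
      proof (clarsimp simp: incseq_def simp del: of_nat_Suc)
        fix m n :: nat and x assume "m \<le> n" "u x \<le> c - 1 / real (Suc m)"
        moreover have "1 / real (Suc n) \<le> 1 / real (Suc m)" using \<open>m \<le> n\<close> by (intro divide_left_mono) auto
        ultimately show "u x \<le> c - 1 / real (Suc n)" by linarith
      qed
    qed auto
    moreover have "(\<Union>n. {x \<in> space M. u x \<le> c - 1 / real (Suc n)}) = {x \<in> space M. u x < c}"
    proof safe
      fix x n assume "u x \<le> c - 1 / real (Suc n)"
      moreover have "1 / real (Suc n) > 0" by simp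
      ultimately show "u x < c" by linarith
    next
      fix x assume "x \<in> space M" "u x < c"
      then obtain n where "1 / real (Suc n) < c - u x"
        using reals_Archimedean[of "c - u x"] by (auto simp: inverse_eq_divide)
      then show "x \<in> (\<Union>n. {x \<in> space M. u x \<le> c - 1 / real (Suc n)})"
        using \<open>x \<in> space M\<close> by (auto intro!: exI[of _ n])
    qed
    moreover have "measure M {x \<in> space M. u x \<le> c - 1 / real (Suc n)} \<le> measure M (space M) / 2" for n
    proof -
      have "c - 1 / real (Suc n) \<notin> S"
        using cInf_lower[OF _ lowS, of "c - 1 / real (Suc n)"] by (auto simp: c_def)
      then have "measure M {x \<in> space M. u x > c - 1 / real (Suc n)} > measure M (space M) / 2"
        by (simp add: S_def)
      moreover have "{x \<in> space M. u x \<le> c - 1 / real (Suc n)} = space M - {x \<in> space M. u x > c - 1 / real (Suc n)}"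
        by auto
      ultimately show ?thesis by (simp add: finite_measure_compl)
    qed
    ultimately have "measure M {x \<in> space M. u x < c} \<le> measure M (space M) / 2"
      by (metis (no_types, lifting) LIMSEQ_le_const2)
    with A show ?thesis by blast
  qed
qed

text \<open>The layer inequality on the set \<open>{u > c}\<close>, for \<open>h = u - c\<close>.\<close>

lemma (in finite_measure) superlevel_inequality:
  fixes u g :: "'a \<Rightarrow> real"
  assumes u[measurable]: "u \<in> borel_measurable M" and g[measurable]: "g \<in> borel_measurable M"
    and g2: "integrable M (\<lambda>x. (g x)\<^sup>2)"
    and N: "N > 0" and A: "A > 0" "measure M {x \<in> space M. u x > c} \<le> A"
    and upper: "\<And>x. x \<in> space M \<Longrightarrow> u x \<le> H"
    and cross: "\<And>\<alpha> \<beta>. c \<le> \<alpha> \<Longrightarrow> \<alpha> < \<beta> \<Longrightarrow> \<beta> \<le> H \<Longrightarrow>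
      (\<integral>x. indicator {x. \<alpha> < u x \<and> u x < \<beta>} x * \<bar>g x\<bar> \<partial>M) \<ge> N * (\<beta> - \<alpha>)"
  shows "(N * pi / (2 * A))\<^sup>2 * (\<integral>x. indicator {x. u x > c} x * (u x - c)\<^sup>2 \<partial>M)
    \<le> (\<integral>x. indicator {x. u x > c} x * (g x)\<^sup>2 \<partial>M)"
proof -
  define P where "P = {x \<in> space M. u x > c}"
  have P1[measurable]: "P \<in> sets M" unfolding P_def by measurable
  have P3: "P \<inter> space M = P" by (auto simp: P_def)
  have P: "P \<in> sets M" "P \<inter> space M \<in> sets M" "P \<inter> space M = P"
    using P1 by (simp_all add: P3)
  interpret R: finite_measure "restrict_space M P"
    by (intro finite_measure_restrict_space P1) unfold_locales
  have conv: "(\<integral>x. f x \<partial>restrict_space M P) = (\<integral>x. indicator {x. u x > c} x * f x \<partial>M)" for f :: "'a \<Rightarrow> real"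
    by (subst integral_restrict_space) (auto simp: P_def indicator_def intro!: Bochner_Integration.integral_cong)
  have spR: "space (restrict_space M P) = P" using P(3) by (auto simp: space_restrict_space)
  have "(N * pi / (2 * A))\<^sup>2 * (\<integral>x. (u x - c)\<^sup>2 \<partial>restrict_space M P) \<le> (\<integral>x. (g x)\<^sup>2 \<partial>restrict_space M P)"
  proof (rule R.layer_inequality[where H="H - c"])
    show "integrable (restrict_space M P) (\<lambda>x. (g x)\<^sup>2)"
      using integrable_mult_indicator[OF P(1) g2] by (subst integrable_restrict_space) auto
    show "measure (restrict_space M P) (space (restrict_space M P)) \<le> A"
      using A by (simp add: spR measure_restrict_space P_def)
    fix \<alpha> \<beta> assume ab: "0 \<le> \<alpha>" "\<alpha> < \<beta>" "\<beta> \<le> H - c"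
    have "N * (\<beta> - \<alpha>) \<le> (\<integral>x. indicator {x. \<alpha> + c < u x \<and> u x < \<beta> + c} x * \<bar>g x\<bar> \<partial>M)"
      using cross[of "\<alpha> + c" "\<beta> + c"] ab by simp
    also have "\<dots> = (\<integral>x. indicator {x. \<alpha> < u x - c \<and> u x - c < \<beta>} x * \<bar>g x\<bar> \<partial>restrict_space M P)"
      unfolding conv using ab by (intro Bochner_Integration.integral_cong) (auto simp: indicator_def)
    finally show "N * (\<beta> - \<alpha>) \<le> (\<integral>x. indicator {x. \<alpha> < u x - c \<and> u x - c < \<beta>} x * \<bar>g x\<bar> \<partial>restrict_space M P)" .
  qed (use A N upper in \<open>auto simp: spR P_def measurable_restrict_space1\<close>)
  then show ?thesis unfolding conv .
qed

text \<open>
  If \<open>c\<close> is a median of \<open>u\<close>, then \<open>{u > c}\<close> and \<open>{u < c}\<close> both have at most half of the total mass, so the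
  previous lemma applies to \<open>u\<close> and to \<open>- u\<close> with the same constant.
\<close>

lemma (in finite_measure) poincare_from_layers:
  fixes u g :: "'a \<Rightarrow> real"
  assumes u[measurable]: "u \<in> borel_measurable M" and g[measurable]: "g \<in> borel_measurable M"
    and g2: "integrable M (\<lambda>x. (g x)\<^sup>2)"
    and N: "N > 0" and pos: "measure M (space M) > 0"
    and xm: "xm \<in> space M" "\<And>x. x \<in> space M \<Longrightarrow> u xm \<le> u x"
    and xp: "xp \<in> space M" "\<And>x. x \<in> space M \<Longrightarrow> u x \<le> u xp"
    and cross: "\<And>\<alpha> \<beta>. u xm \<le> \<alpha> \<Longrightarrow> \<alpha> < \<beta> \<Longrightarrow> \<beta> \<le> u xp \<Longrightarrow>
      (\<integral>x. indicator {x. \<alpha> < u x \<and> u x < \<beta>} x * \<bar>g x\<bar> \<partial>M) \<ge> N * (\<beta> - \<alpha>)"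
  shows "\<exists>c. (N * pi / measure M (space M))\<^sup>2 * (\<integral>x. (u x - c)\<^sup>2 \<partial>M) \<le> (\<integral>x. (g x)\<^sup>2 \<partial>M)"
proof -
  define T where "T = measure M (space M)"
  have bd: "\<bar>u x\<bar> \<le> \<bar>u xm\<bar> + \<bar>u xp\<bar>" if "x \<in> space M" for x
    using xm(2)[OF that] xp(2)[OF that] by linarith
  from median_exists[OF u bd] obtain c where
    c: "measure M {x \<in> space M. u x > c} \<le> T / 2" "measure M {x \<in> space M. u x < c} \<le> T / 2"
    unfolding T_def by blast
  have T: "T > 0" using pos by (simp add: T_def)
  have "u xm \<le> c"
  proof (rule ccontr)
    assume "\<not> u xm \<le> c"
    then have "{x \<in> space M. u x > c} = space M" using xm(2) by force
    with c(1) T show False by (simp add: T_def)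
  qed
  then have 1: "(N * pi / T)\<^sup>2 * (\<integral>x. indicator {x. u x > c} x * (u x - c)\<^sup>2 \<partial>M)
    \<le> (\<integral>x. indicator {x. u x > c} x * (g x)\<^sup>2 \<partial>M)"
    using superlevel_inequality[OF u g g2 N _ c(1) xp(2) cross] T by simp
  have "c \<le> u xp"
  proof (rule ccontr)
    assume "\<not> c \<le> u xp"
    then have "{x \<in> space M. u x < c} = space M" using xp(2) by force
    with c(2) T show False by (simp add: T_def)
  qed
  then have "(N * pi / (2 * (T/2)))\<^sup>2 * (\<integral>x. indicator {x. - u x > - c} x * (- u x - (-c))\<^sup>2 \<partial>M)
    \<le> (\<integral>x. indicator {x. - u x > -c} x * (g x)\<^sup>2 \<partial>M)"
  proof (intro superlevel_inequality[where H="- u xm"])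
    fix \<alpha> \<beta> assume ab: "-c \<le> \<alpha>" "\<alpha> < \<beta>" "\<beta> \<le> - u xm"
    have "{x. \<alpha> < - u x \<and> - u x < \<beta>} = {x. - \<beta> < u x \<and> u x < - \<alpha>}" by auto
    then show "N * (\<beta> - \<alpha>) \<le> (\<integral>x. indicator {x. \<alpha> < - u x \<and> - u x < \<beta>} x * \<bar>g x\<bar> \<partial>M)"
      using cross[of "-\<beta>" "-\<alpha>"] ab \<open>c \<le> u xp\<close> by simp
  qed (use T c(2) xm(2) N g2 in auto)
  then have 2: "(N * pi / T)\<^sup>2 * (\<integral>x. indicator {x. u x < c} x * (u x - c)\<^sup>2 \<partial>M)
    \<le> (\<integral>x. indicator {x. u x < c} x * (g x)\<^sup>2 \<partial>M)"
    by (simp add: power2_commute)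
  have ig: "integrable M (\<lambda>x. indicator {x. P x} x * (g x)\<^sup>2)" if "{x \<in> space M. P x} \<in> sets M" for P
    using integrable_mult_indicator[OF that g2]
    by (rule Bochner_Integration.integrable_cong[THEN iffD1, rotated -1]) (auto simp: indicator_def)
  have u2: "integrable M (\<lambda>x. (u x - c)\<^sup>2)"
  proof (rule integrable_const_bound[where B="(\<bar>u xm\<bar> + \<bar>u xp\<bar> + \<bar>c\<bar>)\<^sup>2"])
    show "AE x in M. norm ((u x - c)\<^sup>2) \<le> (\<bar>u xm\<bar> + \<bar>u xp\<bar> + \<bar>c\<bar>)\<^sup>2"
    proof (rule AE_I2)
      fix x assume "x \<in> space M"
      then have "\<bar>u x - c\<bar> \<le> \<bar>u xm\<bar> + \<bar>u xp\<bar> + \<bar>c\<bar>" using bd[of x] by linarith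
      then show "norm ((u x - c)\<^sup>2) \<le> (\<bar>u xm\<bar> + \<bar>u xp\<bar> + \<bar>c\<bar>)\<^sup>2"
        using power_mono[of "\<bar>u x - c\<bar>" _ 2] by simp
    qed
  qed measurable
  have iu: "integrable M (\<lambda>x. indicator {x. P x} x * (u x - c)\<^sup>2)" if "{x \<in> space M. P x} \<in> sets M" for P
    using integrable_mult_indicator[OF that u2]
    by (rule Bochner_Integration.integrable_cong[THEN iffD1, rotated -1]) (auto simp: indicator_def)
  have "(\<integral>x. (u x - c)\<^sup>2 \<partial>M) = (\<integral>x. indicator {x. u x > c} x * (u x - c)\<^sup>2 + indicator {x. u x < c} x * (u x - c)\<^sup>2 \<partial>M)"
    by (intro Bochner_Integration.integral_cong) (auto simp: indicator_def)
  also have "\<dots> = (\<integral>x. indicator {x. u x > c} x * (u x - c)\<^sup>2 \<partial>M) + (\<integral>x. indicator {x. u x < c} x * (u x - c)\<^sup>2 \<partial>M)"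
    by (intro Bochner_Integration.integral_add iu) auto
  finally have "(N * pi / T)\<^sup>2 * (\<integral>x. (u x - c)\<^sup>2 \<partial>M)
    \<le> (\<integral>x. indicator {x. u x > c} x * (g x)\<^sup>2 \<partial>M) + (\<integral>x. indicator {x. u x < c} x * (g x)\<^sup>2 \<partial>M)"
    using 1 2 by (simp add: distrib_left)
  also have "\<dots> = (\<integral>x. indicator {x. u x > c} x * (g x)\<^sup>2 + indicator {x. u x < c} x * (g x)\<^sup>2 \<partial>M)"
    by (intro Bochner_Integration.integral_add[symmetric] ig) auto
  also have "\<dots> \<le> (\<integral>x. (g x)\<^sup>2 \<partial>M)"
    by (intro integral_mono g2 Bochner_Integration.integrable_add ig) (auto simp: indicator_def)
  finally show ?thesis unfolding T_def by blast
qed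

section \<open>Layers on a single edge and across cuts\<close>

lemma finite_measure_Icc: "finite_measure (lebesgue_on {0..l::real})"
  by (intro finite_measure_lebesgue_on) auto

lemma integrable_of_square:
  fixes g :: "'a \<Rightarrow> 'b :: {banach, second_countable_topology}"
  assumes "finite_measure M" "g \<in> borel_measurable M" "integrable M (\<lambda>x. (norm (g x))\<^sup>2)"
  shows "integrable M g"
proof (rule Bochner_Integration.integrable_bound)
  interpret finite_measure M by fact
  show "integrable M (\<lambda>x. 1 + (norm (g x))\<^sup>2)" using assms(3) by auto
  have "t \<le> 1 + t\<^sup>2" for t :: real
    using zero_le_power2[of "t - 1/2"] by (simp add: power2_eq_square algebra_simps)
  then show "AE x in M. norm (g x) \<le> norm (1 + (norm (g x))\<^sup>2)" by (intro AE_I2) auto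
qed fact

lemma integrable_continuous_lebesgue_on:
  fixes f :: "real \<Rightarrow> 'a :: euclidean_space"
  assumes "continuous_on {0..l} f"
  shows "integrable (lebesgue_on {0..l}) f"
  using absolutely_integrable_continuous_real[OF assms]
  by (simp add: integrable_restrict_space set_integrable_def)

lemma integral_lebesgue_on_FTC:
  fixes F :: "real \<Rightarrow> 'a :: euclidean_space"
  assumes "0 \<le> l" "\<And>t. t \<in> {0..l} \<Longrightarrow> (F has_vector_derivative F' t) (at t within {0..l})"
    and "continuous_on {0..l} F'"
  shows "(\<integral>t. F' t \<partial>lebesgue_on {0..l}) = F l - F 0"
proof -
  have "(\<integral>t. F' t \<partial>lebesgue_on {0..l}) = integral {0..l} F'"
    using assms(3) by (intro lebesgue_integral_eq_integral integrable_continuous_lebesgue_on) auto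
  also have "\<dots> = F l - F 0"
    using fundamental_theorem_of_calculus[OF assms(1,2)] by (simp add: integral_unique)
  finally show ?thesis .
qed

text \<open>
  The interval runs from the last point with \<open>f \<le> a\<close> to the first later point with \<open>f \<ge> b\<close>.
\<close>

lemma crossing_interval:
  fixes f :: "real \<Rightarrow> real"
  assumes cont: "continuous_on {x..y} f" and xy: "x \<le> y" and ab: "f x \<le> a" "a < b" "b \<le> f y"
  obtains p q where "x \<le> p" "p \<le> q" "q \<le> y" "f p \<le> a" "b \<le> f q" "\<And>t. p < t \<Longrightarrow> t < q \<Longrightarrow> a < f t \<and> f t < b"
proof -
  have "compact {z \<in> {x..y}. f z \<le> a}"
    using cont unfolding compact_eq_bounded_closed
    by (intro conjI bounded_subset[OF bounded_closed_interval[of x y]] continuous_on_closed_Collect_le continuous_on_const) auto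
  moreover have "x \<in> {z \<in> {x..y}. f z \<le> a}" using xy ab by auto
  ultimately obtain p where p: "p \<in> {x..y}" "f p \<le> a" "\<And>z. z \<in> {x..y} \<Longrightarrow> f z \<le> a \<Longrightarrow> z \<le> p"
    using compact_attains_sup[of "{z \<in> {x..y}. f z \<le> a}"] by blast
  have cont': "continuous_on {p..y} f" using p by (intro continuous_on_subset[OF cont]) auto
  have "compact {z \<in> {p..y}. b \<le> f z}"
    using cont' unfolding compact_eq_bounded_closed
    by (intro conjI bounded_subset[OF bounded_closed_interval[of p y]] continuous_on_closed_Collect_le continuous_on_const) auto
  moreover have "y \<in> {z \<in> {p..y}. b \<le> f z}" using p ab by auto
  ultimately obtain q where q: "q \<in> {p..y}" "b \<le> f q" "\<And>z. z \<in> {p..y} \<Longrightarrow> b \<le> f z \<Longrightarrow> q \<le> z"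
    using compact_attains_inf[of "{z \<in> {p..y}. b \<le> f z}"] by blast
  show thesis
  proof (rule that[of p q])
    fix t assume t: "p < t" "t < q"
    show "a < f t \<and> f t < b"
      using p(1) q(1) p(3)[of t] q(3)[of t] t by force
  qed (use p q in auto)
qed

text \<open>Truncation to the interval \<open>[\<alpha>, \<beta>]\<close>.\<close>

definition clamp_real :: "real \<Rightarrow> real \<Rightarrow> real \<Rightarrow> real" where
  "clamp_real \<alpha> \<beta> z = max \<alpha> (min \<beta> z)"

text \<open>
  A function can only move from one truncated value to another by crossing the layer between them.
\<close>

lemma clamp_variation_le:
  fixes f g :: "real \<Rightarrow> real"
  assumes cont: "continuous_on {0..l} f" and gi: "integrable (lebesgue_on {0..l}) g"
    and ftc: "\<And>x y. 0 \<le> x \<Longrightarrow> x \<le> y \<Longrightarrow> y \<le> l \<Longrightarrow>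
       f y - f x = (\<integral>t. indicator {x<..<y} t * g t \<partial>lebesgue_on {0..l})"
    and ab: "\<alpha> < \<beta>" and xy: "0 \<le> x" "x \<le> y" "y \<le> l"
  shows "\<bar>clamp_real \<alpha> \<beta> (f y) - clamp_real \<alpha> \<beta> (f x)\<bar>
    \<le> (\<integral>t. indicator {x<..<y} t * (indicator {t. \<alpha> < f t \<and> f t < \<beta>} t * \<bar>g t\<bar>) \<partial>lebesgue_on {0..l})"
proof -
  have [measurable]: "f \<in> borel_measurable (lebesgue_on {0..l})"
    by (intro continuous_imp_measurable_on_sets_lebesgue cont) auto
  have [measurable]: "g \<in> borel_measurable (lebesgue_on {0..l})" using gi by simp
  have im[measurable]: "indicat_real {p<..<q} \<in> borel_measurable (lebesgue_on {0..l})" for p q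
    by (intro measurable_restrict_space1 borel_measurable_indicator) auto
  have int: "integrable (lebesgue_on {0..l}) (\<lambda>t. indicator {x<..<y} t * (indicator {t. P (f t)} t * \<bar>g t\<bar>))"
    if [measurable]: "Measurable.pred borel P" for P
  proof (rule Bochner_Integration.integrable_bound[OF gi])
    have "(\<lambda>t. indicat_real {t. P (f t)} t) \<in> borel_measurable (lebesgue_on {0..l})"
      unfolding indicator_def mem_Collect_eq by measurable
    then show "(\<lambda>t. indicator {x<..<y} t * (indicator {t. P (f t)} t * \<bar>g t\<bar>)) \<in> borel_measurable (lebesgue_on {0..l})"
      by measurable
  qed (auto simp: indicator_def)
  have key: "b - a \<le> (\<integral>t. indicator {x<..<y} t * (indicator {t. \<alpha> < f t \<and> f t < \<beta>} t * \<bar>g t\<bar>) \<partial>lebesgue_on {0..l})"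
    if pq: "x \<le> p" "p \<le> q" "q \<le> y" "b - a \<le> \<bar>f q - f p\<bar>" "\<And>t. p < t \<Longrightarrow> t < q \<Longrightarrow> \<alpha> < f t \<and> f t < \<beta>" for p q a b
  proof -
    have "b - a \<le> \<bar>f q - f p\<bar>" by (fact pq)
    also have "\<dots> = norm (\<integral>t. indicator {p<..<q} t * g t \<partial>lebesgue_on {0..l})"
      using ftc[of p q] pq xy by simp
    also have "\<dots> \<le> (\<integral>t. norm (indicator {p<..<q} t * g t) \<partial>lebesgue_on {0..l})"
      by (rule integral_norm_bound)
    also have "\<dots> \<le> (\<integral>t. indicator {x<..<y} t * (indicator {t. \<alpha> < f t \<and> f t < \<beta>} t * \<bar>g t\<bar>) \<partial>lebesgue_on {0..l})"
    proof (rule integral_mono)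
      show "integrable (lebesgue_on {0..l}) (\<lambda>t. norm (indicat_real {p<..<q} t * g t))"
      proof (rule Bochner_Integration.integrable_bound[OF gi])
        show "(\<lambda>t. norm (indicat_real {p<..<q} t * g t)) \<in> borel_measurable (lebesgue_on {0..l})" by measurable
      qed (auto simp: indicator_def)
      show "integrable (lebesgue_on {0..l}) (\<lambda>t. indicator {x<..<y} t * (indicator {t. \<alpha> < f t \<and> f t < \<beta>} t * \<bar>g t\<bar>))"
        by (rule int) measurable
    qed (use pq in \<open>auto simp: indicator_def\<close>)
    finally show ?thesis .
  qed
  have c: "continuous_on {x..y} f" using xy by (intro continuous_on_subset[OF cont]) auto
  let ?c = "clamp_real \<alpha> \<beta>"
  consider "?c (f x) < ?c (f y)" | "?c (f y) < ?c (f x)" | "?c (f x) = ?c (f y)" by linarith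
  then show ?thesis
  proof cases
    case 1
    have ends: "f x \<le> ?c (f x)" "?c (f y) \<le> f y"
      using 1 ab by (auto simp: clamp_real_def max_def min_def split: if_splits)
    obtain p q where pq: "x \<le> p" "p \<le> q" "q \<le> y" "f p \<le> ?c (f x)" "?c (f y) \<le> f q"
      "\<And>t. p < t \<Longrightarrow> t < q \<Longrightarrow> ?c (f x) < f t \<and> f t < ?c (f y)"
      using crossing_interval[OF c xy(2) ends(1) 1 ends(2)] by blast
    have bd: "\<alpha> \<le> ?c z" "?c z \<le> \<beta>" for z using ab by (auto simp: clamp_real_def)
    have "?c (f y) - ?c (f x) \<le> (\<integral>t. indicator {x<..<y} t * (indicator {t. \<alpha> < f t \<and> f t < \<beta>} t * \<bar>g t\<bar>) \<partial>lebesgue_on {0..l})"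
    proof (rule key[of p q])
      show "?c (f y) - ?c (f x) \<le> \<bar>f q - f p\<bar>" using pq(4,5) by linarith
      show "\<alpha> < f t \<and> f t < \<beta>" if "p < t" "t < q" for t
        using pq(6)[OF that] bd(1)[of "f x"] bd(2)[of "f y"] by linarith
    qed fact+
    then show ?thesis using 1 by simp
  next
    case 2
    have c': "continuous_on {x..y} (\<lambda>t. - f t)" by (intro continuous_intros c)
    have ends: "- f x \<le> - ?c (f x)" "- ?c (f x) < - ?c (f y)" "- ?c (f y) \<le> - f y"
      using 2 ab by (auto simp: clamp_real_def max_def min_def split: if_splits)
    obtain p q where pq: "x \<le> p" "p \<le> q" "q \<le> y" "- f p \<le> - ?c (f x)" "- ?c (f y) \<le> - f q"
      "\<And>t. p < t \<Longrightarrow> t < q \<Longrightarrow> - ?c (f x) < - f t \<and> - f t < - ?c (f y)"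
      using crossing_interval[OF c' xy(2) ends] by blast
    have bd: "\<alpha> \<le> ?c z" "?c z \<le> \<beta>" for z using ab by (auto simp: clamp_real_def)
    have "?c (f x) - ?c (f y) \<le> (\<integral>t. indicator {x<..<y} t * (indicator {t. \<alpha> < f t \<and> f t < \<beta>} t * \<bar>g t\<bar>) \<partial>lebesgue_on {0..l})"
    proof (rule key[of p q])
      show "?c (f x) - ?c (f y) \<le> \<bar>f q - f p\<bar>" using pq(4,5) by linarith
      show "\<alpha> < f t \<and> f t < \<beta>" if "p < t" "t < q" for t
        using pq(6)[OF that] bd(1)[of "f y"] bd(2)[of "f x"] by linarith
    qed fact+
    then show ?thesis using 2 by simp
  next
    case 3
    then show ?thesis by (auto intro!: Bochner_Integration.integral_nonneg)
  qed
qed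


lemma layer_integral_ge:
  fixes f g :: "real \<Rightarrow> real"
  assumes cont: "continuous_on {0..l} f" and gi: "integrable (lebesgue_on {0..l}) g"
    and ftc: "\<And>x y. 0 \<le> x \<Longrightarrow> x \<le> y \<Longrightarrow> y \<le> l \<Longrightarrow>
       f y - f x = (\<integral>t. indicator {x<..<y} t * g t \<partial>lebesgue_on {0..l})"
    and ab: "\<alpha> < \<beta>" and xy: "0 \<le> x" "x \<le> y" "y \<le> l"
  defines "c z \<equiv> clamp_real \<alpha> \<beta> (f z)"
  shows "\<bar>c x - c 0\<bar> + \<bar>c y - c x\<bar> + \<bar>c l - c y\<bar>
    \<le> (\<integral>t. indicator {t. \<alpha> < f t \<and> f t < \<beta>} t * \<bar>g t\<bar> \<partial>lebesgue_on {0..l})"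
proof -
  let ?w = "\<lambda>t. indicator {t. \<alpha> < f t \<and> f t < \<beta>} t * \<bar>g t\<bar>"
  let ?I = "\<lambda>p q. \<integral>t. indicator {p<..<q} t * ?w t \<partial>lebesgue_on {0..l}"
  have [measurable]: "f \<in> borel_measurable (lebesgue_on {0..l})"
    by (intro continuous_imp_measurable_on_sets_lebesgue cont) auto
  have [measurable]: "g \<in> borel_measurable (lebesgue_on {0..l})" using gi by simp
  have im[measurable]: "indicat_real {p<..<q} \<in> borel_measurable (lebesgue_on {0..l})" for p q
    by (intro measurable_restrict_space1 borel_measurable_indicator) auto
  have wm[measurable]: "?w \<in> borel_measurable (lebesgue_on {0..l})"
    unfolding indicator_def mem_Collect_eq by measurable
  have iw: "integrable (lebesgue_on {0..l}) ?w"
    by (rule Bochner_Integration.integrable_bound[OF gi wm]) (auto simp: indicator_def)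
  have iwi: "integrable (lebesgue_on {0..l}) (\<lambda>t. indicator {p<..<q} t * ?w t)" for p q
  proof (rule Bochner_Integration.integrable_bound[OF iw])
    show "(\<lambda>t. indicator {p<..<q} t * ?w t) \<in> borel_measurable (lebesgue_on {0..l})"
      using im wm by (rule borel_measurable_times)
  qed (auto simp: indicator_def)
  have "\<bar>c x - c 0\<bar> + \<bar>c y - c x\<bar> + \<bar>c l - c y\<bar> \<le> ?I 0 x + ?I x y + ?I y l"
    unfolding c_def using xy by (intro add_mono clamp_variation_le[OF cont gi ftc ab]) auto
  also have "\<dots> = (\<integral>t. indicator {0<..<x} t * ?w t + indicator {x<..<y} t * ?w t + indicator {y<..<l} t * ?w t \<partial>lebesgue_on {0..l})"
    by (simp only: Bochner_Integration.integral_add Bochner_Integration.integrable_add iwi)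
  also have "\<dots> \<le> (\<integral>t. ?w t \<partial>lebesgue_on {0..l})"
    by (rule integral_mono[OF Bochner_Integration.integrable_add[OF Bochner_Integration.integrable_add[OF iwi iwi] iwi] iw])
      (use xy in \<open>auto simp: indicator_def\<close>)
  finally show ?thesis .
qed

text \<open>
  A discrete coarea inequality: every level between two values of \<open>w\<close> defines a cut, and
  \<open>|w (tgt e) - w (src e)|\<close> is the measure of the levels whose cut is crossed by \<open>e\<close>.
\<close>

lemma cut_variation_ge:
  fixes w :: "'v \<Rightarrow> real" and m :: "'e \<Rightarrow> real" and src tgt :: "'e \<Rightarrow> 'v"
  assumes fin: "finite E" and m: "\<And>e. e \<in> E \<Longrightarrow> 0 \<le> m e"
    and cut: "\<And>S. (\<exists>e\<in>E. src e \<in> S \<or> tgt e \<in> S) \<Longrightarrow> (\<exists>e\<in>E. src e \<notin> S \<or> tgt e \<notin> S) \<Longrightarrow>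
      N \<le> (\<Sum>e | e \<in> E \<and> (src e \<in> S) \<noteq> (tgt e \<in> S). m e)"
    and W: "W = src ` E \<union> tgt ` E" and ab: "a \<in> w ` W" "b \<in> w ` W" "a \<le> b"
  shows "N * (b - a) \<le> (\<Sum>e\<in>E. m e * \<bar>w (tgt e) - w (src e)\<bar>)"
proof -
  define I where "I e = {min (w (tgt e)) (w (src e))..<max (w (tgt e)) (w (src e))}" for e
  have iI: "integrable lborel (indicat_real (I e))" for e
    unfolding I_def by (intro integrable_real_indicator) (use ab in auto)
  have "N * (b - a) = (\<integral>s. N * indicator {a..<b} s \<partial>lborel)"
    using ab by simp
  also have "\<dots> \<le> (\<integral>s. (\<Sum>e\<in>E. m e * indicator (I e) s) \<partial>lborel)"
  proof (rule integral_mono)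
    show "integrable lborel (\<lambda>s. N * indicator {a..<b} s)"
      by (intro integrable_mult_right integrable_real_indicator) (use ab in auto)
    show "integrable lborel (\<lambda>s. \<Sum>e\<in>E. m e * indicator (I e) s)"
      using iI by (intro Bochner_Integration.integrable_sum integrable_mult_right) auto
    fix s :: real
    show "N * indicator {a..<b} s \<le> (\<Sum>e\<in>E. m e * indicator (I e) s)"
    proof (cases "s \<in> {a..<b}")
      case False
      then have "N * indicator {a..<b} s = 0" by simp
      moreover have "0 \<le> (\<Sum>e\<in>E. m e * indicator (I e) s)"
        using m by (intro sum_nonneg mult_nonneg_nonneg) auto
      ultimately show ?thesis by linarith
    next
      case True
      have "N \<le> (\<Sum>e | e \<in> E \<and> (src e \<in> {v. w v > s}) \<noteq> (tgt e \<in> {v. w v > s}). m e)"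
      proof (rule cut)
        from ab obtain v v' where v: "v \<in> W" "w v = a" "v' \<in> W" "w v' = b" by auto
        with True have "v \<notin> {v. w v > s}" "v' \<in> {v. w v > s}" by auto
        then show "\<exists>e\<in>E. src e \<in> {v. w v > s} \<or> tgt e \<in> {v. w v > s}"
            "\<exists>e\<in>E. src e \<notin> {v. w v > s} \<or> tgt e \<notin> {v. w v > s}"
          using v W by blast+
      qed
      also have "\<dots> = (\<Sum>e | e \<in> E \<and> (src e \<in> {v. w v > s}) \<noteq> (tgt e \<in> {v. w v > s}). m e * indicator (I e) s)"
        by (intro sum.cong) (auto simp: I_def indicator_def)
      also have "\<dots> \<le> (\<Sum>e\<in>E. m e * indicator (I e) s)"
        using fin m by (intro sum_mono2) (auto intro!: mult_nonneg_nonneg)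
      finally show ?thesis using True by simp
    qed
  qed
  also have "\<dots> = (\<Sum>e\<in>E. m e * (\<integral>s. indicator (I e) s \<partial>lborel))"
    using iI by (subst Bochner_Integration.integral_sum) auto
  also have "\<dots> = (\<Sum>e\<in>E. m e * \<bar>w (tgt e) - w (src e)\<bar>)"
    by (intro sum.cong) (auto simp: I_def max_def min_def)
  finally show ?thesis .
qed

section \<open>The disjoint union of the edges as a measure space\<close>

lemma sigma_finite_lebesgue_real: "sigma_finite_measure (lebesgue :: real measure)"
proof
  show "\<exists>A. countable A \<and> A \<subseteq> sets (lebesgue :: real measure) \<and> \<Union> A = space lebesgue \<and> (\<forall>a\<in>A. emeasure lebesgue a \<noteq> \<infinity>)"
  proof (intro exI conjI)
    show "countable (range (\<lambda>n::nat. {- real n..real n}))" by simp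
    show "\<Union> (range (\<lambda>n::nat. {- real n..real n})) = space lebesgue"
    proof (auto)
      fix x :: real
      obtain n where "\<bar>x\<bar> \<le> real n" using real_arch_simple by blast
      then show "\<exists>n. - real n \<le> x \<and> x \<le> real n" by (intro exI[of _ n]) auto
    qed
  qed auto
qed

text \<open>
  The disjoint union of the edges \<open>{0..len e}\<close>, where edge \<open>e\<close> carries Lebesgue measure times \<open>(m e)\<^sup>2\<close>.
\<close>

definition edge_measure :: "'e set \<Rightarrow> ('e \<Rightarrow> real) \<Rightarrow> ('e \<Rightarrow> real) \<Rightarrow> ('e \<times> real) measure" where
  "edge_measure E len m =
    density (restrict_space (count_space E \<Otimes>\<^sub>M lebesgue) (Sigma E (\<lambda>e. {0..len e}))) (\<lambda>p. ennreal ((m (fst p))\<^sup>2))"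

lemma space_edge_measure: "space (edge_measure E len m) = Sigma E (\<lambda>e. {0..len e})"
  by (auto simp: edge_measure_def space_restrict_space space_pair_measure)

lemma edge_sets_Sigma:
  assumes "finite E"
  shows "Sigma E (\<lambda>e. {0..len e}) \<inter> space (count_space E \<Otimes>\<^sub>M lebesgue) \<in> sets (count_space E \<Otimes>\<^sub>M (lebesgue :: real measure))"
proof -
  have "Sigma E (\<lambda>e. {0..len e}) = (\<Union>e\<in>E. {e} \<times> {0..len e :: real})" by auto
  also have "\<dots> \<in> sets (count_space E \<Otimes>\<^sub>M lebesgue)"
    using assms by (intro sets.finite_UN pair_measureI) auto
  finally show ?thesis by (intro sets.Int) auto
qed

lemma borel_measurable_edge_measure:
  fixes f :: "'e \<times> real \<Rightarrow> real"
  assumes fin: "finite E" and f: "\<And>e. e \<in> E \<Longrightarrow> (\<lambda>x. f (e, x)) \<in> borel_measurable (lebesgue_on {0..len e})"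
  shows "f \<in> borel_measurable (edge_measure E len m)"
    and "(\<lambda>p. indicator (Sigma E (\<lambda>e. {0..len e})) p *\<^sub>R f p) \<in> borel_measurable (count_space E \<Otimes>\<^sub>M lebesgue)"
    and "f \<in> borel_measurable (restrict_space (count_space E \<Otimes>\<^sub>M lebesgue) (Sigma E (\<lambda>e. {0..len e})))"
proof -
  show 1: "(\<lambda>p. indicator (Sigma E (\<lambda>e. {0..len e})) p *\<^sub>R f p) \<in> borel_measurable (count_space E \<Otimes>\<^sub>M lebesgue)"
  proof (rule measurable_pair_measure_countable1)
    show "countable E" using fin by (rule countable_finite)
    fix e assume e: "e \<in> E"
    have "(\<lambda>x. indicator {0..len e} x *\<^sub>R f (e, x)) \<in> borel_measurable lebesgue"
      using f[OF e] by (subst (asm) borel_measurable_restrict_space_iff) auto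
    then show "(\<lambda>y. indicator (Sigma E (\<lambda>e. {0..len e})) (e, y) *\<^sub>R f (e, y)) \<in> borel_measurable lebesgue"
      using e by (simp add: indicator_def)
  qed
  then show 2: "f \<in> borel_measurable (restrict_space (count_space E \<Otimes>\<^sub>M lebesgue) (Sigma E (\<lambda>e. {0..len e})))"
    by (subst borel_measurable_restrict_space_iff[OF edge_sets_Sigma[OF fin]])
  then show "f \<in> borel_measurable (edge_measure E len m)"
    by (simp add: edge_measure_def)
qed

lemma integral_edge_measure:
  fixes f :: "'e \<times> real \<Rightarrow> real"
  assumes fin: "finite E" and f: "\<And>e. e \<in> E \<Longrightarrow> integrable (lebesgue_on {0..len e}) (\<lambda>x. f (e, x))"
  shows "integrable (edge_measure E len m) f"
    and "(\<integral>p. f p \<partial>edge_measure E len m) = (\<Sum>e\<in>E. (m e)\<^sup>2 * (\<integral>x. f (e, x) \<partial>lebesgue_on {0..len e}))"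
proof -
  interpret P: pair_sigma_finite "count_space E" "lebesgue :: real measure"
    using sigma_finite_measure_count_space_finite[OF fin] sigma_finite_lebesgue_real
    by (simp add: pair_sigma_finite_def)
  let ?\<Omega> = "Sigma E (\<lambda>e. {0..len e})"
  let ?R = "restrict_space (count_space E \<Otimes>\<^sub>M lebesgue) ?\<Omega>"
  let ?h = "\<lambda>p. (m (fst p))\<^sup>2 *\<^sub>R f p"
  have fm: "\<And>e. e \<in> E \<Longrightarrow> (\<lambda>x. f (e, x)) \<in> borel_measurable (lebesgue_on {0..len e})" using f by auto
  have hm: "\<And>e. e \<in> E \<Longrightarrow> (\<lambda>x. ?h (e, x)) \<in> borel_measurable (lebesgue_on {0..len e})" using fm by auto
  have f_R: "f \<in> borel_measurable ?R" by (rule borel_measurable_edge_measure(3)[OF fin fm])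
  have m_R: "(\<lambda>p. (m (fst p))\<^sup>2) \<in> borel_measurable ?R" by (rule borel_measurable_edge_measure(3)[OF fin]) simp
  have slice: "(\<lambda>x. indicator ?\<Omega> (e, x) *\<^sub>R ?h (e, x)) = (\<lambda>x. indicator {0..len e} x *\<^sub>R ?h (e, x))" if "e \<in> E" for e
    using that by (auto simp: indicator_def)
  have slice_int: "integrable lebesgue (\<lambda>x. indicator {0..len e} x *\<^sub>R ?h (e, x))" if "e \<in> E" for e
  proof -
    have "integrable (lebesgue_on {0..len e}) (\<lambda>x. ?h (e, x))" using f[OF that] by simp
    then show ?thesis by (subst (asm) integrable_restrict_space) auto
  qed
  have int: "integrable (count_space E \<Otimes>\<^sub>M lebesgue) (\<lambda>p. indicator ?\<Omega> p *\<^sub>R ?h p)"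
  proof (rule P.Fubini_integrable)
    show "(\<lambda>p. indicator ?\<Omega> p *\<^sub>R ?h p) \<in> borel_measurable (count_space E \<Otimes>\<^sub>M lebesgue)"
      by (rule borel_measurable_edge_measure(2)[OF fin hm])
    show "integrable (count_space E) (\<lambda>e. \<integral>x. norm (indicator ?\<Omega> (e, x) *\<^sub>R ?h (e, x)) \<partial>lebesgue)"
      by (rule integrable_count_space[OF fin])
    show "AE e in count_space E. integrable lebesgue (\<lambda>x. indicator ?\<Omega> (e, x) *\<^sub>R ?h (e, x))"
      using slice slice_int by (auto simp: AE_count_space)
  qed
  have em: "edge_measure E len m = density ?R (\<lambda>p. ennreal ((m (fst p))\<^sup>2))"
    by (simp add: edge_measure_def)
  show "integrable (edge_measure E len m) f"
    unfolding em using int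
    by (subst integrable_density[OF f_R m_R]) (auto simp: integrable_restrict_space[OF edge_sets_Sigma[OF fin]])
  have "(\<integral>p. f p \<partial>edge_measure E len m) = (\<integral>p. ?h p \<partial>?R)"
    unfolding em by (subst integral_density[OF f_R m_R]) auto
  also have "\<dots> = (\<integral>p. indicator ?\<Omega> p *\<^sub>R ?h p \<partial>(count_space E \<Otimes>\<^sub>M lebesgue))"
    by (rule integral_restrict_space[OF edge_sets_Sigma[OF fin]])
  also have "\<dots> = (\<integral>e. \<integral>x. indicator ?\<Omega> (e, x) *\<^sub>R ?h (e, x) \<partial>lebesgue \<partial>count_space E)"
    by (rule P.integral_fst'[OF int, symmetric])
  also have "\<dots> = (\<Sum>e\<in>E. \<integral>x. indicator ?\<Omega> (e, x) *\<^sub>R ?h (e, x) \<partial>lebesgue)"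
    by (rule lebesgue_integral_count_space_finite[OF fin])
  also have "\<dots> = (\<Sum>e\<in>E. (m e)\<^sup>2 * (\<integral>x. f (e, x) \<partial>lebesgue_on {0..len e}))"
  proof (rule sum.cong[OF refl])
    fix e assume e: "e \<in> E"
    show "(\<integral>x. indicator ?\<Omega> (e, x) *\<^sub>R ?h (e, x) \<partial>lebesgue) = (m e)\<^sup>2 * (\<integral>x. f (e, x) \<partial>lebesgue_on {0..len e})"
      unfolding slice[OF e] by (subst integral_restrict_space[symmetric]) auto
  qed
  finally show "(\<integral>p. f p \<partial>edge_measure E len m) = (\<Sum>e\<in>E. (m e)\<^sup>2 * (\<integral>x. f (e, x) \<partial>lebesgue_on {0..len e}))" .
qed

lemma finite_measure_edge_measure:
  assumes fin: "finite E" and len: "\<And>e. e \<in> E \<Longrightarrow> 0 \<le> len e"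
  shows "finite_measure (edge_measure E len m)"
    and "measure (edge_measure E len m) (space (edge_measure E len m)) = (\<Sum>e\<in>E. (m e)\<^sup>2 * len e)"
proof -
  have i1: "integrable (lebesgue_on {0..len e}) (\<lambda>x. 1 :: real)" for e
    using finite_measure.integrable_const[OF finite_measure_lebesgue_on] by auto
  have "integrable (edge_measure E len m) (\<lambda>x. 1 :: real)"
    by (rule integral_edge_measure(1)[OF fin i1])
  then show 1: "finite_measure (edge_measure E len m)"
    by (intro finite_measureI) (simp add: integrable_iff_bounded less_top)
  have "measure (edge_measure E len m) (space (edge_measure E len m)) = (\<integral>p. 1 \<partial>edge_measure E len m)"
    by simp
  also have "\<dots> = (\<Sum>e\<in>E. (m e)\<^sup>2 * len e)"
    using len by (subst integral_edge_measure(2)[OF fin i1]) (auto intro!: sum.cong simp: measure_restrict_space)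
  finally show "measure (edge_measure E len m) (space (edge_measure E len m)) = (\<Sum>e\<in>E. (m e)\<^sup>2 * len e)" .
qed

section \<open>A Poincare inequality for weighted graphs\<close>

text \<open>
  A Poincare inequality on a graph in which the edge \<open>e\<close> is replaced by \<open>m e\<close> parallel copies, each stretched
  by the factor \<open>m e\<close> (for integral \<open>m e\<close>).  For the function that is transported to all copies the energy does not change,
  since the derivative is divided by \<open>m e\<close> and the measure multiplied by \<open>(m e)\<^sup>2\<close>.  Almost every level
  strictly between the minimum and the maximum is attained at least \<open>N\<close> times on the new graph, as every cut is
  crossed by at least \<open>N\<close> copies of edges; a level above all vertex values or below all of them is attained at
  least twice inside the edge that contains the maximum or the minimum, which is why \<open>N \<le> 2\<close> is needed.
\<close>

lemma weighted_poincare: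
  fixes u g :: "'e \<Rightarrow> real \<Rightarrow> real" and m len :: "'e \<Rightarrow> real" and src tgt :: "'e \<Rightarrow> 'v" and val :: "'v \<Rightarrow> real"
  assumes E: "finite E" "E \<noteq> {}" and len: "\<And>e. e \<in> E \<Longrightarrow> 0 < len e" and m: "\<And>e. e \<in> E \<Longrightarrow> 1 \<le> m e"
    and cont: "\<And>e. e \<in> E \<Longrightarrow> continuous_on {0..len e} (u e)"
    and ends: "\<And>e. e \<in> E \<Longrightarrow> u e 0 = val (src e)" "\<And>e. e \<in> E \<Longrightarrow> u e (len e) = val (tgt e)"
    and gm: "\<And>e. e \<in> E \<Longrightarrow> g e \<in> borel_measurable (lebesgue_on {0..len e})"
    and g2: "\<And>e. e \<in> E \<Longrightarrow> integrable (lebesgue_on {0..len e}) (\<lambda>x. (g e x)\<^sup>2)"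
    and ftc: "\<And>e x y. e \<in> E \<Longrightarrow> 0 \<le> x \<Longrightarrow> x \<le> y \<Longrightarrow> y \<le> len e \<Longrightarrow>
       u e y - u e x = (\<integral>t. indicator {x<..<y} t * g e t \<partial>lebesgue_on {0..len e})"
    and N: "0 < N" "N \<le> 2"
    and cut: "\<And>S. (\<exists>e\<in>E. src e \<in> S \<or> tgt e \<in> S) \<Longrightarrow> (\<exists>e\<in>E. src e \<notin> S \<or> tgt e \<notin> S) \<Longrightarrow>
      N \<le> (\<Sum>e | e \<in> E \<and> (src e \<in> S) \<noteq> (tgt e \<in> S). m e)"
  shows "\<exists>c. (N * pi / (\<Sum>e\<in>E. (m e)\<^sup>2 * len e))\<^sup>2 * (\<Sum>e\<in>E. (m e)\<^sup>2 * (\<integral>x. (u e x - c)\<^sup>2 \<partial>lebesgue_on {0..len e}))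
    \<le> (\<Sum>e\<in>E. \<integral>x. (g e x)\<^sup>2 \<partial>lebesgue_on {0..len e})"
proof -
  define M where "M = edge_measure E len m"
  define U where "U p = u (fst p) (snd p)" for p
  define Gd where "Gd p = g (fst p) (snd p) / m (fst p)" for p
  have len0: "\<And>e. e \<in> E \<Longrightarrow> 0 \<le> len e" using len by (simp add: less_imp_le)
  have fin_M: "finite_measure M" "measure M (space M) = (\<Sum>e\<in>E. (m e)\<^sup>2 * len e)"
    unfolding M_def by (rule finite_measure_edge_measure[OF E(1) len0], assumption)+
  interpret M: finite_measure M by (rule fin_M)
  have sp: "space M = Sigma E (\<lambda>e. {0..len e})" by (simp add: M_def space_edge_measure)
  have um: "\<And>e. e \<in> E \<Longrightarrow> u e \<in> borel_measurable (lebesgue_on {0..len e})"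
    by (intro continuous_imp_measurable_on_sets_lebesgue cont) auto
  have gi: "\<And>e. e \<in> E \<Longrightarrow> integrable (lebesgue_on {0..len e}) (g e)"
    using integrable_of_square[OF finite_measure_Icc gm] g2 by simp
  have Um: "U \<in> borel_measurable M"
    unfolding M_def by (rule borel_measurable_edge_measure(1)[OF E(1)]) (simp add: U_def um)
  have Gm: "Gd \<in> borel_measurable M"
    unfolding M_def by (rule borel_measurable_edge_measure(1)[OF E(1)]) (auto simp: Gd_def intro!: borel_measurable_divide gm)
  have G2e: "integrable (lebesgue_on {0..len e}) (\<lambda>x. (Gd (e, x))\<^sup>2)" if "e \<in> E" for e
    using g2[OF that] by (simp add: Gd_def power_divide)
  have G2: "integrable M (\<lambda>p. (Gd p)\<^sup>2)"
    unfolding M_def by (rule integral_edge_measure(1)[OF E(1) G2e])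
  have energy: "(\<integral>p. (Gd p)\<^sup>2 \<partial>M) = (\<Sum>e\<in>E. \<integral>x. (g e x)\<^sup>2 \<partial>lebesgue_on {0..len e})"
    unfolding M_def using m
    by (subst integral_edge_measure(2)[OF E(1) G2e]) (force intro!: sum.cong simp: Gd_def power_divide)+
  have mass: "(\<integral>p. (U p - c)\<^sup>2 \<partial>M) = (\<Sum>e\<in>E. (m e)\<^sup>2 * (\<integral>x. (u e x - c)\<^sup>2 \<partial>lebesgue_on {0..len e}))" for c
    unfolding M_def
  proof (subst integral_edge_measure(2)[OF E(1)])
    fix e assume e: "e \<in> E"
    have "continuous_on {0..len e} (\<lambda>x. (u e x - c)\<^sup>2)" by (intro continuous_intros cont e)
    then have "integrable (lebesgue_on {0..len e}) (\<lambda>x. (u e x - c)\<^sup>2)"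
      by (rule integrable_continuous_lebesgue_on)
    then show "integrable (lebesgue_on {0..len e}) (\<lambda>x. (U (e, x) - c)\<^sup>2)" by (simp add: U_def)
  qed (simp add: U_def)
  have total: "measure M (space M) = (\<Sum>e\<in>E. (m e)\<^sup>2 * len e)" by (rule fin_M)
  have m0: "0 < m e" if "e \<in> E" for e using m[OF that] by linarith
  have pos: "measure M (space M) > 0"
    unfolding total using E len m0 by (intro sum_pos mult_pos_pos zero_less_power) auto
  \<comment> \<open>extreme points exist by compactness of each edge\<close>
  have "\<exists>xm. xm \<in> space M \<and> (\<forall>x\<in>space M. U xm \<le> U x)"
  proof -
    have "\<forall>e\<in>E. \<exists>x\<in>{0..len e}. \<forall>y\<in>{0..len e}. u e x \<le> u e y"
      using len0 by (intro ballI continuous_attains_inf cont) auto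
    then obtain X where X: "\<And>e. e \<in> E \<Longrightarrow> X e \<in> {0..len e}" "\<And>e y. e \<in> E \<Longrightarrow> y \<in> {0..len e} \<Longrightarrow> u e (X e) \<le> u e y" by metis
    obtain e where e: "e \<in> E" "\<And>e'. e' \<in> E \<Longrightarrow> u e (X e) \<le> u e' (X e')"
      using arg_min_if_finite[OF E, of "\<lambda>e. u e (X e)"] arg_min_least[OF E, of _ "\<lambda>e. u e (X e)"] by blast
    have "u e (X e) \<le> u e' y" if "e' \<in> E" "y \<in> {0..len e'}" for e' y
      using order_trans[OF e(2) X(2)] that by blast
    then show ?thesis
      using e(1) X(1)[OF e(1)] by (intro exI[of _ "(e, X e)"]) (auto simp: sp U_def)
  qed
  then obtain xm where xm: "xm \<in> space M" "\<And>x. x \<in> space M \<Longrightarrow> U xm \<le> U x" by blast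
  have "\<exists>xp. xp \<in> space M \<and> (\<forall>x\<in>space M. U x \<le> U xp)"
  proof -
    have "\<forall>e\<in>E. \<exists>x\<in>{0..len e}. \<forall>y\<in>{0..len e}. u e y \<le> u e x"
      using len0 by (intro ballI continuous_attains_sup cont) auto
    then obtain X where X: "\<And>e. e \<in> E \<Longrightarrow> X e \<in> {0..len e}" "\<And>e y. e \<in> E \<Longrightarrow> y \<in> {0..len e} \<Longrightarrow> u e y \<le> u e (X e)" by metis
    obtain e where e: "e \<in> E" "\<And>e'. e' \<in> E \<Longrightarrow> - u e (X e) \<le> - u e' (X e')"
      using arg_min_if_finite[OF E, of "\<lambda>e. - u e (X e)"] arg_min_least[OF E, of _ "\<lambda>e. - u e (X e)"] by blast
    have "u e' y \<le> u e (X e)" if "e' \<in> E" "y \<in> {0..len e'}" for e' y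
      using X(2)[OF that] e(2)[OF that(1)] by linarith
    then show ?thesis
      using e(1) X(1)[OF e(1)] by (intro exI[of _ "(e, X e)"]) (auto simp: sp U_def)
  qed
  then obtain xp where xp: "xp \<in> space M" "\<And>x. x \<in> space M \<Longrightarrow> U x \<le> U xp" by blast
  have cross: "N * (\<beta> - \<alpha>) \<le> (\<integral>p. indicator {p. \<alpha> < U p \<and> U p < \<beta>} p * \<bar>Gd p\<bar> \<partial>M)"
    if ab: "U xm \<le> \<alpha>" "\<alpha> < \<beta>" "\<beta> \<le> U xp" for \<alpha> \<beta>
  proof -
    define J where "J e = (\<integral>x. indicator {x. \<alpha> < u e x \<and> u e x < \<beta>} x * \<bar>g e x\<bar> \<partial>lebesgue_on {0..len e})" for e
    define w where "w v = clamp_real \<alpha> \<beta> (val v)" for v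
    define c where "c e x = clamp_real \<alpha> \<beta> (u e x)" for e x
    define W where "W = src ` E \<union> tgt ` E"
    define a where "a = Min (w ` W)"
    define b where "b = Max (w ` W)"
    have W: "finite (w ` W)" "w ` W \<noteq> {}" using E by (auto simp: W_def)
    have abW: "a \<in> w ` W" "b \<in> w ` W" "a \<le> b"
      using W Min_le[OF W(1), of b] by (auto simp: a_def b_def)
    have w_ab: "a \<le> w (src e)" "w (src e) \<le> b" "a \<le> w (tgt e)" "w (tgt e) \<le> b" if "e \<in> E" for e
      using W that by (auto simp: a_def b_def W_def)
    have w_rng: "\<alpha> \<le> w v" "w v \<le> \<beta>" for v using ab by (auto simp: w_def clamp_real_def)
    have ab_rng: "\<alpha> \<le> a" "b \<le> \<beta>" using abW w_rng by auto
    have J3: "\<bar>c e x - w (src e)\<bar> + \<bar>c e y - c e x\<bar> + \<bar>w (tgt e) - c e y\<bar> \<le> J e"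
      if "e \<in> E" "0 \<le> x" "x \<le> y" "y \<le> len e" for e x y
      using layer_integral_ge[OF cont[OF that(1)] gi[OF that(1)] ftc[OF that(1)] ab(2) that(2-4)] ends[OF that(1)]
      by (simp add: J_def c_def w_def)
    \<comment> \<open>the variation on \<open>e\<close> in excess of the difference of the values at its ends\<close>
    define D where "D e = J e - \<bar>w (tgt e) - w (src e)\<bar>" for e
    have D0: "0 \<le> D e" if "e \<in> E" for e
      using J3[OF that order_refl order_refl len0[OF that]] ends(1)[OF that] by (simp add: D_def c_def w_def)
    have cutb: "N * (b - a) \<le> (\<Sum>e\<in>E. m e * \<bar>w (tgt e) - w (src e)\<bar>)"
      using m by (intro cut_variation_ge[OF E(1) _ cut W_def abW]) (auto intro: order_trans[OF zero_le_one])
    obtain em sm ep tp where xmp: "xm = (em, sm)" "xp = (ep, tp)" by (metis surj_pair)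
    have em: "em \<in> E" "0 \<le> sm" "sm \<le> len em" "c em sm = \<alpha>"
      using xm(1) ab xmp by (auto simp: sp U_def c_def clamp_real_def)
    have ep: "ep \<in> E" "0 \<le> tp" "tp \<le> len ep" "c ep tp = \<beta>"
      using xp(1) ab xmp by (auto simp: sp U_def c_def clamp_real_def)
    have Dsum: "2 * (\<beta> - b) + 2 * (a - \<alpha>) \<le> (\<Sum>e\<in>E. D e)"
    proof (cases "em = ep")
      case True
      have "2 * (\<beta> - b) + 2 * (a - \<alpha>) \<le> D em"
      proof (cases "sm \<le> tp")
        case le: True
        show ?thesis
          using J3[OF em(1,2) le] ep em True w_rng[of "src em"] w_rng[of "tgt em"] w_ab[OF em(1)] abW(3) ab(2)
          by (simp add: D_def)
      next
        case False
        then show ?thesis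
          using J3[of em tp sm] ep em True w_rng[of "src em"] w_rng[of "tgt em"] w_ab[OF em(1)] abW(3) ab(2)
          by (simp add: D_def)
      qed
      also have "\<dots> \<le> (\<Sum>e\<in>E. D e)"
        using em D0 E by (intro member_le_sum) auto
      finally show ?thesis .
    next
      case False
      have "2 * (\<beta> - b) \<le> D ep"
        using J3[OF ep(1,2) order_refl ep(3)] ep w_rng[of "src ep"] w_rng[of "tgt ep"] w_ab[OF ep(1)]
        by (simp add: D_def)
      moreover have "2 * (a - \<alpha>) \<le> D em"
        using J3[OF em(1,2) order_refl em(3)] em w_rng[of "src em"] w_rng[of "tgt em"] w_ab[OF em(1)]
        by (simp add: D_def)
      moreover have "D ep + D em = (\<Sum>e\<in>{ep, em}. D e)" using False by simp
      moreover have "\<dots> \<le> (\<Sum>e\<in>E. D e)"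
        using em ep D0 E by (intro sum_mono2) auto
      ultimately show ?thesis by linarith
    qed
    have "N * (\<beta> - \<alpha>) = N * (b - a) + N * ((\<beta> - b) + (a - \<alpha>))" by (simp add: algebra_simps)
    also have "\<dots> \<le> N * (b - a) + 2 * ((\<beta> - b) + (a - \<alpha>))"
      using N ab_rng by (intro add_left_mono mult_right_mono) auto
    also have "\<dots> \<le> (\<Sum>e\<in>E. m e * \<bar>w (tgt e) - w (src e)\<bar>) + (\<Sum>e\<in>E. D e)"
      using cutb Dsum by simp
    also have "\<dots> \<le> (\<Sum>e\<in>E. m e * \<bar>w (tgt e) - w (src e)\<bar>) + (\<Sum>e\<in>E. m e * D e)"
      using D0 m mult_right_mono[of 1 "m _" "D _"] by (intro add_left_mono sum_mono) force
    also have "\<dots> = (\<Sum>e\<in>E. m e * J e)"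
      unfolding sum.distrib[symmetric] by (simp add: D_def algebra_simps)
    also have "\<dots> = (\<Sum>e\<in>E. (m e)\<^sup>2 * (\<integral>x. indicator {p. \<alpha> < U p \<and> U p < \<beta>} (e, x) * \<bar>Gd (e, x)\<bar> \<partial>lebesgue_on {0..len e}))"
    proof (rule sum.cong[OF refl])
      fix e assume e: "e \<in> E"
      have "(\<integral>x. indicator {p. \<alpha> < U p \<and> U p < \<beta>} (e, x) * \<bar>Gd (e, x)\<bar> \<partial>lebesgue_on {0..len e}) = (\<integral>x. (indicator {x. \<alpha> < u e x \<and> u e x < \<beta>} x * \<bar>g e x\<bar>) / m e \<partial>lebesgue_on {0..len e})"
        using m[OF e] by (intro Bochner_Integration.integral_cong) (auto simp: U_def Gd_def indicator_def)
      also have "\<dots> = J e / m e" by (simp add: J_def)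
      finally show "m e * J e = (m e)\<^sup>2 * (\<integral>x. indicator {p. \<alpha> < U p \<and> U p < \<beta>} (e, x) * \<bar>Gd (e, x)\<bar> \<partial>lebesgue_on {0..len e})"
        using m[OF e] by (simp add: power2_eq_square)
    qed
    also have "\<dots> = (\<integral>p. indicator {p. \<alpha> < U p \<and> U p < \<beta>} p * \<bar>Gd p\<bar> \<partial>M)"
      unfolding M_def
    proof (rule integral_edge_measure(2)[OF E(1), symmetric])
      fix e assume e: "e \<in> E"
      note [measurable] = um[OF e] gm[OF e]
      have meas: "(\<lambda>x. indicator {p. \<alpha> < U p \<and> U p < \<beta>} (e, x) * \<bar>Gd (e, x)\<bar>) \<in> borel_measurable (lebesgue_on {0..len e})"
        unfolding indicator_def mem_Collect_eq U_def Gd_def fst_conv snd_conv by measurable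
      show "integrable (lebesgue_on {0..len e}) (\<lambda>x. indicator {p. \<alpha> < U p \<and> U p < \<beta>} (e, x) * \<bar>Gd (e, x)\<bar>)"
      proof (rule Bochner_Integration.integrable_bound[OF _ meas])
        show "integrable (lebesgue_on {0..len e}) (\<lambda>x. g e x / m e)" using gi[OF e] by simp
      qed (auto simp: indicator_def Gd_def)
    qed
    finally show ?thesis .
  qed
  from M.poincare_from_layers[OF Um Gm G2 N(1) pos xm xp cross]
  show ?thesis unfolding energy mass total by blast
qed

section \<open>Weak derivatives on an interval\<close>

lemma L2_interval_integrable: "L2_interval l g \<Longrightarrow> integrable (lebesgue_on {0..l}) g"
  unfolding L2_interval_def using integrable_of_square[OF finite_measure_Icc] by blast

lemma DERIV_square_positive_part:
  "((\<lambda>s. (max 0 s)\<^sup>2) has_real_derivative 2 * max 0 s) (at (s :: real))"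
proof -
  consider "s < 0" | "s = 0" | "s > 0" by linarith
  then show ?thesis
  proof cases
    case 1
    have "((\<lambda>s. 0) has_real_derivative 0) (at s)" by simp
    then have "((\<lambda>s. (max 0 s)\<^sup>2) has_real_derivative 0) (at s)"
      by (rule DERIV_cong_ev[THEN iffD1, OF refl _ refl, rotated])
        (use 1 in \<open>auto intro!: eventually_mono[OF eventually_nhds_in_open[of "{..<0}"]]\<close>)
    then show ?thesis using 1 by simp
  next
    case 3
    have "((\<lambda>s. s\<^sup>2) has_real_derivative 2 * s) (at s)" by (auto intro!: derivative_eq_intros)
    then have "((\<lambda>s. (max 0 s)\<^sup>2) has_real_derivative 2 * s) (at s)"
      by (rule DERIV_cong_ev[THEN iffD1, OF refl _ refl, rotated])
        (use 3 in \<open>auto intro!: eventually_mono[OF eventually_nhds_in_open[of "{0<..}"]]\<close>)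
    then show ?thesis using 3 by simp
  next
    case 2
    have "((\<lambda>h. max 0 h) \<longlongrightarrow> max 0 (0::real)) (at 0)" by (intro tendsto_intros)
    then have "((\<lambda>h. max 0 h :: real) \<longlongrightarrow> 0) (at 0)" by simp
    then have "((\<lambda>h. ((max 0 (0 + h))\<^sup>2 - (max 0 0)\<^sup>2) / h) \<longlongrightarrow> (0::real)) (at 0)"
      by (rule Lim_transform_eventually)
        (auto simp: eventually_at_filter max_def power2_eq_square)
    then show ?thesis unfolding 2 DERIV_def by simp
  qed
qed

text \<open>
  A continuously differentiable step from \<open>0\<close> to \<open>1\<close> on \<open>[0, 1]\<close>, written as a quadratic spline, and its
  derivative, a hat function of integral \<open>1\<close>.
\<close>

definition smooth_step :: "real \<Rightarrow> real" where
  "smooth_step s = 2 * ((max 0 s)\<^sup>2 - 2 * (max 0 (s - 1/2))\<^sup>2 + (max 0 (s - 1))\<^sup>2)"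

definition step_bump :: "real \<Rightarrow> real" where
  "step_bump s = 4 * (max 0 s - 2 * max 0 (s - 1/2) + max 0 (s - 1))"

lemma DERIV_smooth_step: "(smooth_step has_real_derivative step_bump s) (at s)"
proof -
  have 1: "((\<lambda>s. (max 0 (s - c))\<^sup>2) has_real_derivative 2 * max 0 (s - c)) (at s)" for c :: real
  proof -
    have "((\<lambda>s. s - c) has_real_derivative 1) (at s)" by (auto intro!: derivative_eq_intros)
    from DERIV_chain2[OF DERIV_square_positive_part this] show ?thesis by simp
  qed
  show ?thesis
    unfolding smooth_step_def[abs_def] step_bump_def
    by (rule derivative_eq_intros 1 DERIV_square_positive_part refl)+ (simp add: algebra_simps)
qed

lemma smooth_step_eq_0: "s \<le> 0 \<Longrightarrow> smooth_step s = 0"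
  by (simp add: smooth_step_def)

lemma smooth_step_eq_1: "1 \<le> s \<Longrightarrow> smooth_step s = 1"
  by (simp add: smooth_step_def power2_eq_square algebra_simps)

lemma step_bump_eq_0: "s \<le> 0 \<or> 1 \<le> s \<Longrightarrow> step_bump s = 0"
  by (auto simp: step_bump_def)

lemma step_bump_nonneg: "0 \<le> step_bump s"
  by (auto simp: step_bump_def max_def)

lemma mono_smooth_step: "s \<le> t \<Longrightarrow> smooth_step s \<le> smooth_step t"
  by (rule DERIV_nonneg_imp_nondecreasing) (use DERIV_smooth_step step_bump_nonneg in blast)+

lemma smooth_step_bounds: "0 \<le> smooth_step s" "smooth_step s \<le> 1"
  using mono_smooth_step[of "min 0 s" s] mono_smooth_step[of s "max 1 s"]
  by (auto simp: smooth_step_eq_0 smooth_step_eq_1)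

lemma continuous_on_step_bump [continuous_intros]:
  "continuous_on A f \<Longrightarrow> continuous_on A (\<lambda>x. step_bump (f x))"
  unfolding step_bump_def by (intro continuous_intros)

text \<open>The rescaled hat functions are averaging kernels.\<close>

lemma bump_average:
  fixes f :: "real \<Rightarrow> complex"
  assumes "continuous_on {0..l} f" and e: "e > 0" "0 \<le> z" "z + e \<le> l"
    and close: "\<And>t. t \<in> {z..z + e} \<Longrightarrow> norm (f t - v) \<le> \<eta>"
  shows "norm ((\<integral>t. (step_bump ((t - z) / e) / e) *\<^sub>R f t \<partial>lebesgue_on {0..l}) - v) \<le> \<eta>"
proof -
  let ?w = "\<lambda>t. step_bump ((t - z) / e) / e"
  have w0: "0 \<le> ?w t" for t using step_bump_nonneg[of "(t - z) / e"] e by simp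
  have cw: "continuous_on {0..l} ?w" using e by (intro continuous_intros) auto
  have "(\<integral>t. ?w t \<partial>lebesgue_on {0..l}) = smooth_step ((l - z) / e) - smooth_step ((0 - z) / e)"
  proof (rule integral_lebesgue_on_FTC)
    fix t assume "t \<in> {0..l}"
    have "((\<lambda>t. smooth_step ((t - z) / e)) has_real_derivative step_bump ((t - z) / e) * (1 / e)) (at t)"
      by (rule DERIV_chain2[OF DERIV_smooth_step]) (use e in \<open>auto intro!: derivative_eq_intros\<close>)
    then show "((\<lambda>t. smooth_step ((t - z) / e)) has_vector_derivative ?w t) (at t within {0..l})"
      by (simp add: has_real_derivative_iff_has_vector_derivative has_vector_derivative_at_within)
  qed (use e cw in auto)
  also have "\<dots> = 1"
    using e by (simp add: smooth_step_eq_0 smooth_step_eq_1)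
  finally have w1: "(\<integral>t. ?w t \<partial>lebesgue_on {0..l}) = 1" .
  have iw: "integrable (lebesgue_on {0..l}) ?w" by (rule integrable_continuous_lebesgue_on[OF cw])
  have iwf: "integrable (lebesgue_on {0..l}) (\<lambda>t. ?w t *\<^sub>R f t)"
    using assms by (intro integrable_continuous_lebesgue_on continuous_intros) auto
  have iwv: "integrable (lebesgue_on {0..l}) (\<lambda>t. ?w t *\<^sub>R v)"
    by (intro integrable_scaleR_left iw)
  have "(\<integral>t. ?w t *\<^sub>R v \<partial>lebesgue_on {0..l}) = v"
    using integral_scaleR_left[OF iw, of v] w1 by simp
  then have eq: "(\<integral>t. ?w t *\<^sub>R f t \<partial>lebesgue_on {0..l}) - v = (\<integral>t. ?w t *\<^sub>R f t - ?w t *\<^sub>R v \<partial>lebesgue_on {0..l})"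
    using Bochner_Integration.integral_diff[OF iwf iwv] by simp
  have "norm (\<integral>t. ?w t *\<^sub>R f t - ?w t *\<^sub>R v \<partial>lebesgue_on {0..l}) \<le> (\<integral>t. norm (?w t *\<^sub>R f t - ?w t *\<^sub>R v) \<partial>lebesgue_on {0..l})"
    by (rule integral_norm_bound)
  also have "\<dots> \<le> (\<integral>t. ?w t * \<eta> \<partial>lebesgue_on {0..l})"
  proof (rule integral_mono)
    fix t assume t: "t \<in> space (lebesgue_on {0..l})"
    have "norm (?w t *\<^sub>R f t - ?w t *\<^sub>R v) = ?w t * norm (f t - v)"
      using w0[of t] by (simp only: scaleR_diff_right[symmetric] norm_scaleR abs_of_nonneg)
    also have "\<dots> \<le> ?w t * \<eta>"
    proof (cases "t \<in> {z..z+e}")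
      case True
      then show ?thesis using close w0[of t] by (intro mult_left_mono) auto
    next
      case False
      then have "(t - z) / e \<le> 0 \<or> 1 \<le> (t - z) / e" using e by (auto simp: field_simps)
      then show ?thesis by (simp add: step_bump_eq_0)
    qed
    finally show "norm (?w t *\<^sub>R f t - ?w t *\<^sub>R v) \<le> ?w t * \<eta>" .
  next
    show "integrable (lebesgue_on {0..l}) (\<lambda>t. norm (?w t *\<^sub>R f t - ?w t *\<^sub>R v))"
      by (intro integrable_norm Bochner_Integration.integrable_diff iwf iwv)
    show "integrable (lebesgue_on {0..l}) (\<lambda>t. ?w t * \<eta>)" using iw by (intro integrable_mult_left) auto
  qed
  also have "\<dots> = (\<integral>t. ?w t \<partial>lebesgue_on {0..l}) * \<eta>"
    by (rule integral_mult_left_zero)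
  also have "\<dots> = \<eta>" unfolding w1 by simp
  finally show ?thesis unfolding eq .
qed

text \<open>
  The test functions rise from \<open>0\<close> to \<open>1\<close> next to \<open>x\<close> and fall back next to \<open>y\<close>.  They converge to the
  indicator function of \<open>(x, y)\<close>, and their derivatives are differences of averaging kernels at \<open>x\<close> and at \<open>y\<close>.
\<close>

lemma weak_deriv_integral:
  assumes wd: "has_weak_deriv l f g" and cont: "continuous_on {0..l} f"
    and xy: "0 \<le> x" "x \<le> y" "y \<le> l"
  shows "f y - f x = (\<integral>t. indicator {x<..<y} t *\<^sub>R g t \<partial>lebesgue_on {0..l})"
proof (cases "x < y")
  case False
  then show ?thesis using xy by simp
next
  case True
  \<comment> \<open>the ramps are \<open>[x + e, x + 2 e]\<close> and \<open>[y - 2 e, y - e]\<close>; the offset \<open>4\<close> keeps them disjoint\<close>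
  define e where "e n = (y - x) / (real n + 4)" for n
  have e0: "e n > 0" for n using True by (simp add: e_def)
  have e4: "4 * e n \<le> y - x" for n
    using True mult_right_mono[of x y "real n"] by (simp add: e_def field_simps)
  have elim: "e \<longlonglongrightarrow> 0"
    using LIMSEQ_ignore_initial_segment[OF lim_const_over_n[of "y - x"], of 4] by (simp add: e_def[abs_def] ac_simps)
  define \<phi> where "\<phi> n t = smooth_step ((t - (x + e n)) / e n) - smooth_step ((t - (y - 2 * e n)) / e n)" for n t
  define \<phi>' where "\<phi>' n t = step_bump ((t - (x + e n)) / e n) / e n - step_bump ((t - (y - 2 * e n)) / e n) / e n" for n t
  have d\<phi>: "(\<phi> n has_real_derivative \<phi>' n t) (at t)" for n t
  proof -
    have 1: "((\<lambda>t. smooth_step ((t - z) / e n)) has_real_derivative step_bump ((t - z) / e n) * (1 / e n)) (at t)" for z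
      by (rule DERIV_chain2[OF DERIV_smooth_step]) (use e0[of n] in \<open>auto intro!: derivative_eq_intros\<close>)
    show ?thesis unfolding \<phi>_def[abs_def] \<phi>'_def
      using DERIV_diff[OF 1 1] by simp
  qed
  have \<phi>_cont: "continuous_on UNIV (\<phi> n)" for n
    using d\<phi> by (meson DERIV_isCont continuous_at_imp_continuous_on)
  have \<phi>'_cont: "continuous_on A (\<phi>' n)" for n A
    unfolding \<phi>'_def by (intro continuous_intros) (use e0[of n] in auto)
  have C1: "\<phi> n C1_differentiable_on UNIV" for n
    unfolding C1_differentiable_on_def
    using d\<phi> \<phi>'_cont by (auto simp: has_real_derivative_iff_has_vector_derivative intro!: exI[of _ "\<phi>' n"])
  have deriv: "deriv (\<phi> n) = \<phi>' n" for n
    using d\<phi> by (intro ext DERIV_imp_deriv)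
  have supp: "{t. \<phi> n t \<noteq> 0} \<subseteq> {x + e n..y - e n}" for n
  proof (rule subsetI, rule ccontr)
    fix t assume t: "t \<in> {t. \<phi> n t \<noteq> 0}" "t \<notin> {x + e n..y - e n}"
    then consider "t < x + e n" | "t > y - e n" by force
    then have "\<phi> n t = 0"
    proof cases
      case 1
      then show ?thesis using e0[of n] e4[of n] unfolding \<phi>_def
        by (subst (1 2) smooth_step_eq_0) (auto simp: divide_nonpos_pos)
    next
      case 2
      then show ?thesis using e0[of n] e4[of n] unfolding \<phi>_def
        by (subst (1 2) smooth_step_eq_1) (auto simp: field_simps)
    qed
    with t show False by simp
  qed
  then have supp': "closure {t. \<phi> n t \<noteq> 0} \<subseteq> {x + e n..y - e n}" for n
    by (intro closure_minimal) auto
  have comp: "compact (closure {t. \<phi> n t \<noteq> 0})" for n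
    using supp[of n] bounded_subset[OF bounded_closed_interval] by (simp add: compact_closure)
  have "closure {t. \<phi> n t \<noteq> 0} \<subseteq> {0<..<l}" for n
    using supp'[of n] e0[of n] xy by force
  then have test: "(\<integral>t. \<phi>' n t *\<^sub>R f t \<partial>lebesgue_on {0..l}) = - (\<integral>t. \<phi> n t *\<^sub>R g t \<partial>lebesgue_on {0..l})" for n
    using wd C1 comp unfolding has_weak_deriv_def deriv[symmetric] by blast
  have L2: "L2_interval l g" using wd by (simp add: has_weak_deriv_def)
  have gm[measurable]: "g \<in> borel_measurable (lebesgue_on {0..l})" using L2 by (simp add: L2_interval_def)
  have gi: "integrable (lebesgue_on {0..l}) g" by (rule L2_interval_integrable[OF L2])

  have lim1: "(\<lambda>n. \<integral>t. \<phi> n t *\<^sub>R g t \<partial>lebesgue_on {0..l}) \<longlonglongrightarrow> (\<integral>t. indicator {x<..<y} t *\<^sub>R g t \<partial>lebesgue_on {0..l})"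
  proof (rule integral_dominated_convergence[where w="\<lambda>t. norm (g t)"])
    show "(\<lambda>t. indicator {x<..<y} t *\<^sub>R g t) \<in> borel_measurable (lebesgue_on {0..l})"
      by (intro borel_measurable_scaleR gm measurable_restrict_space1 borel_measurable_indicator) auto
    show "(\<lambda>t. \<phi> n t *\<^sub>R g t) \<in> borel_measurable (lebesgue_on {0..l})" for n
      by (intro borel_measurable_scaleR gm continuous_imp_measurable_on_sets_lebesgue continuous_on_subset[OF \<phi>_cont]) auto
    show "integrable (lebesgue_on {0..l}) (\<lambda>t. norm (g t))" using gi by simp
    show "AE t in lebesgue_on {0..l}. norm (\<phi> n t *\<^sub>R g t) \<le> norm (g t)" for n
    proof (rule AE_I2)
      fix t
      have "\<bar>\<phi> n t\<bar> \<le> 1"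
        unfolding \<phi>_def abs_le_iff
        by (smt (verit) smooth_step_bounds)
      then show "norm (\<phi> n t *\<^sub>R g t) \<le> norm (g t)"
        by (simp add: mult_left_le_one_le)
    qed
    show "AE t in lebesgue_on {0..l}. (\<lambda>n. \<phi> n t *\<^sub>R g t) \<longlonglongrightarrow> indicator {x<..<y} t *\<^sub>R g t"
    proof (intro AE_I2 tendsto_scaleR tendsto_const)
      fix t
      show "(\<lambda>n. \<phi> n t) \<longlonglongrightarrow> indicator {x<..<y} t"
      proof (cases "t \<in> {x<..<y}")
        case True
        have "((\<lambda>n. x + 2 * e n) \<longlonglongrightarrow> x + 2 * 0)" "((\<lambda>n. y - 2 * e n) \<longlonglongrightarrow> y - 2 * 0)"
          by (intro tendsto_intros elim)+
        then have "eventually (\<lambda>n. x + 2 * e n < t) sequentially" "eventually (\<lambda>n. y - 2 * e n > t) sequentially"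
          using True by (auto intro: order_tendstoD)
        then have "eventually (\<lambda>n. \<phi> n t = 1) sequentially"
        proof eventually_elim
          case (elim n)
          have a: "(t - (x + e n)) / e n \<ge> 1" "(t - (y - 2 * e n)) / e n \<le> 0"
            using elim e0[of n] by (auto simp: field_simps)
          show ?case unfolding \<phi>_def smooth_step_eq_1[OF a(1)] smooth_step_eq_0[OF a(2)] by simp
        qed
        then show ?thesis using True by (simp add: tendsto_eventually)
      next
        case False
        have "\<phi> n t = 0" for n using supp[of n] False e0[of n] by force
        then show ?thesis using False by simp
      qed
    qed
  qed
  have lim2: "(\<lambda>n. \<integral>t. \<phi>' n t *\<^sub>R f t \<partial>lebesgue_on {0..l}) \<longlonglongrightarrow> f x - f y"
  proof -
    have one: "(\<lambda>n. \<integral>t. (step_bump ((t - z n) / e n) / e n) *\<^sub>R f t \<partial>lebesgue_on {0..l}) \<longlonglongrightarrow> f v"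
      if v: "v \<in> {0..l}" and z: "\<And>n. 0 \<le> z n" "\<And>n. z n + e n \<le> l" "\<And>n t. t \<in> {z n..z n + e n} \<Longrightarrow> \<bar>t - v\<bar> \<le> 2 * e n" for v z
    proof (rule LIMSEQ_I)
      fix r :: real assume r: "r > 0"
      obtain d where d: "d > 0" "\<And>t. t \<in> {0..l} \<Longrightarrow> dist t v < d \<Longrightarrow> dist (f t) (f v) < r / 2"
        using cont[unfolded continuous_on_iff, rule_format, OF v, of "r / 2"] r by auto
      have "((\<lambda>n. 2 * e n) \<longlonglongrightarrow> 2 * 0)" by (intro tendsto_intros elim)
      then have "eventually (\<lambda>n. 2 * e n < d) sequentially" using order_tendstoD(2)[of "\<lambda>n. 2 * e n" 0 sequentially d] d by simp
      then obtain n0 where n0: "\<And>n. n \<ge> n0 \<Longrightarrow> 2 * e n < d" by (auto simp: eventually_sequentially)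
      show "\<exists>no. \<forall>n\<ge>no. norm ((\<integral>t. (step_bump ((t - z n) / e n) / e n) *\<^sub>R f t \<partial>lebesgue_on {0..l}) - f v) < r"
      proof (intro exI allI impI)
        fix n assume "n0 \<le> n"
        have "norm ((\<integral>t. (step_bump ((t - z n) / e n) / e n) *\<^sub>R f t \<partial>lebesgue_on {0..l}) - f v) \<le> r / 2"
        proof (rule bump_average[OF cont e0 z(1,2)])
          fix t assume t: "t \<in> {z n..z n + e n}"
          then have "t \<in> {0..l}" "dist t v < d" using z(1,2)[of n] z(3)[OF t] n0[OF \<open>n0 \<le> n\<close>] by (auto simp: dist_real_def)
          then show "norm (f t - f v) \<le> r / 2" using d(2)[of t] by (simp add: dist_norm)
        qed
        then show "norm ((\<integral>t. (step_bump ((t - z n) / e n) / e n) *\<^sub>R f t \<partial>lebesgue_on {0..l}) - f v) < r"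
          using r by linarith
      qed
    qed
    have int: "integrable (lebesgue_on {0..l}) (\<lambda>t. (step_bump ((t - z) / e n) / e n) *\<^sub>R f t)" for z n
      by (intro integrable_continuous_lebesgue_on continuous_intros cont) (use e0[of n] in auto)
    have eq: "(\<integral>t. \<phi>' n t *\<^sub>R f t \<partial>lebesgue_on {0..l}) =
       (\<integral>t. (step_bump ((t - (x + e n)) / e n) / e n) *\<^sub>R f t \<partial>lebesgue_on {0..l})
       - (\<integral>t. (step_bump ((t - (y - 2 * e n)) / e n) / e n) *\<^sub>R f t \<partial>lebesgue_on {0..l})" for n
      unfolding \<phi>'_def scaleR_diff_left by (intro Bochner_Integration.integral_diff int)
    have le: "x + 2 * e n \<le> l" "0 \<le> y - 2 * e n" for n using e0[of n] e4[of n] xy by linarith+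
    show ?thesis unfolding eq
    proof (intro tendsto_diff one)
      fix n t
      note ee = e0[of n] e4[of n] le[of n]
      show "x \<in> {0..l}" "y \<in> {0..l}" "0 \<le> x + e n" "x + e n + e n \<le> l" "0 \<le> y - 2 * e n" "y - 2 * e n + e n \<le> l"
        using ee xy by auto
      show "t \<in> {x + e n..x + e n + e n} \<Longrightarrow> \<bar>t - x\<bar> \<le> 2 * e n" using ee by auto
      show "t \<in> {y - 2 * e n..y - 2 * e n + e n} \<Longrightarrow> \<bar>t - y\<bar> \<le> 2 * e n" using ee by auto
    qed
  qed
  have "(\<lambda>n. - (\<integral>t. \<phi>' n t *\<^sub>R f t \<partial>lebesgue_on {0..l})) \<longlonglongrightarrow> - (f x - f y)"
    by (intro tendsto_minus lim2)
  then have "(\<lambda>n. \<integral>t. \<phi> n t *\<^sub>R g t \<partial>lebesgue_on {0..l}) \<longlonglongrightarrow> f y - f x"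
    by (simp add: test)
  then show ?thesis using lim1 by (rule LIMSEQ_unique)
qed

text \<open>
  A Dynkin argument starting from the half-lines extends the hypothesis from intervals to Borel sets, and null sets
  then give all Lebesgue measurable sets.
\<close>

lemma AE_zero_of_interval_integrals:
  fixes d :: "real \<Rightarrow> complex"
  assumes di: "integrable (lebesgue_on {0..l}) d" and l: "0 < l"
    and zero: "\<And>x y. 0 \<le> x \<Longrightarrow> x \<le> y \<Longrightarrow> y \<le> l \<Longrightarrow> (\<integral>t. indicator {x<..<y} t *\<^sub>R d t \<partial>lebesgue_on {0..l}) = 0"
  shows "AE t in lebesgue_on {0..l}. d t = 0"
proof -
  define D where "D t = indicator {0<..<l} t *\<^sub>R d t" for t
  have conv: "(\<integral>t. indicator A t *\<^sub>R (indicator {0<..<l} t *\<^sub>R d t) \<partial>lebesgue_on {0..l}) = (\<integral>t\<in>A. D t \<partial>lebesgue)" for A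
  proof -
    have "(\<integral>t. indicator A t *\<^sub>R (indicator {0<..<l} t *\<^sub>R d t) \<partial>lebesgue_on {0..l})
       = (\<integral>t. indicator {0..l} t *\<^sub>R (indicator A t *\<^sub>R (indicator {0<..<l} t *\<^sub>R d t)) \<partial>lebesgue)"
      by (rule integral_restrict_space) auto
    also have "\<dots> = (\<integral>t\<in>A. D t \<partial>lebesgue)"
      unfolding set_lebesgue_integral_def D_def
      by (intro Bochner_Integration.integral_cong) (auto simp: indicator_def)
    finally show ?thesis .
  qed
  have "integrable lebesgue (\<lambda>t. indicator {0..l} t *\<^sub>R d t)"
    using di by (subst (asm) integrable_restrict_space) auto
  then have "integrable lebesgue (\<lambda>t. indicator {0<..<l} t *\<^sub>R (indicator {0..l} t *\<^sub>R d t))"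
    by (rule integrable_mult_indicator[rotated]) simp
  then have Di: "integrable lebesgue D"
    by (rule Bochner_Integration.integrable_cong[THEN iffD1, rotated -1]) (auto simp: D_def indicator_def)
  have Dset: "set_integrable lebesgue A D" if "A \<in> sets lebesgue" for A
    unfolding set_integrable_def by (rule integrable_mult_indicator[OF that Di])
  have basic: "(\<integral>t\<in>{a<..}. D t \<partial>lebesgue) = 0" for a
  proof -
    have "(\<integral>t. indicator {a<..} t *\<^sub>R (indicator {0<..<l} t *\<^sub>R d t) \<partial>lebesgue_on {0..l})
      = (\<integral>t. indicator {min l (max 0 a)<..<l} t *\<^sub>R d t \<partial>lebesgue_on {0..l})"
      by (intro Bochner_Integration.integral_cong) (auto simp: indicator_def)
    also have "\<dots> = 0" using l by (intro zero) auto
    finally show ?thesis unfolding conv .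
  qed
  have total: "(\<integral>t\<in>UNIV. D t \<partial>lebesgue) = 0"
  proof -
    have "(\<integral>t\<in>UNIV. D t \<partial>lebesgue) = (\<integral>t\<in>{0<..}. D t \<partial>lebesgue)"
      unfolding set_lebesgue_integral_def by (intro Bochner_Integration.integral_cong) (auto simp: D_def indicator_def)
    then show ?thesis using basic by simp
  qed
  have borel: "(\<integral>t\<in>A. D t \<partial>lebesgue) = 0" if "A \<in> sets borel" for A
  proof -
    have "{a<..} \<inter> {b<..} = {max a b<..}" for a b :: real by auto
    then have *: "Int_stable (range greaterThan :: real set set)" "range greaterThan \<subseteq> Pow (UNIV :: real set)"
      by (auto simp: Int_stable_def)
    have sets_eq: "sigma_sets UNIV (range greaterThan) = sets (borel :: real measure)"
      by (simp add: borel_Ioi)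
    have leb: "B \<in> sets lebesgue" if "B \<in> sets borel" for B :: "real set"
      using that by (intro sets_completionI_sets) simp
    have "A \<in> sigma_sets UNIV (range greaterThan)" using that by (simp add: sets_eq)
    from * this show ?thesis
    proof (induction rule: sigma_sets_induct_disjoint)
      case (basic A)
      then show ?case using \<open>\<And>a. (\<integral>t\<in>{a<..}. D t \<partial>lebesgue) = 0\<close> by auto
    next
      case empty
      then show ?case by (simp add: set_lebesgue_integral_def)
    next
      case (compl A)
      have A: "A \<in> sets lebesgue" using compl(1) leb by (simp add: sets_eq)
      have "(\<integral>t\<in>A \<union> (UNIV - A). D t \<partial>lebesgue) = (\<integral>t\<in>A. D t \<partial>lebesgue) + (\<integral>t\<in>UNIV - A. D t \<partial>lebesgue)"
        using A by (intro set_integral_Un Dset) auto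
      then show ?case using compl total by simp
    next
      case (union A)
      have A: "A i \<in> sets lebesgue" for i using union(2) leb unfolding sets_eq by auto
      have "(\<integral>t\<in>(\<Union>i. A i). D t \<partial>lebesgue) = (\<Sum>i. \<integral>t\<in>A i. D t \<partial>lebesgue)"
        using union(1) A by (intro lebesgue_integral_countable_add Dset sets.countable_UN) (auto simp: disjoint_family_on_def)
      then show ?case using union by simp
    qed
  qed
  have "AE t in lebesgue. D t = 0"
  proof (rule sigma_finite_measure.density_zero[OF sigma_finite_lebesgue_real Di])
    fix A :: "real set" assume "A \<in> sets lebesgue"
    then obtain S N N' where A: "A = S \<union> N" "N \<subseteq> N'" "N' \<in> null_sets lborel" "S \<in> sets lborel"
      by (rule sets_completionE)
    have N': "AE t in lebesgue. t \<notin> N'" using A(3) by (intro AE_not_in null_sets_completionI)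
    have "(\<integral>t\<in>A. D t \<partial>lebesgue) = (\<integral>t\<in>S. D t \<partial>lebesgue)"
      unfolding set_lebesgue_integral_def
    proof (rule integral_cong_AE)
      show "(\<lambda>t. indicat_real A t *\<^sub>R D t) \<in> borel_measurable lebesgue"
        using integrable_mult_indicator[OF \<open>A \<in> sets lebesgue\<close> Di] by simp
      show "(\<lambda>t. indicat_real S t *\<^sub>R D t) \<in> borel_measurable lebesgue"
        using A(4) Di by (intro borel_measurable_integrable integrable_mult_indicator) auto
      show "AE t in lebesgue. indicat_real A t *\<^sub>R D t = indicat_real S t *\<^sub>R D t"
        using N' by eventually_elim (use A in \<open>auto simp: indicator_def\<close>)
    qed
    also have "\<dots> = 0" using A(4) by (intro borel) simp
    finally show "(\<integral>t\<in>A. D t \<partial>lebesgue) = 0" .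
  qed
  moreover have "AE t in lebesgue. t \<noteq> 0" "AE t in lebesgue. t \<noteq> l"
    using AE_lborel_singleton by (auto intro: AE_completion)
  ultimately have "AE t in lebesgue. t \<in> {0..l} \<longrightarrow> d t = 0"
    by eventually_elim (auto simp: D_def indicator_def split: if_splits)
  then show ?thesis by (subst AE_restrict_space_iff) auto
qed

lemma weak_deriv_unique:
  assumes "0 < l" "continuous_on {0..l} f" "has_weak_deriv l f g" "has_weak_deriv l f h"
  shows "AE t in lebesgue_on {0..l}. g t = h t"
proof -
  have L2: "L2_interval l g" "L2_interval l h" using assms by (auto simp: has_weak_deriv_def)
  note gi = L2_interval_integrable[OF L2(1)] and hi = L2_interval_integrable[OF L2(2)]
  have "AE t in lebesgue_on {0..l}. g t - h t = 0"
  proof (rule AE_zero_of_interval_integrals[OF _ assms(1)])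
    show "integrable (lebesgue_on {0..l}) (\<lambda>t. g t - h t)" using gi hi by simp
    fix x y :: real assume xy: "0 \<le> x" "x \<le> y" "y \<le> l"
    have s: "{x<..<y} \<in> sets (lebesgue_on {0..l})"
      using xy by (subst sets_restrict_space_iff) auto
    have "(\<integral>t. indicator {x<..<y} t *\<^sub>R (g t - h t) \<partial>lebesgue_on {0..l})
      = (\<integral>t. indicator {x<..<y} t *\<^sub>R g t \<partial>lebesgue_on {0..l}) - (\<integral>t. indicator {x<..<y} t *\<^sub>R h t \<partial>lebesgue_on {0..l})"
      unfolding scaleR_diff_right
      by (intro Bochner_Integration.integral_diff integrable_mult_indicator s gi hi)
    also have "\<dots> = 0"
      using weak_deriv_integral[OF assms(3,2) xy] weak_deriv_integral[OF assms(4,2) xy] by simp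
    finally show "(\<integral>t. indicator {x<..<y} t *\<^sub>R (g t - h t) \<partial>lebesgue_on {0..l}) = 0" .
  qed
  then show ?thesis by simp
qed

text \<open>By uniqueness the choice made in \<open>weak_deriv\<close> does not affect the energy.\<close>

lemma integral_weak_deriv_square:
  assumes "0 < l" "continuous_on {0..l} f" "has_weak_deriv l f g"
  shows "(\<integral>x. (norm (weak_deriv l f x))\<^sup>2 \<partial>lebesgue_on {0..l}) = (\<integral>x. (norm (g x))\<^sup>2 \<partial>lebesgue_on {0..l})"
proof -
  have wd: "has_weak_deriv l f (weak_deriv l f)"
    unfolding weak_deriv_def by (rule someI[of "has_weak_deriv l f"], fact)
  show ?thesis
  proof (rule integral_cong_AE)
    show "AE x in lebesgue_on {0..l}. (norm (weak_deriv l f x))\<^sup>2 = (norm (g x))\<^sup>2"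
      using weak_deriv_unique[OF assms(1,2) wd assms(3)] by eventually_elim simp
  qed (use wd assms(3) in \<open>auto simp: has_weak_deriv_def L2_interval_def\<close>)
qed

lemma continuous_L2_interval: "continuous_on {0..l} f \<Longrightarrow> L2_interval l f"
  unfolding L2_interval_def
  by (auto intro!: continuous_imp_measurable_on_sets_lebesgue integrable_continuous_lebesgue_on continuous_intros)

lemma C1_has_weak_deriv:
  assumes l: "0 < l" and f: "\<And>t. t \<in> {0..l} \<Longrightarrow> (f has_vector_derivative f' t) (at t within {0..l})"
    and f': "continuous_on {0..l} f'"
  shows "has_weak_deriv l f f'"
  unfolding has_weak_deriv_def
proof (intro conjI allI impI)
  show "L2_interval l f'" by (rule continuous_L2_interval[OF f'])
  have cf: "continuous_on {0..l} f" using f by (rule continuous_on_vector_derivative)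
  fix \<phi> :: "real \<Rightarrow> real"
  assume \<phi>: "\<phi> C1_differentiable_on UNIV" "closure {x. \<phi> x \<noteq> 0} \<subseteq> {0<..<l}"
  then obtain \<phi>' where d: "\<And>x. (\<phi> has_vector_derivative \<phi>' x) (at x)" "continuous_on UNIV \<phi>'"
    unfolding C1_differentiable_on_def by auto
  have deriv: "deriv \<phi> = \<phi>'"
    using d(1) by (auto intro!: DERIV_imp_deriv simp: has_real_derivative_iff_has_vector_derivative)
  have c\<phi>: "continuous_on {0..l} \<phi>" "continuous_on {0..l} \<phi>'"
    using d by (auto intro: continuous_on_subset continuous_on_vector_derivative has_vector_derivative_at_within)
  have "\<phi> x = 0" if "x \<notin> {0<..<l}" for x
    using that \<phi>(2) closure_subset[of "{x. \<phi> x \<noteq> 0}"] by blast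
  from this[of 0] this[of l] have "\<phi> 0 = 0" "\<phi> l = 0" by simp_all
  have i1: "integrable (lebesgue_on {0..l}) (\<lambda>x. \<phi> x *\<^sub>R f' x)" "integrable (lebesgue_on {0..l}) (\<lambda>x. \<phi>' x *\<^sub>R f x)"
    by (intro integrable_continuous_lebesgue_on continuous_intros c\<phi> cf f')+
  have "(\<integral>x. \<phi> x *\<^sub>R f' x + \<phi>' x *\<^sub>R f x \<partial>lebesgue_on {0..l}) = \<phi> l *\<^sub>R f l - \<phi> 0 *\<^sub>R f 0"
  proof (rule integral_lebesgue_on_FTC)
    fix t assume t: "t \<in> {0..l}"
    have "((\<lambda>t. \<phi> t *\<^sub>R f t) has_vector_derivative \<phi> t *\<^sub>R f' t + \<phi>' t *\<^sub>R f t) (at t within {0..l})"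
      using d(1)[of t] by (intro has_vector_derivative_scaleR f t)
        (simp add: has_real_derivative_iff_has_vector_derivative has_vector_derivative_at_within)
    then show "((\<lambda>t. \<phi> t *\<^sub>R f t) has_vector_derivative \<phi> t *\<^sub>R f' t + \<phi>' t *\<^sub>R f t) (at t within {0..l})" .
  qed (use l in \<open>auto intro!: continuous_intros c\<phi> cf f'\<close>)
  also have "(\<integral>x. \<phi> x *\<^sub>R f' x + \<phi>' x *\<^sub>R f x \<partial>lebesgue_on {0..l})
     = (\<integral>x. \<phi> x *\<^sub>R f' x \<partial>lebesgue_on {0..l}) + (\<integral>x. \<phi>' x *\<^sub>R f x \<partial>lebesgue_on {0..l})"
    by (intro Bochner_Integration.integral_add i1)
  finally have "(\<integral>x. \<phi> x *\<^sub>R f' x \<partial>lebesgue_on {0..l}) + (\<integral>x. \<phi>' x *\<^sub>R f x \<partial>lebesgue_on {0..l}) = 0"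
    by (simp only: \<open>\<phi> 0 = 0\<close> \<open>\<phi> l = 0\<close> scaleR_zero_left diff_0_right)
  then show "(\<integral>x. deriv \<phi> x *\<^sub>R f x \<partial>lebesgue_on {0..l}) = - (\<integral>x. \<phi> x *\<^sub>R f' x \<partial>lebesgue_on {0..l})"
    unfolding deriv by (simp only: eq_neg_iff_add_eq_0 add.commute)
qed

section \<open>Cuts and bridges\<close>

lemma connected_iff_cut:
  assumes "wf_digraph G"
  shows "Digraph_Component.connected G \<longleftrightarrow> verts G \<noteq> {} \<and>
    (\<forall>S. S \<inter> verts G \<noteq> {} \<longrightarrow> verts G - S \<noteq> {} \<longrightarrow> (\<exists>e\<in>arcs G. (tail G e \<in> S) \<noteq> (head G e \<in> S)))"
    (is "_ \<longleftrightarrow> _ \<and> ?cuts")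
proof -
  interpret wf_digraph G by fact
  have sym: "(u, v) \<in> (arcs_ends G)\<^sup>s \<longleftrightarrow> (\<exists>e\<in>arcs G. (u = tail G e \<and> v = head G e) \<or> (v = tail G e \<and> u = head G e))" for u v
    by (auto simp: symcl_def arcs_ends_conv)
  have "(\<forall>u\<in>verts G. \<forall>v\<in>verts G. (u, v) \<in> rtrancl_on (verts G) ((arcs_ends G)\<^sup>s)) \<longleftrightarrow> ?cuts"
  proof (intro iffI allI impI ballI)
    fix S
    assume reach: "\<forall>u\<in>verts G. \<forall>v\<in>verts G. (u, v) \<in> rtrancl_on (verts G) ((arcs_ends G)\<^sup>s)"
      and "S \<inter> verts G \<noteq> {}" "verts G - S \<noteq> {}"
    then obtain u v where uv: "u \<in> S" "u \<in> verts G" "v \<in> verts G" "v \<notin> S" by blast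
    show "\<exists>e\<in>arcs G. (tail G e \<in> S) \<noteq> (head G e \<in> S)"
    proof (rule ccontr)
      assume no: "\<not> (\<exists>e\<in>arcs G. (tail G e \<in> S) \<noteq> (head G e \<in> S))"
      have "(u, v) \<in> rtrancl_on (verts G) ((arcs_ends G)\<^sup>s)" using reach uv by blast
      then have "v \<in> S"
      proof (induction rule: rtrancl_on_induct)
        case base
        then show ?case using uv by simp
      next
        case (step y z)
        then show ?case using no unfolding sym by blast
      qed
      with uv show False by blast
    qed
  next
    fix u v assume cuts: ?cuts and uv: "u \<in> verts G" "v \<in> verts G"
    define S where "S = {w. (u, w) \<in> rtrancl_on (verts G) ((arcs_ends G)\<^sup>s)}"
    have uS: "u \<in> S" using uv by (auto simp: S_def)
    have step: "b \<in> S" if "a \<in> S" "(a, b) \<in> (arcs_ends G)\<^sup>s" "b \<in> verts G" for a b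
      using that unfolding S_def by (auto intro: rtrancl_on_into_rtrancl_on)
    have "(tail G e \<in> S) = (head G e \<in> S)" if "e \<in> arcs G" for e
      using that step[of "tail G e" "head G e"] step[of "head G e" "tail G e"] sym by auto
    with cuts uS uv have "verts G - S = {}" by blast
    then show "(u, v) \<in> rtrancl_on (verts G) ((arcs_ends G)\<^sup>s)"
      using uv by (auto simp: S_def)
  qed
  then show ?thesis unfolding connected_conv by blast
qed

text \<open>A bridge is the only edge across some cut.\<close>

lemma bridging_edge_cut:
  assumes "wf_digraph G" "Digraph_Component.connected G" "bridging_edge G e"
  shows "\<exists>S. \<forall>a\<in>arcs G. (tail G a \<in> S) \<noteq> (head G a \<in> S) \<longleftrightarrow> a = e"
proof -
  have e: "e \<in> arcs G" "\<not> Digraph_Component.connected (pre_digraph.del_arc G e)"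
    using assms(3) by (auto simp: bridging_edge_def)
  obtain S where S: "S \<inter> verts G \<noteq> {}" "verts G - S \<noteq> {}"
    "\<And>a. a \<in> arcs G \<Longrightarrow> a \<noteq> e \<Longrightarrow> (tail G a \<in> S) = (head G a \<in> S)"
    using e(2) assms(2) connected_iff_cut[OF assms(1)] connected_iff_cut[OF wf_digraph.wf_digraph_del_arc[OF assms(1)], of e]
    unfolding pre_digraph.del_arc_simps by blast
  obtain a where "a \<in> arcs G" "(tail G a \<in> S) \<noteq> (head G a \<in> S)"
    using S(1,2) assms(2) connected_iff_cut[OF assms(1)] by blast
  with S(3) have "(tail G e \<in> S) \<noteq> (head G e \<in> S)" by blast
  with S(3) show ?thesis by (intro exI[of _ S]) blast
qed

text \<open>
  Doubling the bridges makes the graph 2-edge-connected.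
\<close>

definition bridge_multiplicity :: "('v, 'e) pre_digraph \<Rightarrow> 'e \<Rightarrow> real" where
  "bridge_multiplicity G e = (if bridging_edge G e then 2 else 1)"

lemma cut_weight_ge_2:
  assumes "fin_digraph G" "Digraph_Component.connected G"
    and S: "\<exists>e\<in>arcs G. tail G e \<in> S \<or> head G e \<in> S" "\<exists>e\<in>arcs G. tail G e \<notin> S \<or> head G e \<notin> S"
  shows "2 \<le> (\<Sum>e | e \<in> arcs G \<and> (tail G e \<in> S) \<noteq> (head G e \<in> S). bridge_multiplicity G e)"
proof -
  interpret fin_digraph G by fact
  let ?C = "{e \<in> arcs G. (tail G e \<in> S) \<noteq> (head G e \<in> S)}"
  have fin: "finite ?C" by simp
  have V: "S \<inter> verts G \<noteq> {}" "verts G - S \<noteq> {}"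
    using S tail_in_verts head_in_verts by blast+
  obtain e where e: "e \<in> ?C"
    using V assms(2) connected_iff_cut[OF wf_digraph_axioms] by blast
  show ?thesis
  proof (cases "bridging_edge G e")
    case True
    then have "2 = (\<Sum>e\<in>{e}. bridge_multiplicity G e)" by (simp add: bridge_multiplicity_def)
    also have "\<dots> \<le> (\<Sum>e\<in>?C. bridge_multiplicity G e)"
      using e fin by (intro sum_mono2) (auto simp: bridge_multiplicity_def)
    finally show ?thesis .
  next
    case False
    with e have "Digraph_Component.connected (pre_digraph.del_arc G e)" by (auto simp: bridging_edge_def)
    then obtain e' where e': "e' \<in> ?C" "e' \<noteq> e"
      using V connected_iff_cut[OF wf_digraph_del_arc, of e]
      unfolding pre_digraph.del_arc_simps by blast
    have "2 \<le> (\<Sum>e\<in>{e, e'}. bridge_multiplicity G e)" using e' by (simp add: bridge_multiplicity_def)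
    also have "\<dots> \<le> (\<Sum>e\<in>?C. bridge_multiplicity G e)"
      using e e' fin by (intro sum_mono2) (auto simp: bridge_multiplicity_def)
    finally show ?thesis .
  qed
qed

lemma cut_card_ge_1:
  assumes "fin_digraph G" "Digraph_Component.connected G"
    and S: "\<exists>e\<in>arcs G. tail G e \<in> S \<or> head G e \<in> S" "\<exists>e\<in>arcs G. tail G e \<notin> S \<or> head G e \<notin> S"
  shows "1 \<le> (\<Sum>e | e \<in> arcs G \<and> (tail G e \<in> S) \<noteq> (head G e \<in> S). 1 :: real)"
proof -
  interpret fin_digraph G by fact
  have V: "S \<inter> verts G \<noteq> {}" "verts G - S \<noteq> {}"
    using S tail_in_verts head_in_verts by blast+
  then have "{e \<in> arcs G. (tail G e \<in> S) \<noteq> (head G e \<in> S)} \<noteq> {}"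
    using assms(2) connected_iff_cut[OF wf_digraph_axioms] by blast
  then have "card {e \<in> arcs G. (tail G e \<in> S) \<noteq> (head G e \<in> S)} > 0"
    by (subst card_gt_0_iff) simp
  then show ?thesis by (simp add: Suc_le_eq)
qed

text \<open>
  If all edges were bridges, a bridge and one of its sides with the fewest vertices could be chosen.  Since the end
  of the bridge in that side has degree at least 2, a second bridge starts there and cuts off a smaller side.
\<close>

lemma nonbridging_edge_exists:
  assumes "fin_digraph G" "Digraph_Component.connected G" "e0 \<in> arcs G"
    and no_terminal: "\<And>e. e \<in> arcs G \<Longrightarrow> \<not> terminal_edge G e"
  shows "\<exists>e\<in>arcs G. \<not> bridging_edge G e"
proof (rule ccontr)
  interpret fin_digraph G by fact
  assume "\<not> ?thesis"
  then have all: "\<And>e. e \<in> arcs G \<Longrightarrow> bridging_edge G e" by blast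
  \<comment> \<open>a side of a bridge with the fewest vertices\<close>
  define P where "P S \<longleftrightarrow> S \<subseteq> verts G \<and> (\<exists>e\<in>arcs G. \<forall>a\<in>arcs G. (tail G a \<in> S) \<noteq> (head G a \<in> S) \<longleftrightarrow> a = e)" for S
  have side: "P (S \<inter> verts G)" if "e \<in> arcs G" "\<And>a. a \<in> arcs G \<Longrightarrow> (tail G a \<in> S) \<noteq> (head G a \<in> S) \<longleftrightarrow> a = e" for S e
    using that unfolding P_def by auto
  have "\<exists>S. P S"
    using bridging_edge_cut[OF wf_digraph_axioms assms(2) all[OF assms(3)]] side[OF assms(3)] by metis
  then obtain S where S: "P S" "\<And>R. P R \<Longrightarrow> card S \<le> card R"
    using ex_has_least_nat[of P _ card] by blast
  from S(1) obtain e where e: "e \<in> arcs G" "\<And>a. a \<in> arcs G \<Longrightarrow> (tail G a \<in> S) \<noteq> (head G a \<in> S) \<longleftrightarrow> a = e"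
    and SV: "S \<subseteq> verts G"
    unfolding P_def by blast
  have finS: "finite S" using SV finite_verts finite_subset by blast
  obtain v v' where v: "v \<in> S" "v' \<notin> S" "{tail G e, head G e} = {v, v'}"
    using e(2)[OF e(1)] by (metis insert_commute)
  have "degree G v \<noteq> 1"
    using no_terminal[OF e(1)] e(1) v(3) unfolding terminal_edge_def by (auto simp: doubleton_eq_iff)
  have "\<exists>f\<in>arcs G. f \<noteq> e \<and> (tail G f = v \<or> head G f = v)"
  proof (rule ccontr)
    assume no: "\<not> ?thesis"
    have "v \<noteq> v'" using v by auto
    have "card (in_arcs G v) + card (out_arcs G v) = 1"
    proof (cases "tail G e = v")
      case True
      then have "out_arcs G v = {e}" "in_arcs G v = {}"
        using no e(1) v(3) \<open>v \<noteq> v'\<close> by (auto simp: in_arcs_def out_arcs_def doubleton_eq_iff)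
      then show ?thesis by simp
    next
      case False
      then have "out_arcs G v = {}" "in_arcs G v = {e}"
        using no e(1) v(3) \<open>v \<noteq> v'\<close> by (auto simp: in_arcs_def out_arcs_def doubleton_eq_iff)
      then show ?thesis by simp
    qed
    then show False using \<open>degree G v \<noteq> 1\<close> by (simp add: degree_def in_degree_def out_degree_def)
  qed
  then obtain f where f: "f \<in> arcs G" "f \<noteq> e" "tail G f = v \<or> head G f = v" by blast
  obtain R0 where R0: "\<And>a. a \<in> arcs G \<Longrightarrow> (tail G a \<in> R0) \<noteq> (head G a \<in> R0) \<longleftrightarrow> a = f"
    using bridging_edge_cut[OF wf_digraph_axioms assms(2) all[OF f(1)]] by metis
  define R where "R = (if v \<in> R0 then - R0 else R0)"
  have R: "(tail G a \<in> R) \<noteq> (head G a \<in> R) \<longleftrightarrow> a = f" if "a \<in> arcs G" for a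
    using R0[OF that] by (auto simp: R_def)
  have vR: "v \<notin> R" by (auto simp: R_def)
  have fS: "tail G f \<in> S" "head G f \<in> S" using e(2)[OF f(1)] f v(1) by auto
  have "(tail G a \<in> R \<inter> S) \<noteq> (head G a \<in> R \<inter> S) \<longleftrightarrow> a = f" if a: "a \<in> arcs G" for a
  proof (cases "a = e")
    case True
    have "(tail G e \<in> R) = (head G e \<in> R)" using R[OF e(1)] f(2) by auto
    then have "v' \<notin> R" "v \<notin> R" using v(3) vR by (auto simp: doubleton_eq_iff)
    then have "tail G e \<notin> R" "head G e \<notin> R" using v(3) by (auto simp: doubleton_eq_iff)
    then show ?thesis using True f(2) by auto
  next
    case False
    then show ?thesis using e(2)[OF a] R[OF a] fS by auto
  qed
  then have "P (R \<inter> S)" using f(1) SV unfolding P_def by blast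
  then have "card S \<le> card (R \<inter> S)" by (rule S(2))
  moreover have "card (R \<inter> S) < card S"
    using finS v(1) vR by (intro psubset_card_mono) auto
  ultimately show False by simp
qed

section \<open>Bounds for the spectral gap and the threshold mass\<close>

lemma H1_weak_deriv:
  "H1_interval l f \<Longrightarrow> has_weak_deriv l f (weak_deriv l f)"
  unfolding H1_interval_def weak_deriv_def using someI[of "has_weak_deriv l f"] by blast

lemma mean_zero_minimizes:
  fixes u :: "'e \<Rightarrow> real \<Rightarrow> real"
  assumes E: "finite E" and len: "\<And>e. e \<in> E \<Longrightarrow> 0 < len e"
    and cont: "\<And>e. e \<in> E \<Longrightarrow> continuous_on {0..len e} (u e)"
    and mean: "(\<Sum>e\<in>E. \<integral>x. u e x \<partial>lebesgue_on {0..len e}) = 0"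
  shows "(\<Sum>e\<in>E. \<integral>x. (u e x)\<^sup>2 \<partial>lebesgue_on {0..len e}) \<le> (\<Sum>e\<in>E. \<integral>x. (u e x - c)\<^sup>2 \<partial>lebesgue_on {0..len e})"
proof -
  have "(\<integral>x. (u e x - c)\<^sup>2 \<partial>lebesgue_on {0..len e}) = (\<integral>x. (u e x)\<^sup>2 \<partial>lebesgue_on {0..len e})
      - 2 * c * (\<integral>x. u e x \<partial>lebesgue_on {0..len e}) + c\<^sup>2 * len e" if e: "e \<in> E" for e
  proof -
    have i: "integrable (lebesgue_on {0..len e}) (u e)" "integrable (lebesgue_on {0..len e}) (\<lambda>x. (u e x)\<^sup>2)"
      "integrable (lebesgue_on {0..len e}) (\<lambda>x. c\<^sup>2)"
      by (intro integrable_continuous_lebesgue_on continuous_intros cont e)+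
    have "(\<integral>x. (u e x - c)\<^sup>2 \<partial>lebesgue_on {0..len e}) = (\<integral>x. (u e x)\<^sup>2 - 2 * c * u e x + c\<^sup>2 \<partial>lebesgue_on {0..len e})"
      by (simp add: power2_diff algebra_simps)
    also have "\<dots> = (\<integral>x. (u e x)\<^sup>2 \<partial>lebesgue_on {0..len e}) - 2 * c * (\<integral>x. u e x \<partial>lebesgue_on {0..len e}) + (\<integral>x. c\<^sup>2 \<partial>lebesgue_on {0..len e})"
      using i by simp
    also have "(\<integral>x. c\<^sup>2 \<partial>lebesgue_on {0..len e}) = c\<^sup>2 * len e"
      using len[OF e] by (simp add: measure_restrict_space)
    finally show ?thesis .
  qed
  then have "(\<Sum>e\<in>E. \<integral>x. (u e x - c)\<^sup>2 \<partial>lebesgue_on {0..len e})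
     = (\<Sum>e\<in>E. \<integral>x. (u e x)\<^sup>2 \<partial>lebesgue_on {0..len e}) - 2 * c * (\<Sum>e\<in>E. \<integral>x. u e x \<partial>lebesgue_on {0..len e}) + c\<^sup>2 * (\<Sum>e\<in>E. len e)"
    by (simp add: sum.distrib sum_subtractf sum_distrib_left)
  moreover have "0 \<le> c\<^sup>2 * (\<Sum>e\<in>E. len e)"
    using len by (intro mult_nonneg_nonneg sum_nonneg) (auto simp: less_imp_le)
  ultimately show ?thesis using mean by simp
qed

text \<open>The function \<open>\<rho>\<close> is the real part or the imaginary part.\<close>

lemma component_poincare:
  fixes \<rho> :: "complex \<Rightarrow> real" and G :: "('v, 'e) pre_digraph"
  assumes G: "fin_digraph G" "arcs G \<noteq> {}" and len: "\<And>e. e \<in> arcs G \<Longrightarrow> 0 < len e"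
    and m: "\<And>e. e \<in> arcs G \<Longrightarrow> 1 \<le> m e" and N: "0 < N" "N \<le> 2"
    and cut: "\<And>S. (\<exists>e\<in>arcs G. tail G e \<in> S \<or> head G e \<in> S) \<Longrightarrow> (\<exists>e\<in>arcs G. tail G e \<notin> S \<or> head G e \<notin> S) \<Longrightarrow>
      N \<le> (\<Sum>e | e \<in> arcs G \<and> (tail G e \<in> S) \<noteq> (head G e \<in> S). m e)"
    and u: "u \<in> H1_graph G len" "graph_integral G len u = 0"
    and \<rho>: "bounded_linear \<rho>" "\<And>z. \<bar>\<rho> z\<bar> \<le> norm z"
  shows "(N * pi / (\<Sum>e\<in>arcs G. (m e)\<^sup>2 * len e))\<^sup>2 * graph_integral G len (\<lambda>e x. (\<rho> (u e x))\<^sup>2)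
    \<le> graph_integral G len (\<lambda>e x. (\<rho> (weak_deriv (len e) (u e) x))\<^sup>2)"
proof -
  interpret fin_digraph G by fact
  interpret \<rho>: bounded_linear \<rho> by fact
  have cont: "continuous_on {0..len e} (u e)" and wd: "has_weak_deriv (len e) (u e) (weak_deriv (len e) (u e))" if "e \<in> arcs G" for e
    using u(1) that H1_weak_deriv by (auto simp: H1_graph_def graph_continuous_def)
  obtain val where val: "\<And>e. e \<in> arcs G \<Longrightarrow> u e 0 = val (tail G e)" "\<And>e. e \<in> arcs G \<Longrightarrow> u e (len e) = val (head G e)"
    using u(1) by (auto simp: H1_graph_def graph_continuous_def)
  have contr: "continuous_on {0..len e} (\<lambda>x. \<rho> (u e x))" if "e \<in> arcs G" for e
    by (intro \<rho>.continuous_on cont that)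
  define g where "g e x = weak_deriv (len e) (u e) x" for e x
  have L2: "L2_interval (len e) (g e)" if "e \<in> arcs G" for e
    using wd[OF that] by (simp add: has_weak_deriv_def g_def[abs_def])
  note gi = L2_interval_integrable[OF L2]
  have \<rho>m: "(\<lambda>x. \<rho> (g e x)) \<in> borel_measurable (lebesgue_on {0..len e})" if "e \<in> arcs G" for e
    by (intro borel_measurable_integrable integrable_bounded_linear[OF \<rho>(1) gi[OF that]])
  have \<rho>2: "integrable (lebesgue_on {0..len e}) (\<lambda>x. (\<rho> (g e x))\<^sup>2)" if "e \<in> arcs G" for e
  proof (rule Bochner_Integration.integrable_bound)
    show "integrable (lebesgue_on {0..len e}) (\<lambda>x. (norm (g e x))\<^sup>2)" using L2[OF that] by (simp add: L2_interval_def)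
    show "(\<lambda>x. (\<rho> (g e x))\<^sup>2) \<in> borel_measurable (lebesgue_on {0..len e})" using \<rho>m[OF that] by simp
    show "AE x in lebesgue_on {0..len e}. norm ((\<rho> (g e x))\<^sup>2) \<le> norm ((norm (g e x))\<^sup>2)"
      using \<rho>(2) power_mono[OF \<rho>(2) abs_ge_zero, of _ 2] by (intro AE_I2) simp
  qed
  have ftc: "\<rho> (u e y) - \<rho> (u e x) = (\<integral>t. indicator {x<..<y} t * \<rho> (g e t) \<partial>lebesgue_on {0..len e})"
    if e: "e \<in> arcs G" and xy: "0 \<le> x" "x \<le> y" "y \<le> len e" for e x y
  proof -
    have s: "{x<..<y} \<in> sets (lebesgue_on {0..len e})" using xy by (subst sets_restrict_space_iff) auto
    have "\<rho> (u e y) - \<rho> (u e x) = \<rho> (\<integral>t. indicator {x<..<y} t *\<^sub>R g e t \<partial>lebesgue_on {0..len e})"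
      using weak_deriv_integral[OF wd[OF e] cont[OF e] xy] by (simp add: \<rho>.diff[symmetric] g_def)
    also have "\<dots> = (\<integral>t. \<rho> (indicator {x<..<y} t *\<^sub>R g e t) \<partial>lebesgue_on {0..len e})"
      by (intro integral_bounded_linear[symmetric] \<rho>(1) integrable_mult_indicator s gi e)
    finally show ?thesis by (simp add: \<rho>.scaleR)
  qed
  obtain c where c: "(N * pi / (\<Sum>e\<in>arcs G. (m e)\<^sup>2 * len e))\<^sup>2 * (\<Sum>e\<in>arcs G. (m e)\<^sup>2 * (\<integral>x. (\<rho> (u e x) - c)\<^sup>2 \<partial>lebesgue_on {0..len e}))
    \<le> (\<Sum>e\<in>arcs G. \<integral>x. (\<rho> (g e x))\<^sup>2 \<partial>lebesgue_on {0..len e})"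
    using weighted_poincare[of "arcs G" len m "\<lambda>e x. \<rho> (u e x)" "\<lambda>v. \<rho> (val v)" "tail G" "head G" "\<lambda>e x. \<rho> (g e x)" N,
        OF finite_arcs G(2) len m contr _ _ \<rho>m \<rho>2 ftc N cut] val by auto
  have "(\<Sum>e\<in>arcs G. \<integral>x. \<rho> (u e x) \<partial>lebesgue_on {0..len e}) = \<rho> (graph_integral G len u)"
    unfolding graph_integral_def \<rho>.sum
    by (intro sum.cong refl integral_bounded_linear \<rho>(1) integrable_continuous_lebesgue_on cont)
  then have mean: "(\<Sum>e\<in>arcs G. \<integral>x. \<rho> (u e x) \<partial>lebesgue_on {0..len e}) = 0" using u(2) by (simp add: \<rho>.zero)
  have "(\<Sum>e\<in>arcs G. \<integral>x. (\<rho> (u e x))\<^sup>2 \<partial>lebesgue_on {0..len e}) \<le> (\<Sum>e\<in>arcs G. \<integral>x. (\<rho> (u e x) - c)\<^sup>2 \<partial>lebesgue_on {0..len e})"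
    by (rule mean_zero_minimizes[OF finite_arcs len contr mean])
  also have "\<dots> \<le> (\<Sum>e\<in>arcs G. (m e)\<^sup>2 * (\<integral>x. (\<rho> (u e x) - c)\<^sup>2 \<partial>lebesgue_on {0..len e}))"
  proof (rule sum_mono)
    fix e assume "e \<in> arcs G"
    then have "1 \<le> (m e)\<^sup>2" using m by simp
    then show "(\<integral>x. (\<rho> (u e x) - c)\<^sup>2 \<partial>lebesgue_on {0..len e}) \<le> (m e)\<^sup>2 * (\<integral>x. (\<rho> (u e x) - c)\<^sup>2 \<partial>lebesgue_on {0..len e})"
      using mult_right_mono[of 1 "(m e)\<^sup>2" "\<integral>x. (\<rho> (u e x) - c)\<^sup>2 \<partial>lebesgue_on {0..len e}"]
      by (simp add: Bochner_Integration.integral_nonneg)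
  qed
  finally have "(N * pi / (\<Sum>e\<in>arcs G. (m e)\<^sup>2 * len e))\<^sup>2 * graph_integral G len (\<lambda>e x. (\<rho> (u e x))\<^sup>2)
     \<le> (N * pi / (\<Sum>e\<in>arcs G. (m e)\<^sup>2 * len e))\<^sup>2 * (\<Sum>e\<in>arcs G. (m e)\<^sup>2 * (\<integral>x. (\<rho> (u e x) - c)\<^sup>2 \<partial>lebesgue_on {0..len e}))"
    unfolding graph_integral_def by (rule mult_left_mono) simp
  also note c
  finally show ?thesis by (simp add: graph_integral_def g_def)
qed

lemma graph_norm_square_pos:
  assumes G: "fin_digraph G" and len: "\<And>e. e \<in> arcs G \<Longrightarrow> 0 < len e"
    and u: "u \<in> H1_graph G len" "e \<in> arcs G" "x \<in> {0..len e}" "u e x \<noteq> 0"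
  shows "0 < graph_integral G len (\<lambda>e x. (norm (u e x))\<^sup>2)"
proof -
  interpret fin_digraph G by fact
  have c: "continuous_on {0..len e} (\<lambda>x. (norm (u e x))\<^sup>2)" if "e \<in> arcs G" for e
    using u(1) that by (intro continuous_intros) (auto simp: H1_graph_def graph_continuous_def)
  have "(\<integral>x. (norm (u e x))\<^sup>2 \<partial>lebesgue_on {0..len e}) \<noteq> 0"
  proof
    assume "(\<integral>x. (norm (u e x))\<^sup>2 \<partial>lebesgue_on {0..len e}) = 0"
    then have "integral {0..len e} (\<lambda>x. (norm (u e x))\<^sup>2) = 0"
      using lebesgue_integral_eq_integral[OF integrable_continuous_lebesgue_on[OF c[OF u(2)]]] by simp
    then have "(norm (u e x))\<^sup>2 = 0"
      using integral_eq_0_iff[OF c[OF u(2)] len[OF u(2)]] u(3) by simp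
    with u(4) show False by simp
  qed
  then have "0 < (\<integral>x. (norm (u e x))\<^sup>2 \<partial>lebesgue_on {0..len e})"
    by (simp add: less_le Bochner_Integration.integral_nonneg)
  then show ?thesis
    unfolding graph_integral_def using u(2)
    by (intro sum_pos2[of _ e]) (auto intro!: Bochner_Integration.integral_nonneg)
qed

lemma rayleigh_quotient_ge:
  fixes G :: "('v, 'e) pre_digraph"
  assumes G: "fin_digraph G" and len: "\<And>e. e \<in> arcs G \<Longrightarrow> 0 < len e"
    and m: "\<And>e. e \<in> arcs G \<Longrightarrow> 1 \<le> m e" and N: "0 < N" "N \<le> 2"
    and cut: "\<And>S. (\<exists>e\<in>arcs G. tail G e \<in> S \<or> head G e \<in> S) \<Longrightarrow> (\<exists>e\<in>arcs G. tail G e \<notin> S \<or> head G e \<notin> S) \<Longrightarrow>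
      N \<le> (\<Sum>e | e \<in> arcs G \<and> (tail G e \<in> S) \<noteq> (head G e \<in> S). m e)"
    and u: "u \<in> H1_graph G len" "\<exists>e\<in>arcs G. \<exists>x\<in>{0..len e}. u e x \<noteq> 0" "graph_integral G len u = 0"
  shows "(N * pi / (\<Sum>e\<in>arcs G. (m e)\<^sup>2 * len e))\<^sup>2 \<le> rayleigh_quotient G len u"
proof -
  interpret fin_digraph G by fact
  have ne: "arcs G \<noteq> {}" using u(2) by auto
  let ?k = "(N * pi / (\<Sum>e\<in>arcs G. (m e)\<^sup>2 * len e))\<^sup>2"
  let ?g = "\<lambda>e. weak_deriv (len e) (u e)"
  have cont: "continuous_on {0..len e} (u e)" and L2: "L2_interval (len e) (?g e)" if "e \<in> arcs G" for e
    using u(1) that H1_weak_deriv by (auto simp: H1_graph_def graph_continuous_def has_weak_deriv_def)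
  have split: "graph_integral G len (\<lambda>e x. (norm (w e x))\<^sup>2)
      = graph_integral G len (\<lambda>e x. (Re (w e x))\<^sup>2) + graph_integral G len (\<lambda>e x. (Im (w e x))\<^sup>2)"
    if L2: "\<And>e. e \<in> arcs G \<Longrightarrow> L2_interval (len e) (w e)" for w
  proof -
    have "(\<integral>x. (norm (w e x))\<^sup>2 \<partial>lebesgue_on {0..len e})
        = (\<integral>x. (Re (w e x))\<^sup>2 \<partial>lebesgue_on {0..len e}) + (\<integral>x. (Im (w e x))\<^sup>2 \<partial>lebesgue_on {0..len e})" if e: "e \<in> arcs G" for e
    proof -
      have n2: "integrable (lebesgue_on {0..len e}) (\<lambda>x. (norm (w e x))\<^sup>2)" and wm: "w e \<in> borel_measurable (lebesgue_on {0..len e})"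
        using L2[OF e] by (auto simp: L2_interval_def)
      have i: "integrable (lebesgue_on {0..len e}) (\<lambda>x. (Re (w e x))\<^sup>2)" "integrable (lebesgue_on {0..len e}) (\<lambda>x. (Im (w e x))\<^sup>2)"
        using wm by (auto intro!: Bochner_Integration.integrable_bound[OF n2] simp: cmod_power2)
      show ?thesis using i by (simp add: cmod_power2)
    qed
    then show ?thesis by (simp add: graph_integral_def sum.distrib)
  qed
  have "?k * graph_integral G len (\<lambda>e x. (norm (u e x))\<^sup>2) \<le> graph_integral G len (\<lambda>e x. (norm (?g e x))\<^sup>2)"
    using component_poincare[OF G ne len m N cut u(1,3) bounded_linear_Re abs_Re_le_cmod]
      component_poincare[OF G ne len m N cut u(1,3) bounded_linear_Im abs_Im_le_cmod]
    by (simp add: split[OF continuous_L2_interval[OF cont]] split[OF L2] distrib_left)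
  moreover have "0 < graph_integral G len (\<lambda>e x. (norm (u e x))\<^sup>2)"
    using u(2) graph_norm_square_pos[OF G len u(1)] by blast
  ultimately show ?thesis unfolding rayleigh_quotient_def by (simp add: pos_le_divide_eq)
qed

lemma integral_cos_minus_const:
  fixes l c :: real
  assumes l: "0 < l"
  shows "(\<integral>x. cos (pi * x / l) - c \<partial>lebesgue_on {0..l}) = - c * l"
    and "(\<integral>x. (cos (pi * x / l) - c)\<^sup>2 \<partial>lebesgue_on {0..l}) = l / 2 + c\<^sup>2 * l"
    and "(\<integral>x. (pi / l * sin (pi * x / l))\<^sup>2 \<partial>lebesgue_on {0..l}) = pi\<^sup>2 / (2 * l)"
proof -
  have dl: "pi * l / l = pi" using l by simp
  have cont: "continuous_on {0..l} (\<lambda>x. cos (pi * x / l))" "continuous_on {0..l} (\<lambda>x. sin (pi * x / l))"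
    by (intro continuous_intros; use l in auto)+
  have "(\<integral>x. cos (pi * x / l) - c \<partial>lebesgue_on {0..l})
     = (\<lambda>x. l / pi * sin (pi * x / l) - c * x) l - (\<lambda>x. l / pi * sin (pi * x / l) - c * x) 0"
  proof (rule integral_lebesgue_on_FTC)
    fix t
    have "((\<lambda>x. l / pi * sin (pi * x / l) - c * x) has_real_derivative cos (pi * t / l) - c) (at t)"
      using l by (auto intro!: derivative_eq_intros simp: field_simps)
    then show "((\<lambda>x. l / pi * sin (pi * x / l) - c * x) has_vector_derivative cos (pi * t / l) - c) (at t within {0..l})"
      by (simp add: has_real_derivative_iff_has_vector_derivative has_vector_derivative_at_within)
  qed (use l in \<open>auto intro!: continuous_intros cont\<close>)
  then show "(\<integral>x. cos (pi * x / l) - c \<partial>lebesgue_on {0..l}) = - c * l" by (simp add: dl)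
  let ?F = "\<lambda>x. x / 2 + l / (2 * pi) * (sin (pi * x / l) * cos (pi * x / l)) - 2 * c * (l / pi) * sin (pi * x / l) + c\<^sup>2 * x"
  have "(\<integral>x. (cos (pi * x / l) - c)\<^sup>2 \<partial>lebesgue_on {0..l}) = ?F l - ?F 0"
  proof (rule integral_lebesgue_on_FTC)
    fix t
    have cs: "(sin (pi * t / l))\<^sup>2 = 1 - (cos (pi * t / l))\<^sup>2" by (simp add: sin_squared_eq)
    have "(?F has_real_derivative (1 / 2 + 1 / 2 * ((cos (pi * t / l))\<^sup>2 - (sin (pi * t / l))\<^sup>2) - 2 * c * cos (pi * t / l) + c\<^sup>2)) (at t)"
      using l by (auto intro!: derivative_eq_intros simp: field_simps power2_eq_square)
    also have "(1 / 2 + 1 / 2 * ((cos (pi * t / l))\<^sup>2 - (sin (pi * t / l))\<^sup>2) - 2 * c * cos (pi * t / l) + c\<^sup>2) = (cos (pi * t / l) - c)\<^sup>2"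
      unfolding cs by (simp add: power2_diff algebra_simps)
    finally show "(?F has_vector_derivative (cos (pi * t / l) - c)\<^sup>2) (at t within {0..l})"
      by (simp add: has_real_derivative_iff_has_vector_derivative has_vector_derivative_at_within)
  qed (use l in \<open>auto intro!: continuous_intros cont\<close>)
  then show "(\<integral>x. (cos (pi * x / l) - c)\<^sup>2 \<partial>lebesgue_on {0..l}) = l / 2 + c\<^sup>2 * l" by (simp add: dl)
  let ?H = "\<lambda>x. (pi / l)\<^sup>2 * (x / 2 - l / (2 * pi) * (sin (pi * x / l) * cos (pi * x / l)))"
  have "(\<integral>x. (pi / l * sin (pi * x / l))\<^sup>2 \<partial>lebesgue_on {0..l}) = ?H l - ?H 0"
  proof (rule integral_lebesgue_on_FTC)
    fix t
    have cs: "(cos (pi * t / l))\<^sup>2 = 1 - (sin (pi * t / l))\<^sup>2" by (simp add: cos_squared_eq)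
    have "(?H has_real_derivative (pi / l)\<^sup>2 * (1 / 2 - 1 / 2 * ((cos (pi * t / l))\<^sup>2 - (sin (pi * t / l))\<^sup>2))) (at t)"
      using l by (intro DERIV_cmult) (auto intro!: derivative_eq_intros simp: field_simps power2_eq_square)
    also have "(pi / l)\<^sup>2 * (1 / 2 - 1 / 2 * ((cos (pi * t / l))\<^sup>2 - (sin (pi * t / l))\<^sup>2)) = (pi / l * sin (pi * t / l))\<^sup>2"
    proof -
      have "1 / 2 - 1 / 2 * ((1 - X) - X) = X" for X :: real by (simp add: field_simps)
      then show ?thesis unfolding cs power_mult_distrib by simp
    qed
    finally show "(?H has_vector_derivative (pi / l * sin (pi * t / l))\<^sup>2) (at t within {0..l})"
      by (simp add: has_real_derivative_iff_has_vector_derivative has_vector_derivative_at_within)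
  qed (use l in \<open>auto intro!: continuous_intros cont\<close>)
  also have "\<dots> = pi\<^sup>2 / (2 * l)" using l by (simp add: dl power2_eq_square field_simps)
  finally show "(\<integral>x. (pi / l * sin (pi * x / l))\<^sup>2 \<partial>lebesgue_on {0..l}) = pi\<^sup>2 / (2 * l)" .
qed

text \<open>
  The test function is \<open>cos (\<pi> x / len e0)\<close> on the bridge and \<open>\<plusminus>1\<close> on its two sides, minus its mean \<open>c\<close>.
\<close>

lemma bridge_test_function:
  fixes G :: "('v, 'e) pre_digraph"
  assumes G: "fin_digraph G" and len: "\<And>e. e \<in> arcs G \<Longrightarrow> 0 < len e" and e0: "e0 \<in> arcs G"
    and S: "\<And>a. a \<in> arcs G \<Longrightarrow> (tail G a \<in> S) \<noteq> (head G a \<in> S) \<longleftrightarrow> a = e0"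
  shows "\<exists>u\<in>H1_graph G len. (\<exists>e\<in>arcs G. \<exists>x\<in>{0..len e}. u e x \<noteq> 0) \<and> graph_integral G len u = 0
     \<and> rayleigh_quotient G len u \<le> (pi / len e0)\<^sup>2"
proof -
  interpret fin_digraph G by fact
  let ?l = "len e0"
  let ?E = "arcs G - {e0}"
  have l: "0 < ?l" using len e0 by simp
  define s :: real where "s = (if tail G e0 \<in> S then 1 else -1)"
  define \<sigma> where "\<sigma> v = (if v \<in> S then s else - s)" for v
  have \<sigma>0: "\<sigma> (tail G e0) = 1" "\<sigma> (head G e0) = -1" using S[OF e0] by (auto simp: \<sigma>_def s_def)
  have \<sigma>: "\<sigma> (head G e) = \<sigma> (tail G e)" if "e \<in> ?E" for e using S[of e] that by (auto simp: \<sigma>_def)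
  have \<sigma>2: "(\<sigma> v)\<^sup>2 = 1" "\<bar>\<sigma> v\<bar> = 1" for v by (auto simp: \<sigma>_def s_def)
  define R where "R = (\<Sum>e\<in>?E. len e)"
  define A where "A = (\<Sum>e\<in>?E. \<sigma> (tail G e) * len e)"
  define L where "L = ?l + R"
  define c where "c = A / L"
  have R: "0 \<le> R" unfolding R_def using len by (intro sum_nonneg) (auto simp: less_imp_le)
  have L: "0 < L" using l R by (simp add: L_def)
  \<comment> \<open>subtracting the mean lowers the squared norm by \<open>A\<^sup>2 / L\<close>, which the two sides compensate\<close>
  have "\<bar>A\<bar> \<le> R"
    unfolding A_def R_def using len
    by (intro order_trans[OF sum_abs] sum_mono) (auto simp: abs_mult \<sigma>2 less_imp_le)
  then have "A\<^sup>2 \<le> R\<^sup>2" using abs_le_square_iff[of A R] R by simp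
  also have "R\<^sup>2 \<le> R * L" using R l by (simp add: power2_eq_square L_def mult_left_mono)
  finally have AR: "A\<^sup>2 / L \<le> R" using L by (simp add: pos_divide_le_eq)
  define v where "v e x = (if e = e0 then cos (pi * x / ?l) else \<sigma> (tail G e)) - c" for e x
  define v' where "v' e x = (if e = e0 then - (pi / ?l * sin (pi * x / ?l)) else 0)" for e x
  define u where "u e x = complex_of_real (v e x)" for e x
  have dv: "((\<lambda>x. v e x) has_real_derivative v' e x) (at x)" for e x
    using l unfolding v_def v'_def by (cases "e = e0") (auto intro!: derivative_eq_intros simp: field_simps)
  have du: "(u e has_vector_derivative complex_of_real (v' e x)) (at x within X)" for e x X
    unfolding u_def[abs_def]
    by (intro has_vector_derivative_of_real) (use dv in \<open>auto intro: has_field_derivative_at_within\<close>)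
  have cv': "continuous_on X (\<lambda>x. complex_of_real (v' e x))" for e X
    unfolding v'_def using l by (cases "e = e0") (auto intro!: continuous_intros)
  have cu: "continuous_on X (u e)" for e X
    using du by (rule continuous_on_vector_derivative)
  have cv: "continuous_on X (v e)" for e X
    using dv by (meson DERIV_isCont continuous_at_imp_continuous_on)
  have wd: "has_weak_deriv (len e) (u e) (\<lambda>x. complex_of_real (v' e x))" if "e \<in> arcs G" for e
    by (rule C1_has_weak_deriv[OF len[OF that] du cv'])
  have wd': "\<exists>g. has_weak_deriv (len e) (u e) g" if "e \<in> arcs G" for e
    using wd[OF that] by blast
  have "u e 0 = complex_of_real (\<sigma> (tail G e) - c) \<and> u e (len e) = complex_of_real (\<sigma> (head G e) - c)" if "e \<in> arcs G" for e
    using that \<sigma>[of e] \<sigma>0 l by (cases "e = e0") (auto simp: u_def v_def)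
  then have uH: "u \<in> H1_graph G len"
    unfolding H1_graph_def graph_continuous_def H1_interval_def
    using cu continuous_L2_interval[OF cu]
    by (intro CollectI conjI exI[of _ "\<lambda>v. complex_of_real (\<sigma> v - c)"] ballI) (auto intro: wd')
  have split: "(\<Sum>e\<in>arcs G. h e) = h e0 + (\<Sum>e\<in>?E. h e)" for h :: "'e \<Rightarrow> real"
    using e0 by (simp add: sum.remove)
  have const: "(\<integral>x. (k :: real) \<partial>lebesgue_on {0..len e}) = k * len e" if "e \<in> ?E" for e k
    using len[of e] that by (simp add: measure_restrict_space)
  have v0: "v e0 = (\<lambda>x. cos (pi * x / ?l) - c)" "v' e0 = (\<lambda>x. - (pi / ?l * sin (pi * x / ?l)))"
    by (auto simp: v_def v'_def)
  have v1: "v e = (\<lambda>x. \<sigma> (tail G e) - c)" "v' e = (\<lambda>x. 0)" if "e \<in> ?E" for e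
    using that by (auto simp: v_def v'_def)
  have "graph_integral G len u = complex_of_real (\<Sum>e\<in>arcs G. \<integral>x. v e x \<partial>lebesgue_on {0..len e})"
    by (simp add: graph_integral_def u_def)
  also have "(\<Sum>e\<in>arcs G. \<integral>x. v e x \<partial>lebesgue_on {0..len e}) = - c * ?l + (\<Sum>e\<in>?E. (\<sigma> (tail G e) - c) * len e)"
    unfolding split v0 integral_cos_minus_const(1)[OF l]
    by (intro arg_cong2[where f="(+)"] refl sum.cong) (simp only: v1 const)
  also have "\<dots> = A - c * L"
    by (simp add: A_def L_def R_def algebra_simps sum_subtractf sum_distrib_left)
  also have "\<dots> = 0" using L by (simp add: c_def)
  finally have mean: "graph_integral G len u = 0" by simp
  have "graph_integral G len (\<lambda>e x. (norm (u e x))\<^sup>2) = (\<Sum>e\<in>arcs G. \<integral>x. (v e x)\<^sup>2 \<partial>lebesgue_on {0..len e})"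
    by (simp add: graph_integral_def u_def)
  also have "\<dots> = ?l / 2 + c\<^sup>2 * ?l + (\<Sum>e\<in>?E. (\<sigma> (tail G e) - c)\<^sup>2 * len e)"
    unfolding split v0 integral_cos_minus_const(2)[OF l]
    by (intro arg_cong2[where f="(+)"] refl sum.cong) (simp only: v1 const)
  also have "(\<Sum>e\<in>?E. (\<sigma> (tail G e) - c)\<^sup>2 * len e) = (\<Sum>e\<in>?E. len e - 2 * c * (\<sigma> (tail G e) * len e) + c\<^sup>2 * len e)"
    by (intro sum.cong refl) (simp add: power2_diff \<sigma>2(1) algebra_simps)
  also have "\<dots> = R - 2 * c * A + c\<^sup>2 * R"
    by (simp add: sum.distrib sum_subtractf sum_distrib_left R_def A_def)
  also have "?l / 2 + c\<^sup>2 * ?l + (R - 2 * c * A + c\<^sup>2 * R) = ?l / 2 + (R - 2 * c * A + c\<^sup>2 * L)"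
    by (simp add: L_def algebra_simps)
  also have "\<dots> = ?l / 2 + (R - A\<^sup>2 / L)"
    using L by (simp add: c_def power2_eq_square)
  finally have den: "graph_integral G len (\<lambda>e x. (norm (u e x))\<^sup>2) \<ge> ?l / 2" using AR by simp
  have "graph_integral G len (\<lambda>e x. (norm (weak_deriv (len e) (u e) x))\<^sup>2)
     = (\<Sum>e\<in>arcs G. \<integral>x. (v' e x)\<^sup>2 \<partial>lebesgue_on {0..len e})"
    unfolding graph_integral_def
    using integral_weak_deriv_square[OF len cu wd] by (intro sum.cong) auto
  also have "\<dots> = pi\<^sup>2 / (2 * ?l)"
    unfolding split v0 power2_minus integral_cos_minus_const(3)[OF l] by (simp add: v1)
  finally have num: "graph_integral G len (\<lambda>e x. (norm (weak_deriv (len e) (u e) x))\<^sup>2) = pi\<^sup>2 / (2 * ?l)" .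
  have "rayleigh_quotient G len u \<le> (pi\<^sup>2 / (2 * ?l)) / (?l / 2)"
    unfolding rayleigh_quotient_def num using den l by (intro divide_left_mono mult_pos_pos) auto
  also have "\<dots> = (pi / ?l)\<^sup>2" using l by (simp add: power2_eq_square field_simps)
  finally have rq: "rayleigh_quotient G len u \<le> (pi / ?l)\<^sup>2" .
  have "u e0 0 \<noteq> 0 \<or> u e0 ?l \<noteq> 0"
    using l by (auto simp: u_def v_def)
  then have "\<exists>e\<in>arcs G. \<exists>x\<in>{0..len e}. u e x \<noteq> 0" using e0 l by force
  with uH mean rq show ?thesis by blast
qed

context compact_metric_graph
begin

lemma rayleigh_quotient_nonneg: "0 \<le> rayleigh_quotient G len u"
  unfolding rayleigh_quotient_def graph_integral_def
  by (intro divide_nonneg_nonneg sum_nonneg Bochner_Integration.integral_nonneg) auto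

lemma bridging_edge_test_function:
  assumes "bridging_edge G e"
  obtains u where "u \<in> H1_graph G len" "\<exists>e\<in>arcs G. \<exists>x\<in>{0..len e}. u e x \<noteq> 0"
    "graph_integral G len u = 0" "rayleigh_quotient G len u \<le> (pi / len e)\<^sup>2"
proof -
  have e: "e \<in> arcs G" using assms by (simp add: bridging_edge_def)
  obtain S where S: "\<forall>a\<in>arcs G. (tail G a \<in> S) \<noteq> (head G a \<in> S) \<longleftrightarrow> a = e"
    using bridging_edge_cut[OF wf_digraph_axioms graph_connected assms] by (rule exE)
  have "\<exists>u\<in>H1_graph G len. (\<exists>e\<in>arcs G. \<exists>x\<in>{0..len e}. u e x \<noteq> 0) \<and> graph_integral G len u = 0
     \<and> rayleigh_quotient G len u \<le> (pi / len e)\<^sup>2"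
    by (rule bridge_test_function[OF fin_digraph_axioms _ e], erule len_pos, erule S[rule_format])
  then show thesis by (rule bexE) (elim conjE, rule that)
qed

lemma lambda2_le:
  assumes "bridging_edge G e"
  shows "lambda2 G len \<le> (pi / len e)\<^sup>2"
proof -
  obtain u where u: "u \<in> H1_graph G len" "\<exists>e\<in>arcs G. \<exists>x\<in>{0..len e}. u e x \<noteq> 0" "graph_integral G len u = 0"
     "rayleigh_quotient G len u \<le> (pi / len e)\<^sup>2"
    by (rule bridging_edge_test_function[OF assms])
  have "lambda2 G len \<le> rayleigh_quotient G len u"
    unfolding lambda2_def
  proof (rule cInf_lower)
    show "bdd_below {rayleigh_quotient G len u | u. u \<in> H1_graph G len \<and>
      (\<exists>e\<in>arcs G. \<exists>x\<in>{0..len e}. u e x \<noteq> 0) \<and> graph_integral G len u = 0}"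
      using rayleigh_quotient_nonneg by (intro bdd_belowI[of _ 0]) blast
  qed (use u(1-3) in blast)
  with u(4) show ?thesis by simp
qed

lemma lambda2_ge:
  assumes e: "bridging_edge G e"
    and m: "\<And>e. e \<in> arcs G \<Longrightarrow> 1 \<le> m e" and N: "0 < N" "N \<le> 2"
    and cut: "\<And>S. (\<exists>e\<in>arcs G. tail G e \<in> S \<or> head G e \<in> S) \<Longrightarrow> (\<exists>e\<in>arcs G. tail G e \<notin> S \<or> head G e \<notin> S) \<Longrightarrow>
      N \<le> (\<Sum>e | e \<in> arcs G \<and> (tail G e \<in> S) \<noteq> (head G e \<in> S). m e)"
  shows "(N * pi / (\<Sum>e\<in>arcs G. (m e)\<^sup>2 * len e))\<^sup>2 \<le> lambda2 G len"
  unfolding lambda2_def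
proof (rule cInf_greatest)
  obtain u where "u \<in> H1_graph G len" "\<exists>e\<in>arcs G. \<exists>x\<in>{0..len e}. u e x \<noteq> 0" "graph_integral G len u = 0"
    by (rule bridging_edge_test_function[OF e])
  then show "{rayleigh_quotient G len u | u. u \<in> H1_graph G len \<and>
    (\<exists>e\<in>arcs G. \<exists>x\<in>{0..len e}. u e x \<noteq> 0) \<and> graph_integral G len u = 0} \<noteq> {}" by blast
  fix r assume "r \<in> {rayleigh_quotient G len u | u. u \<in> H1_graph G len \<and>
    (\<exists>e\<in>arcs G. \<exists>x\<in>{0..len e}. u e x \<noteq> 0) \<and> graph_integral G len u = 0}"
  then obtain u where u: "r = rayleigh_quotient G len u" "u \<in> H1_graph G len"
    "\<exists>e\<in>arcs G. \<exists>x\<in>{0..len e}. u e x \<noteq> 0" "graph_integral G len u = 0"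
    by blast
  show "(N * pi / (\<Sum>e\<in>arcs G. (m e)\<^sup>2 * len e))\<^sup>2 \<le> r"
    unfolding u(1) by (rule rayleigh_quotient_ge[OF fin_digraph_axioms len_pos m N cut u(2-4)])
qed

lemma total_length_pos: "e \<in> arcs G \<Longrightarrow> 0 < total_length G len"
  unfolding total_length_def using len_pos by (intro sum_pos) auto

lemma mu1_le:
  assumes "bridging_edge G e"
  shows "mu1 G len \<le> total_length G len * pi / (2 * len e)"
proof -
  have e: "e \<in> arcs G" using assms by (simp add: bridging_edge_def)
  have "lambda2 G len / 4 \<le> (pi / (2 * len e))\<^sup>2" using lambda2_le[OF assms] by (simp add: power_divide)
  then have "sqrt (lambda2 G len / 4) \<le> pi / (2 * len e)"
    using len_pos[OF e] by (intro real_le_lsqrt) auto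
  then show ?thesis
    unfolding mu1_def using mult_left_mono[OF _ less_imp_le[OF total_length_pos[OF e]]] by fastforce
qed

lemma mu1_ge:
  assumes e: "bridging_edge G e"
    and m: "\<And>e. e \<in> arcs G \<Longrightarrow> 1 \<le> m e" and N: "0 < N" "N \<le> 2"
    and cut: "\<And>S. (\<exists>e\<in>arcs G. tail G e \<in> S \<or> head G e \<in> S) \<Longrightarrow> (\<exists>e\<in>arcs G. tail G e \<notin> S \<or> head G e \<notin> S) \<Longrightarrow>
      N \<le> (\<Sum>e | e \<in> arcs G \<and> (tail G e \<in> S) \<noteq> (head G e \<in> S). m e)"
  shows "N * pi / 2 * (total_length G len / (\<Sum>e\<in>arcs G. (m e)\<^sup>2 * len e)) \<le> mu1 G len"
proof -
  have ea: "e \<in> arcs G" using e by (simp add: bridging_edge_def)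
  let ?T = "\<Sum>e\<in>arcs G. (m e)\<^sup>2 * len e"
  have "(N * pi / ?T / 2)\<^sup>2 \<le> lambda2 G len / 4"
    using lambda2_ge[OF e m N cut] by (simp add: power_divide)
  then have "N * pi / ?T / 2 \<le> sqrt (lambda2 G len / 4)" by (rule real_le_rsqrt)
  then have "total_length G len * (N * pi / ?T / 2) \<le> mu1 G len"
    unfolding mu1_def using total_length_pos[OF ea] by (intro mult_left_mono) auto
  then show ?thesis by (simp add: mult.commute mult.left_commute)
qed

end

section \<open>Long and short bridges\<close>

theorem theorem2p5:
  fixes G :: "('v, 'e) pre_digraph"
    and len :: "real \<Rightarrow> 'e \<Rightarrow> real"
    and e0 :: 'e
  assumes graphs: "\<And>l. l > 0 \<Longrightarrow> compact_metric_graph G (len l)"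
    and no_terminal: "\<And>e. e \<in> arcs G \<Longrightarrow> \<not> terminal_edge G e"
    and no_covering: "\<not> has_cycle_covering G"
    and e0_bridging: "bridging_edge G e0"
    and e0_length: "\<And>l. l > 0 \<Longrightarrow> len l e0 = l"
    and nonbridging_fixed:
      "\<And>e l l'. e \<in> arcs G \<Longrightarrow> \<not> bridging_edge G e \<Longrightarrow> l > 0 \<Longrightarrow> l' > 0 \<Longrightarrow> len l e = len l' e"
    and bridging_le: "\<And>e l. bridging_edge G e \<Longrightarrow> e \<noteq> e0 \<Longrightarrow> l > 0 \<Longrightarrow> len l e \<le> l"
    and bridging_bounded:
      "\<exists>M. \<forall>e l. bridging_edge G e \<longrightarrow> e \<noteq> e0 \<longrightarrow> l > 0 \<longrightarrow> len l e \<le> M"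
  shows "((\<lambda>l. mu1 G (len l)) \<longlongrightarrow> pi / 2) at_top \<and>
    Liminf (at_right 0) (\<lambda>l. ereal (mu1 G (len l))) \<ge> ereal pi"
proof
  interpret G1: compact_metric_graph G "len 1" by (rule graphs) simp
  note fin = G1.fin_digraph_axioms and conn = G1.graph_connected
  have e0: "e0 \<in> arcs G" using e0_bridging by (simp add: bridging_edge_def)
  have finE: "finite (arcs G)" by (rule G1.finite_arcs)
  have lpos: "0 < len l e" if "0 < l" "e \<in> arcs G" for l e
    using compact_metric_graph.len_pos[OF graphs] that by blast
  have Tpos: "0 < total_length G (len l)" if "0 < l" for l
    using compact_metric_graph.total_length_pos[OF graphs[OF that] e0] .
  have lower: "pi / 2 \<le> mu1 G (len l)" if "0 < l" for l
    using compact_metric_graph.mu1_ge[OF graphs[OF that] e0_bridging, of "\<lambda>_. 1" 1] cut_card_ge_1[OF fin conn] Tpos[OF that]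
    by (simp add: total_length_def)
  obtain M where M: "\<And>e l. bridging_edge G e \<Longrightarrow> e \<noteq> e0 \<Longrightarrow> l > 0 \<Longrightarrow> len l e \<le> M" using bridging_bounded by blast
  define K where "K = (\<Sum>e\<in>arcs G - {e0}. \<bar>M\<bar> + len 1 e)"
  have TK: "total_length G (len l) \<le> l + K" if l: "0 < l" for l
  proof -
    have "total_length G (len l) = l + (\<Sum>e\<in>arcs G - {e0}. len l e)"
      unfolding total_length_def using e0 finE e0_length[OF l] by (simp add: sum.remove)
    also have "(\<Sum>e\<in>arcs G - {e0}. len l e) \<le> K"
      unfolding K_def
    proof (rule sum_mono)
      fix e assume e: "e \<in> arcs G - {e0}"
      have "0 < len 1 e" using lpos[of 1 e] e by simp
      then show "len l e \<le> \<bar>M\<bar> + len 1 e"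
        using M[of e l] nonbridging_fixed[of e l 1] e l by (cases "bridging_edge G e") auto
    qed
    finally show ?thesis by simp
  qed
  have upper: "mu1 G (len l) \<le> pi / 2 * (1 + K / l)" if l: "0 < l" for l
  proof -
    have "mu1 G (len l) \<le> total_length G (len l) * pi / (2 * l)"
      using compact_metric_graph.mu1_le[OF graphs[OF l] e0_bridging] e0_length[OF l] by simp
    also have "\<dots> \<le> (l + K) * pi / (2 * l)"
      using TK[OF l] l by (intro divide_right_mono mult_right_mono) auto
    also have "\<dots> = pi / 2 * (1 + K / l)" using l by (simp add: field_simps)
    finally show ?thesis .
  qed
  show "((\<lambda>l. mu1 G (len l)) \<longlongrightarrow> pi / 2) at_top"
  proof (rule tendsto_sandwich)
    show "eventually (\<lambda>l. pi / 2 \<le> mu1 G (len l)) at_top"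
      using eventually_gt_at_top[of 0] by eventually_elim (rule lower)
    show "eventually (\<lambda>l. mu1 G (len l) \<le> pi / 2 * (1 + K / l)) at_top"
      using eventually_gt_at_top[of 0] by eventually_elim (rule upper)
    have "((\<lambda>l. K / l) \<longlongrightarrow> 0) at_top"
      by (intro tendsto_divide_0[OF tendsto_const] filterlim_at_top_imp_at_infinity filterlim_ident)
    then have "((\<lambda>l. pi / 2 * (1 + K / l)) \<longlongrightarrow> pi / 2 * (1 + 0)) at_top" by (intro tendsto_intros)
    then show "((\<lambda>l. pi / 2 * (1 + K / l)) \<longlongrightarrow> pi / 2) at_top" by simp
  qed simp
  define L0 where "L0 = (\<Sum>e | e \<in> arcs G \<and> \<not> bridging_edge G e. len 1 e)"
  have L0: "0 < L0"
    unfolding L0_def using nonbridging_edge_exists[OF fin conn e0 no_terminal] finE lpos[of 1]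
    by (intro sum_pos) auto
  define n where "n = real (card (arcs G))"
  \<comment> \<open>doubling the bridges, of total length \<open>b\<close>, replaces the length \<open>L0 + b\<close> by \<open>L0 + 4 b\<close>\<close>
  have lower0: "pi * (1 - 3 * n * l / L0) \<le> mu1 G (len l)" if l: "0 < l" for l
  proof -
    define b where "b = (\<Sum>e | e \<in> arcs G \<and> bridging_edge G e. len l e)"
    have split: "(\<Sum>e\<in>arcs G. h e) = (\<Sum>e | e \<in> arcs G \<and> \<not> bridging_edge G e. h e) + (\<Sum>e | e \<in> arcs G \<and> bridging_edge G e. h e)" for h :: "'e \<Rightarrow> real"
      using finE by (subst sum.union_disjoint[symmetric]) (auto intro!: sum.cong)
    have nonbridges: "(\<Sum>e | e \<in> arcs G \<and> \<not> bridging_edge G e. len l e) = L0"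
      unfolding L0_def using l by (intro sum.cong refl nonbridging_fixed) auto
    have T: "total_length G (len l) = L0 + b" unfolding total_length_def split nonbridges b_def by simp
    have W: "(\<Sum>e\<in>arcs G. (bridge_multiplicity G e)\<^sup>2 * len l e) = L0 + 4 * b"
      unfolding split b_def nonbridges[symmetric] by (simp add: bridge_multiplicity_def sum_distrib_left)
    have b0: "0 \<le> b" unfolding b_def using lpos[OF l] by (intro sum_nonneg) (auto simp: less_imp_le)
    have "b \<le> (\<Sum>e | e \<in> arcs G \<and> bridging_edge G e. l)"
      unfolding b_def using bridging_le e0_length l by (intro sum_mono) (metis mem_Collect_eq order_refl)
    also have "\<dots> \<le> (\<Sum>e\<in>arcs G. l)" using finE l by (intro sum_mono2) auto
    finally have bn: "b \<le> n * l" by (simp add: n_def)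
    have "3 * b / (L0 + 4 * b) \<le> 3 * b / L0" using L0 b0 by (intro divide_left_mono) auto
    also have "\<dots> \<le> 3 * (n * l) / L0" using L0 bn by (intro divide_right_mono) auto
    finally have "1 - 3 * n * l / L0 \<le> 1 - 3 * b / (L0 + 4 * b)" by simp
    also have "\<dots> = (L0 + b) / (L0 + 4 * b)" using L0 b0 by (simp add: field_simps)
    finally have "pi * (1 - 3 * n * l / L0) \<le> pi * ((L0 + b) / (L0 + 4 * b))" by (intro mult_left_mono) auto
    also have "\<dots> \<le> mu1 G (len l)"
      using compact_metric_graph.mu1_ge[OF graphs[OF l] e0_bridging, of "bridge_multiplicity G" 2] cut_weight_ge_2[OF fin conn]
      unfolding T W by (simp add: bridge_multiplicity_def)
    finally show ?thesis .
  qed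
  have "((\<lambda>l. pi * (1 - 3 * n * l / L0)) \<longlongrightarrow> pi * (1 - 3 * n * 0 / L0)) (at_right 0)"
    using L0 by (intro tendsto_intros) auto
  then have "((\<lambda>l. ereal (pi * (1 - 3 * n * l / L0))) \<longlongrightarrow> ereal pi) (at_right 0)" by simp
  then have "ereal pi = Liminf (at_right 0) (\<lambda>l. ereal (pi * (1 - 3 * n * l / L0)))"
    by (intro lim_imp_Liminf[symmetric]) auto
  also have "\<dots> \<le> Liminf (at_right 0) (\<lambda>l. ereal (mu1 G (len l)))"
  proof (rule Liminf_mono)
    show "eventually (\<lambda>l. ereal (pi * (1 - 3 * n * l / L0)) \<le> ereal (mu1 G (len l))) (at_right 0)"
      using eventually_at_right_less[of 0] by eventually_elim (simp add: lower0)
  qed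
  finally show "Liminf (at_right 0) (\<lambda>l. ereal (mu1 G (len l))) \<ge> ereal pi" .
qed

end
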